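(* Let $L$ be a hyperbolic automorphism of the torus $\mathbf{T}^2$. Let $F$ be a finite set of periodic points of $L$, and for each $p\in F$ let $a_p>0$ and $b_p>0$ be arbitrary real numbers, subject only to $a_p=a_q$ and $b_p=b_q$ when $p,q\in F$ lie on the same orbit. Then there exist an Anosov diffeomorphism $g:N\to N$ of class $C^{1+\alpha}$ for some $0<\alpha<1$, a homeomorphism $h:\mathbf{T}^2\to N$ with $g\circ h=h\circ L$, and real constants $P_u,P_s$ (not unique), such that for every $p\in F$, of period $n$, $$|\lambda_u(h(p))|^{1/n}=e^{-P_u}\,a_p,\qquad |\lambda_s(h(p))|^{1/n}=e^{P_s}\,b_p .$$
   Context: A hyperbolic automorphism of $\mathbf{T}^2=\mathbf{R}^2/\mathbf{Z}^2$ is the map induced by a matrix in $GL(2,\mathbf{Z})$ with no eigenvalue of absolute value $1$. A diffeomorphism $g$ of a compact manifold $N$ is Anosov if $TN$ has a continuous $Dg$-invariant splitting $E^s\oplus E^u$ with $E^s$ uniformly exponentially contracted by forward iterates and $E^u$ uniformly exponentially contracted by backward iterates of $g$. If $q$ is a periodic point of $g$ of period $n$ (and $N$ is two-dimensional), $\lambda_u(q)$ and $\lambda_s(q)$ denote the eigenvalues of $Dg^n(q)$ on the one-dimensional spaces $E^u(q)$ and $E^s(q)$ respectively. *)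

theory Defs
  imports "HOL-Analysis.Analysis" "HOL-Combinatorics.Cycles" "HOL-Combinatorics.Orbits"
begin

section \<open>The torus and its hyperbolic automorphisms\<close>

definition torus_rel :: "real^2 \<Rightarrow> real^2 \<Rightarrow> bool" where
  "torus_rel x y \<longleftrightarrow> (\<forall>i. x $ i - y $ i \<in> \<int>)"

lemma equivp_torus_rel: "equivp torus_rel"
proof (rule equivpI)
  show "reflp torus_rel"
    by (auto simp: reflp_def torus_rel_def)
  show "symp torus_rel"
    unfolding symp_def torus_rel_def by (metis Ints_minus minus_diff_eq)
  show "transp torus_rel"
    unfolding transp_def torus_rel_def
  proof (intro allI impI)
    fix x y z :: "real^2" and i
    assume "\<forall>i. x $ i - y $ i \<in> \<int>" "\<forall>i. y $ i - z $ i \<in> \<int>"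
    then have "(x $ i - y $ i) + (y $ i - z $ i) \<in> \<int>" by (intro Ints_add) auto
    then show "x $ i - z $ i \<in> \<int>" by simp
  qed
qed

quotient_type torus = "real^2" / torus_rel
  by (rule equivp_torus_rel)

instantiation torus :: topological_space
begin

definition open_torus :: "torus set \<Rightarrow> bool" where
  "open_torus U \<longleftrightarrow> open (abs_torus -` U)"

instance
proof
  show "open (UNIV :: torus set)" by (simp add: open_torus_def)
next
  fix S T :: "torus set" assume "open S" "open T"
  then show "open (S \<inter> T)" by (simp add: open_torus_def vimage_Int open_Int)
next
  fix K :: "torus set set" assume "\<forall>S\<in>K. open S"
  then show "open (\<Union> K)" by (auto simp: open_torus_def vimage_Union intro!: open_UN)
qed

end

definition int_matrix :: "int^2^2 \<Rightarrow> 'a::ring_1^2^2" where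
  "int_matrix A = (\<chi> i j. of_int (A $ i $ j))"

lift_definition toral_map :: "int^2^2 \<Rightarrow> torus \<Rightarrow> torus" is "\<lambda>A x. int_matrix A *v x"
proof -
  fix A :: "int^2^2" and x y :: "real^2"
  assume *: "torus_rel x y"
  have "(int_matrix A *v x) $ i - (int_matrix A *v y) $ i
      = (\<Sum>j\<in>UNIV. of_int (A $ i $ j) * (x $ j - y $ j))" for i
    by (simp add: int_matrix_def matrix_vector_mult_def sum_subtractf right_diff_distrib)
  with * show "torus_rel (int_matrix A *v x) (int_matrix A *v y)"
    by (auto simp: torus_rel_def intro!: Ints_sum Ints_mult)
qed

text \<open>Invertibility of an integer matrix means that the inverse is also an integer matrix, i.e.
  membership in \<open>GL(2,Z)\<close>. Eigenvalues are taken in the complex numbers.\<close>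

definition hyperbolic_matrix :: "int^2^2 \<Rightarrow> bool" where
  "hyperbolic_matrix A \<longleftrightarrow> invertible A \<and>
     (\<forall>(z::complex) (v::complex^2). v \<noteq> 0 \<and> int_matrix A *v v = z *s v \<longrightarrow> norm z \<noteq> 1)"

definition hyperbolic_automorphism :: "(torus \<Rightarrow> torus) \<Rightarrow> bool" where
  "hyperbolic_automorphism L \<longleftrightarrow> (\<exists>A. hyperbolic_matrix A \<and> L = toral_map A)"


section \<open>Regularity classes on open subsets of normed spaces\<close>

primrec Ck_on :: "nat \<Rightarrow> ('a::real_normed_vector \<Rightarrow> 'b::real_normed_vector) \<Rightarrow> 'a set \<Rightarrow> bool" where
  "Ck_on 0 f S \<longleftrightarrow> continuous_on S f"
| "Ck_on (Suc k) f S \<longleftrightarrow>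
     (\<exists>f'. (\<forall>x\<in>S. (f has_derivative f' x) (at x)) \<and> (\<forall>v. Ck_on k (\<lambda>x. f' x v) S))"

definition smooth_on :: "('a::real_normed_vector \<Rightarrow> 'b::real_normed_vector) \<Rightarrow> 'a set \<Rightarrow> bool" where
  "smooth_on f S \<longleftrightarrow> (\<forall>k. Ck_on k f S)"

text \<open>The derivative is locally Hoelder continuous with exponent \<open>\<alpha>\<close>. For maps of compact
  manifolds this local condition in charts is the same as a global one.\<close>

definition C1_holder_on ::
  "real \<Rightarrow> ('a::real_normed_vector \<Rightarrow> 'b::real_normed_vector) \<Rightarrow> 'a set \<Rightarrow> bool" where
  "C1_holder_on \<alpha> f S \<longleftrightarrow> (\<exists>f' :: 'a \<Rightarrow> 'a \<Rightarrow>\<^sub>L 'b.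
     (\<forall>x\<in>S. (f has_derivative blinfun_apply (f' x)) (at x)) \<and>
     (\<forall>x\<in>S. \<exists>\<epsilon>>0. \<exists>C. \<forall>y\<in>ball x \<epsilon> \<inter> S. \<forall>z\<in>ball x \<epsilon> \<inter> S.
        norm (f' y - f' z) \<le> C * dist y z powr \<alpha>))"


section \<open>Smooth manifolds\<close>

text \<open>A chart is a pair of a domain and a coordinate map; the values of the coordinate map
  outside the domain are irrelevant. A manifold is given by a topology, whose \<open>topspace\<close> is the
  underlying set, and an atlas, not assumed to be maximal.\<close>

type_synonym ('a, 'e) chart = "'a set \<times> ('a \<Rightarrow> 'e)"

definition chart_inv :: "('a, 'e) chart \<Rightarrow> 'e \<Rightarrow> 'a" where
  "chart_inv c = inv_into (fst c) (snd c)"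

definition is_chart :: "'a topology \<Rightarrow> ('a, 'e::euclidean_space) chart \<Rightarrow> bool" where
  "is_chart X c \<longleftrightarrow> openin X (fst c) \<and> open (snd c ` fst c) \<and>
     homeomorphic_map (subtopology X (fst c)) (top_of_set (snd c ` fst c)) (snd c)"

definition smooth_manifold :: "'a topology \<Rightarrow> ('a, 'e::euclidean_space) chart set \<Rightarrow> bool" where
  "smooth_manifold X A \<longleftrightarrow>
     Hausdorff_space X \<and> second_countable X \<and>
     (\<forall>c\<in>A. is_chart X c) \<and> (\<Union>c\<in>A. fst c) = topspace X \<and>
     (\<forall>c\<in>A. \<forall>d\<in>A. smooth_on (snd d \<circ> chart_inv c) (snd c ` (fst c \<inter> fst d)))"

definition C1_holder_map ::
  "real \<Rightarrow> 'a topology \<Rightarrow> ('a, 'e::euclidean_space) chart set \<Rightarrow> ('a \<Rightarrow> 'a) \<Rightarrow> bool" where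
  "C1_holder_map \<alpha> X A f \<longleftrightarrow> continuous_map X X f \<and>
     (\<forall>c\<in>A. \<forall>d\<in>A. C1_holder_on \<alpha> (snd d \<circ> f \<circ> chart_inv c) (snd c ` (fst c \<inter> f -` fst d)))"

definition C1_holder_diffeo ::
  "real \<Rightarrow> 'a topology \<Rightarrow> ('a, 'e::euclidean_space) chart set \<Rightarrow> ('a \<Rightarrow> 'a) \<Rightarrow> bool" where
  "C1_holder_diffeo \<alpha> X A f \<longleftrightarrow> bij_betw f (topspace X) (topspace X) \<and>
     C1_holder_map \<alpha> X A f \<and> C1_holder_map \<alpha> X A (inv_into (topspace X) f)"


section \<open>Tangent spaces\<close>

text \<open>The tangent space at \<open>x\<close> is identified with the model space \<open>'e\<close> by means of one chart
  \<open>chart_at A x\<close> around \<open>x\<close>, chosen once and for all. In particular, if \<open>f x = x\<close> then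
  \<open>mderiv A f x\<close> is the derivative as an endomorphism of a single copy of the tangent space.\<close>

definition chart_at :: "('a, 'e) chart set \<Rightarrow> 'a \<Rightarrow> ('a, 'e) chart" where
  "chart_at A x = (SOME c. c \<in> A \<and> x \<in> fst c)"

definition mderiv ::
  "('a, 'e::euclidean_space) chart set \<Rightarrow> ('a \<Rightarrow> 'a) \<Rightarrow> 'a \<Rightarrow> 'e \<Rightarrow> 'e" where
  "mderiv A f x =
     frechet_derivative (snd (chart_at A (f x)) \<circ> f \<circ> chart_inv (chart_at A x))
       (at (snd (chart_at A x) x))"

text \<open>Change of coordinates, at the point \<open>x\<close>, from the chart \<open>c\<close> to the chart \<open>d\<close>.\<close>

definition tcoord :: "('a, 'e::euclidean_space) chart \<Rightarrow> ('a, 'e) chart \<Rightarrow> 'a \<Rightarrow> 'e \<Rightarrow> 'e" where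
  "tcoord c d x = frechet_derivative (snd d \<circ> chart_inv c) (at (snd c x))"

definition continuous_riemannian_metric ::
  "'a topology \<Rightarrow> ('a, 'e::euclidean_space) chart set \<Rightarrow> ('a \<Rightarrow> 'e \<Rightarrow> 'e \<Rightarrow> real) \<Rightarrow> bool" where
  "continuous_riemannian_metric X A G \<longleftrightarrow>
     (\<forall>x\<in>topspace X. bilinear (G x) \<and> (\<forall>u v. G x u v = G x v u) \<and> (\<forall>v. v \<noteq> 0 \<longrightarrow> G x v v > 0)) \<and>
     (\<forall>c\<in>A. \<forall>u v. continuous_map (subtopology X (fst c)) euclideanreal
        (\<lambda>x. G x (tcoord c (chart_at A x) x u) (tcoord c (chart_at A x) x v)))"

text \<open>A continuous subbundle of the tangent bundle: around each point, in the coordinates of some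
  chart, the fibres have a basis depending continuously on the base point.\<close>

definition continuous_subbundle ::
  "'a topology \<Rightarrow> ('a, 'e::euclidean_space) chart set \<Rightarrow> ('a \<Rightarrow> 'e set) \<Rightarrow> bool" where
  "continuous_subbundle X A E \<longleftrightarrow>
     (\<forall>x\<in>topspace X. subspace (E x)) \<and>
     (\<forall>x\<in>topspace X. \<exists>c\<in>A. \<exists>W (k::nat) (e :: nat \<Rightarrow> 'a \<Rightarrow> 'e).
        openin X W \<and> x \<in> W \<and> W \<subseteq> fst c \<and>
        (\<forall>i<k. continuous_map (subtopology X W) euclidean (e i)) \<and>
        (\<forall>y\<in>W. inj_on (\<lambda>i. e i y) {..<k} \<and> independent ((\<lambda>i. e i y) ` {..<k}) \<and>
           tcoord (chart_at A y) c y ` E y = span ((\<lambda>i. e i y) ` {..<k})))"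


section \<open>Anosov diffeomorphisms\<close>

text \<open>\<open>Es\<close> and \<open>Eu\<close> form an Anosov splitting for the diffeomorphism \<open>g\<close>. On a compact manifold
  the choice of the Riemannian metric does not matter.\<close>

definition anosov_splitting ::
  "'a topology \<Rightarrow> ('a, 'e::euclidean_space) chart set \<Rightarrow> ('a \<Rightarrow> 'a) \<Rightarrow>
     ('a \<Rightarrow> 'e set) \<Rightarrow> ('a \<Rightarrow> 'e set) \<Rightarrow> bool" where
  "anosov_splitting X A g Es Eu \<longleftrightarrow>
     continuous_subbundle X A Es \<and> continuous_subbundle X A Eu \<and>
     (\<forall>x\<in>topspace X. Es x \<inter> Eu x = {0} \<and> {v + w | v w. v \<in> Es x \<and> w \<in> Eu x} = UNIV) \<and>
     (\<forall>x\<in>topspace X. mderiv A g x ` Es x = Es (g x) \<and> mderiv A g x ` Eu x = Eu (g x)) \<and>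
     (\<exists>G C \<mu>. continuous_riemannian_metric X A G \<and> 0 < C \<and> 0 < \<mu> \<and> \<mu> < 1 \<and>
        (\<forall>x\<in>topspace X. \<forall>n.
           (\<forall>v\<in>Es x. let y = (g ^^ n) x; w = mderiv A (g ^^ n) x v in
              sqrt (G y w w) \<le> C * \<mu> ^ n * sqrt (G x v v)) \<and>
           (\<forall>v\<in>Eu x. let f = inv_into (topspace X) g ^^ n; y = f x; w = mderiv A f x v in
              sqrt (G y w w) \<le> C * \<mu> ^ n * sqrt (G x v v))))"

definition anosov_diffeo ::
  "real \<Rightarrow> 'a topology \<Rightarrow> ('a, 'e::euclidean_space) chart set \<Rightarrow> ('a \<Rightarrow> 'a) \<Rightarrow>
     ('a \<Rightarrow> 'e set) \<Rightarrow> ('a \<Rightarrow> 'e set) \<Rightarrow> bool" where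
  "anosov_diffeo \<alpha> X A g Es Eu \<longleftrightarrow>
     smooth_manifold X A \<and> compact_space X \<and> C1_holder_diffeo \<alpha> X A g \<and>
     anosov_splitting X A g Es Eu"

text \<open>The eigenvalue of the derivative of the first return map at a periodic point \<open>q\<close> on an
  invariant line \<open>E q\<close>; \<open>least_power g q\<close> is the period of \<open>q\<close>. Meaningful only if
  \<open>dim (E q) = 1\<close>.\<close>

definition periodic_eigenvalue ::
  "('a, 'e::euclidean_space) chart set \<Rightarrow> ('a \<Rightarrow> 'a) \<Rightarrow> ('a \<Rightarrow> 'e set) \<Rightarrow> 'a \<Rightarrow> real" where
  "periodic_eigenvalue A g E q =
     (THE l. \<forall>v\<in>E q. mderiv A (g ^^ least_power g q) q v = l *\<^sub>R v)"

definition periodic_point :: "('a \<Rightarrow> 'a) \<Rightarrow> 'a \<Rightarrow> bool" where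
  "periodic_point f p \<longleftrightarrow> (\<exists>n>0. (f ^^ n) p = p)"

end

theory Submission
  imports Defs
begin

text \<open>Write points of the plane in eigencoordinates \<open>(s, u)\<close> of \<open>L\<close>, with eigenvalues \<open>\<mu>s\<close> and \<open>\<mu>u\<close>.
  The diffeomorphism is a perturbation \<open>g(s, u) = (\<mu>s (s + \<eta>), \<mu>u (u + \<psi>))\<close> on the standard torus, with
  \<open>\<eta>\<close> and \<open>\<psi>\<close> sums of bumps at the orbits of \<open>F\<close> that vanish on these orbits. Since \<open>P\<^sub>u\<close> and \<open>P\<^sub>s\<close> are free,
  all prescribed unstable rates may be taken above \<open>\<bar>\<mu>u\<bar>\<close> and all stable ones below \<open>\<bar>\<mu>s\<bar>\<close>. Then the bumps
  only have to strengthen the hyperbolicity at their centres, which is possible with arbitrarily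
  small loss elsewhere and arbitrarily small off-diagonal derivatives. So \<open>g\<close> has invariant cones and
  is Anosov, its derivative is diagonal on the orbits of \<open>F\<close>, and the conjugacy to \<open>L\<close> is given by
  explicit geometric series.\<close>

section \<open>The torus as a smooth manifold\<close>

text \<open>The prescribed rates may differ from those of \<open>L\<close> by arbitrary factors, so
  \<open>g\<close> need not be C^1-close to \<open>L\<close>, and structural stability cannot be
  quoted. What survives is one-sided control: the diagonal factor is at most
  \<open>1 + \<epsilon>\<close> along \<open>s\<close> and at least \<open>1 - \<epsilon>\<close>
  along \<open>u\<close>, with off-diagonal entries small even after multiplication by the square of
  \<open>\<mu>u\<close>. After normalization each bump has a coefficient of fixed sign. A profile
  increasing along \<open>u\<close> with a nonnegative coefficient can lower the derivative only
  through its cutoff; that loss scales with the height of the bump, which can be shrunk without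
  changing the slope at the centre. The series give only a map \<open>k\<close> of the plane with
  \<open>k \<circ> g = A \<circ> k\<close>. It is at bounded distance from the identity, hence onto;
  it is injective because the cone estimates hold for pairs of points at any distance and make
  \<open>g\<close> expansive on the plane. The conjugacy \<open>h\<close> is the inverse of the
  torus map of \<open>k\<close> and fixes every prescribed periodic point.\<close>

lemma torus_rel_refl [simp]: "torus_rel x x"
  by (simp add: torus_rel_def)

lemma torus_rel_sym: "torus_rel x y \<Longrightarrow> torus_rel y x"
  using equivp_torus_rel by (meson equivp_symp)

lemma torus_rel_trans: "torus_rel x y \<Longrightarrow> torus_rel y z \<Longrightarrow> torus_rel x z"
  using equivp_torus_rel by (meson equivp_transp)

lemma torus_rel_diff: "torus_rel x y \<longleftrightarrow> torus_rel (x - y) 0"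
  by (simp add: torus_rel_def)

lemma abs_torus_eq_iff: "abs_torus x = abs_torus y \<longleftrightarrow> torus_rel x y"
  using torus.abs_eq_iff by blast

lemma abs_rep_torus [simp]: "abs_torus (rep_torus t) = t"
  by (meson Quotient_torus Quotient_abs_rep)

lemma torus_rel_rep_abs: "torus_rel (rep_torus (abs_torus x)) x"
  by (metis abs_torus_eq_iff abs_rep_torus)

lemma open_torus_iff: "open (V::torus set) \<longleftrightarrow> open (abs_torus -` V)"
  by (simp add: open_torus_def)

lemma continuous_on_abs_torus [continuous_intros]: "continuous_on T abs_torus"
proof -
  have "continuous_on UNIV abs_torus"
    by (simp add: continuous_on_open_vimage open_torus_iff)
  then show ?thesis by (rule continuous_on_subset) simp
qed

lemma continuous_on_torus_iff:
  fixes F :: "torus \<Rightarrow> 'b::topological_space"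
  shows "continuous_on UNIV F \<longleftrightarrow> continuous_on UNIV (F \<circ> abs_torus)"
  by (simp add: continuous_on_open_vimage open_torus_iff vimage_comp o_def)

text \<open>The full preimage of the image is the union of the translates of \<open>S\<close> by
  integer vectors. Openness of the projection gives both the charts and the countable base.\<close>

lemma open_abs_torus_image:
  assumes "open S"
  shows "open (abs_torus ` S)"
proof -
  have "abs_torus -` abs_torus ` S = (\<Union>m\<in>{m. torus_rel m 0}. (+) m ` S)" (is "?l = ?r")
  proof
    show "?l \<subseteq> ?r"
    proof
      fix x assume "x \<in> ?l"
      then obtain y where y: "y \<in> S" "torus_rel x y" by (auto simp: abs_torus_eq_iff)
      then have "torus_rel (x - y) 0" using torus_rel_diff by blast
      moreover have "x = (x - y) + y" by simp
      ultimately show "x \<in> ?r" using y by blast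
    qed
  next
    show "?r \<subseteq> ?l"
    proof
      fix x assume "x \<in> ?r"
      then obtain m y where "torus_rel m 0" "y \<in> S" "x = m + y" by blast
      then have "torus_rel x y" using torus_rel_diff[of x y] by simp
      then have "abs_torus x = abs_torus y" by (simp add: abs_torus_eq_iff)
      then show "x \<in> ?l" using \<open>y \<in> S\<close> by blast
    qed
  qed
  then show ?thesis
    using assms by (simp add: open_torus_iff open_UN open_translation)
qed

text \<open>Some coordinate differs by a nonzero integer. The gap makes the projection injective on
  small balls and forces continuous lattice-valued functions to be locally constant.\<close>

lemma torus_rel_separated:
  assumes "x \<noteq> y" "torus_rel x y"
  shows "1 \<le> dist x y"
proof -
  obtain i where i: "x $ i \<noteq> y $ i" using assms(1) by (meson vec_eq_iff)
  obtain k :: int where k: "x $ i - y $ i = of_int k"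
    using assms(2) by (auto simp: torus_rel_def elim: Ints_cases)
  have "k \<noteq> 0" using i k by auto
  then have "1 \<le> \<bar>x $ i - y $ i\<bar>" unfolding k by linarith
  also have "\<dots> = dist (x $ i) (y $ i)" by (simp add: dist_real_def)
  also have "\<dots> \<le> dist x y" by (rule dist_vec_nth_le)
  finally show ?thesis .
qed

text \<open>The exponentials do not depend on the representative, are continuous on the quotient and
  jointly separate points, so disjoint neighbourhoods can be pulled back from the complex
  plane.\<close>

definition circle_coord :: "2 \<Rightarrow> torus \<Rightarrow> complex" where
  "circle_coord i t = cis (2 * pi * rep_torus t $ i)"

lemma cis_torus_rel:
  assumes "torus_rel x y" shows "cis (2 * pi * x $ i) = cis (2 * pi * y $ i)"
proof -
  obtain k :: int where "x $ i - y $ i = of_int k"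
    using assms by (auto simp: torus_rel_def elim: Ints_cases)
  then have "2 * pi * x $ i = 2 * pi * y $ i + 2 * pi * of_int k" by (simp add: algebra_simps)
  then have "sin (2 * pi * x $ i) = sin (2 * pi * y $ i) \<and> cos (2 * pi * x $ i) = cos (2 * pi * y $ i)"
    using sin_cos_eq_iff by blast
  then show ?thesis by (simp add: complex_eq_iff)
qed

lemma circle_coord_abs: "circle_coord i (abs_torus x) = cis (2 * pi * x $ i)"
  unfolding circle_coord_def by (rule cis_torus_rel[OF torus_rel_rep_abs])

lemma continuous_circle_coord: "continuous_on UNIV (circle_coord i)"
  by (auto simp: continuous_on_torus_iff circle_coord_abs o_def cis_conv_exp intro!: continuous_intros)

lemma circle_coord_inj:
  assumes "\<And>i. circle_coord i s = circle_coord i t" shows "s = t"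
proof -
  obtain x y where st: "s = abs_torus x" "t = abs_torus y" by (metis abs_rep_torus)
  have "torus_rel x y" unfolding torus_rel_def
  proof
    fix i
    have "cis (2 * pi * x $ i) = cis (2 * pi * y $ i)"
      using assms[of i] by (simp add: st circle_coord_abs)
    then have "sin (2 * pi * x $ i) = sin (2 * pi * y $ i) \<and> cos (2 * pi * x $ i) = cos (2 * pi * y $ i)"
      by (simp add: complex_eq_iff)
    then obtain k :: int where "2 * pi * x $ i = 2 * pi * y $ i + 2 * pi * of_int k"
      using sin_cos_eq_iff by blast
    then have "2 * pi * (x $ i - y $ i) = 2 * pi * of_int k" by (simp add: algebra_simps)
    then have "x $ i - y $ i = of_int k" by simp
    then show "x $ i - y $ i \<in> \<int>" by simp
  qed
  then show ?thesis by (simp add: st abs_torus_eq_iff)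
qed

instance torus :: t2_space
proof
  fix s t :: torus assume "s \<noteq> t"
  then obtain i where i: "circle_coord i s \<noteq> circle_coord i t" using circle_coord_inj by blast
  obtain V W where VW: "open V" "open W" "circle_coord i s \<in> V" "circle_coord i t \<in> W" "V \<inter> W = {}"
    using hausdorff[OF i] by blast
  have "open (circle_coord i -` V)" "open (circle_coord i -` W)"
    using continuous_circle_coord VW by (auto simp: continuous_on_open_vimage)
  with VW show "\<exists>U V. open U \<and> open V \<and> s \<in> U \<and> t \<in> V \<and> U \<inter> V = {}"
    by (intro exI[of _ "circle_coord i -` V"] exI[of _ "circle_coord i -` W"]) auto
qed

section \<open>Compactness, Hausdorff property and countable base\<close>

lemma abs_torus_unit_cube: "abs_torus ` cbox 0 (\<chi> i. 1) = UNIV"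
proof -
  have "t \<in> abs_torus ` cbox 0 (\<chi> i. 1)" for t
  proof -
    let ?x = "\<chi> i. frac (rep_torus t $ i)"
    have "torus_rel ?x (rep_torus t)" by (simp add: torus_rel_def frac_def)
    then have "abs_torus ?x = t" by (metis abs_rep_torus abs_torus_eq_iff)
    moreover have "?x \<in> cbox 0 (\<chi> i. 1)"
      by (simp add: mem_box_cart frac_lt_1 less_imp_le)
    ultimately show ?thesis by (metis image_eqI)
  qed
  then show ?thesis by blast
qed

lemma compact_torus: "compact (UNIV :: torus set)"
  by (metis abs_torus_unit_cube compact_cbox compact_continuous_image continuous_on_abs_torus)

lemma Hausdorff_torus: "Hausdorff_space (euclidean :: torus topology)"
  unfolding Hausdorff_space_def disjnt_def using hausdorff by (metis open_openin)

lemma second_countable_torus: "second_countable (euclidean :: torus topology)"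
proof -
  obtain B :: "(real^2) set set" where B: "countable B" "topological_basis B"
    using ex_countable_basis by blast
  show ?thesis
    unfolding second_countable_def
  proof (intro exI conjI ballI allI impI)
    show "countable ((\<lambda>b. abs_torus ` b) ` B)" using B by simp
  next
    fix V assume "V \<in> (\<lambda>b. abs_torus ` b) ` B"
    then show "openin euclidean V"
      using topological_basis_open[OF B(2)] open_abs_torus_image by (metis imageE open_openin)
  next
    fix V :: "torus set" and t assume "openin euclidean V \<and> t \<in> V"
    then have V: "open (abs_torus -` V)" "rep_torus t \<in> abs_torus -` V"
      by (simp_all add: open_torus_iff[symmetric])
    then obtain b where b: "b \<in> B" "rep_torus t \<in> b" "b \<subseteq> abs_torus -` V"
      using topological_basisE[OF B(2)] by metis
    have "t \<in> abs_torus ` b" using b(2) by (metis abs_rep_torus image_eqI)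
    moreover have "abs_torus ` b \<subseteq> V" using b(3) by blast
    ultimately show "\<exists>U\<in>(\<lambda>b. abs_torus ` b) ` B. t \<in> U \<and> U \<subseteq> V"
      using b(1) by blast
  qed
qed

section \<open>Charts as local inverses of the projection\<close>

definition torus_chart :: "real^2 \<Rightarrow> (torus, real^2) chart" where
  "torus_chart z = (abs_torus ` ball z (1/4), inv_into (ball z (1/4)) abs_torus)"

definition torus_atlas :: "(torus, real^2) chart set" where
  "torus_atlas = range torus_chart"

lemma fst_torus_chart: "fst (torus_chart z) = abs_torus ` ball z (1/4)"
  by (simp add: torus_chart_def)

text \<open>Two points of a ball of radius 1/4 are at distance less than 1, whereas distinct
  equivalent points are at distance at least 1.\<close>

lemma inj_on_abs_torus_ball: "inj_on abs_torus (ball z (1/4))"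
proof (rule inj_onI, rule ccontr)
  fix x y assume xy: "x \<in> ball z (1/4)" "y \<in> ball z (1/4)" "abs_torus x = abs_torus y" "x \<noteq> y"
  then have "1 \<le> dist x y" using torus_rel_separated abs_torus_eq_iff by blast
  moreover have "dist x y \<le> dist z x + dist z y" by (metis dist_commute dist_triangle)
  ultimately show False using xy by simp
qed

lemma torus_chart_abs:
  "x \<in> ball z (1/4) \<Longrightarrow> snd (torus_chart z) (abs_torus x) = x"
  by (simp add: torus_chart_def inv_into_f_f[OF inj_on_abs_torus_ball])

lemma torus_chart_image: "snd (torus_chart z) ` fst (torus_chart z) = ball z (1/4)"
proof -
  have "(\<lambda>x. snd (torus_chart z) (abs_torus x)) ` ball z (1/4) = (\<lambda>x. x) ` ball z (1/4)"
    by (rule image_cong[OF refl torus_chart_abs])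
  then show ?thesis by (simp add: fst_torus_chart image_image)
qed

lemma torus_chart_inv:
  assumes "x \<in> ball z (1/4)" shows "chart_inv (torus_chart z) x = abs_torus x"
proof -
  have "inj_on (snd (torus_chart z)) (fst (torus_chart z))"
    by (rule inj_onI) (auto simp: fst_torus_chart torus_chart_abs)
  then show ?thesis
    unfolding chart_inv_def using assms
    by (intro inv_into_f_eq) (auto simp: fst_torus_chart torus_chart_abs)
qed

lemma is_chart_torus_chart: "is_chart euclidean (torus_chart z)"
proof -
  let ?B = "ball z (1/4)"
  have "homeomorphic_map (top_of_set ?B) (top_of_set (abs_torus ` ?B)) abs_torus"
  proof (rule bijective_open_imp_homeomorphic_map)
    show "continuous_map (top_of_set ?B) (top_of_set (abs_torus ` ?B)) abs_torus"
      by (auto simp: continuous_on_abs_torus)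
    show "open_map (top_of_set ?B) (top_of_set (abs_torus ` ?B)) abs_torus"
      unfolding open_map_def
    proof (intro allI impI)
      fix V assume "openin (top_of_set ?B) V"
      then have "open V" "V \<subseteq> ?B" by (auto simp: openin_open_eq)
      then show "openin (top_of_set (abs_torus ` ?B)) (abs_torus ` V)"
        by (simp add: openin_open_eq open_abs_torus_image image_mono)
    qed
    show "inj_on abs_torus (topspace (top_of_set ?B))" by (simp add: inj_on_abs_torus_ball)
  qed auto
  then obtain k where k: "homeomorphic_maps (top_of_set ?B) (top_of_set (abs_torus ` ?B)) abs_torus k"
    unfolding homeomorphic_map_maps by blast
  then have "homeomorphic_map (top_of_set (abs_torus ` ?B)) (top_of_set ?B) k"
    using homeomorphic_maps_map by blast
  moreover have "k t = snd (torus_chart z) t" if "t \<in> topspace (top_of_set (abs_torus ` ?B))" for t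
  proof -
    have "t \<in> abs_torus ` ?B" using that by simp
    then obtain x where x: "x \<in> ?B" "t = abs_torus x" by blast
    have "k t = x" using k x unfolding homeomorphic_maps_def by simp
    then show ?thesis using torus_chart_abs x by metis
  qed
  ultimately have "homeomorphic_map (top_of_set (abs_torus ` ?B)) (top_of_set ?B) (snd (torus_chart z))"
    by (rule homeomorphic_map_eq)
  then show ?thesis
    unfolding is_chart_def
    by (simp add: fst_torus_chart[symmetric] torus_chart_image)
       (simp add: fst_torus_chart open_abs_torus_image)
qed

section \<open>Lifts to the plane and derivatives in charts\<close>

definition torus_lift :: "(torus \<Rightarrow> torus) \<Rightarrow> (real^2 \<Rightarrow> real^2) \<Rightarrow> bool" where
  "torus_lift f \<phi> \<longleftrightarrow> (\<forall>x. f (abs_torus x) = abs_torus (\<phi> x))"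

lemma torus_liftD: "torus_lift f \<phi> \<Longrightarrow> f (abs_torus x) = abs_torus (\<phi> x)"
  by (simp add: torus_lift_def)

lemma has_derivative_transform_nhds:
  assumes "(f has_derivative D) (at x)" "\<forall>\<^sub>F y in nhds x. f y = g y"
  shows "(g has_derivative D) (at x)"
  using assms(1)
  by (rule has_derivative_transform_eventually)
    (use assms(2) in \<open>auto simp: eventually_at_filter elim: eventually_mono dest: eventually_nhds_x_imp_x\<close>)

text \<open>In charts \<open>f\<close> is its lift up to a constant integer vector \<open>m\<close>,
  which moves \<open>\<phi> x\<close> to the representative of its class in the target ball. By
  continuity the same \<open>m\<close> works near \<open>x\<close>.\<close>

lemma chart_expression:
  assumes lift: "torus_lift f \<phi>" and cont: "isCont \<phi> x"
    and x: "x \<in> ball z (1/4)" "f (abs_torus x) \<in> fst (torus_chart w)"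
  obtains m where "\<forall>\<^sub>F y in nhds x.
    (snd (torus_chart w) \<circ> f \<circ> chart_inv (torus_chart z)) y = \<phi> y + m"
proof -
  obtain v where v: "v \<in> ball w (1/4)" "abs_torus v = abs_torus (\<phi> x)"
    using x torus_liftD[OF lift] by (auto simp: fst_torus_chart)
  define m where "m = v - \<phi> x"
  have m: "torus_rel m 0"
    using v(2) torus_rel_diff unfolding m_def abs_torus_eq_iff by blast
  have "isCont (\<lambda>y. \<phi> y + m) x" using cont by (intro continuous_intros)
  then have "((\<lambda>y. \<phi> y + m) \<longlongrightarrow> \<phi> x + m) (nhds x)"
    by (simp only: isCont_def tendsto_at_iff_tendsto_nhds[where g="\<lambda>y. \<phi> y + m"])
  moreover have "\<phi> x + m \<in> ball w (1/4)" using v by (simp add: m_def)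
  ultimately have "\<forall>\<^sub>F y in nhds x. \<phi> y + m \<in> ball w (1/4)"
    by (metis open_ball topological_tendstoD)
  moreover have "\<forall>\<^sub>F y in nhds x. y \<in> ball z (1/4)"
    using x by (intro eventually_nhds_in_open) auto
  ultimately have "\<forall>\<^sub>F y in nhds x.
    (snd (torus_chart w) \<circ> f \<circ> chart_inv (torus_chart z)) y = \<phi> y + m"
  proof eventually_elim
    case (elim y)
    have "torus_rel (\<phi> y) (\<phi> y + m)" using m torus_rel_diff[of "\<phi> y + m" "\<phi> y"]
      by (auto intro: torus_rel_sym)
    then have "abs_torus (\<phi> y) = abs_torus (\<phi> y + m)" by (simp add: abs_torus_eq_iff)
    then show ?case using elim by (simp add: torus_chart_inv torus_liftD[OF lift] torus_chart_abs)
  qed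
  then show thesis by (rule that)
qed

lemma has_derivative_chart_expression:
  assumes lift: "torus_lift f \<phi>" and D: "(\<phi> has_derivative D) (at x)"
    and x: "x \<in> ball z (1/4)" "f (abs_torus x) \<in> fst (torus_chart w)"
  shows "((snd (torus_chart w) \<circ> f \<circ> chart_inv (torus_chart z)) has_derivative D) (at x)"
proof -
  have "isCont \<phi> x" using D by (rule has_derivative_continuous)
  then obtain m where m: "\<forall>\<^sub>F y in nhds x.
    (snd (torus_chart w) \<circ> f \<circ> chart_inv (torus_chart z)) y = \<phi> y + m"
    using chart_expression[OF lift _ x] by blast
  have "((\<lambda>y. \<phi> y + m) has_derivative D) (at x)"
    using D by (auto intro!: derivative_eq_intros)
  then show ?thesis
    by (rule has_derivative_transform_nhds) (use m in \<open>auto elim: eventually_mono\<close>)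
qed

lemma chart_at_torus:
  obtains z where "chart_at torus_atlas t = torus_chart z" "t \<in> fst (torus_chart z)"
proof -
  have "torus_chart (rep_torus t) \<in> torus_atlas \<and> t \<in> fst (torus_chart (rep_torus t))"
    by (auto simp: torus_atlas_def fst_torus_chart intro!: image_eqI[of t abs_torus "rep_torus t"])
  then have "chart_at torus_atlas t \<in> torus_atlas \<and> t \<in> fst (chart_at torus_atlas t)"
    unfolding chart_at_def by (rule someI)
  then show thesis using that by (auto simp: torus_atlas_def)
qed

text \<open>For an integer vector \<open>m\<close>, the continuous function \<open>\<phi> (u + m) - \<phi> u\<close> takes integer vectors as values,
  so it is locally constant.\<close>

lemma has_derivative_lift_translate:
  assumes lift: "torus_lift f \<phi>" and cont: "continuous_on UNIV \<phi>"
    and D: "(\<phi> has_derivative D) (at x)" and xy: "torus_rel x y"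
  shows "(\<phi> has_derivative D) (at y)"
proof -
  define m where "m = x - y"
  have m: "torus_rel m 0" using xy torus_rel_diff m_def by auto
  define \<delta> where "\<delta> u = \<phi> (u + m) - \<phi> u" for u
  have \<delta>0: "torus_rel (\<delta> u) 0" for u
  proof -
    have "torus_rel (u + m) u" using m torus_rel_diff[of "u+m" u] by simp
    then have "abs_torus (\<phi> (u + m)) = abs_torus (\<phi> u)"
      by (metis torus_liftD[OF lift] abs_torus_eq_iff)
    then show ?thesis using torus_rel_diff unfolding \<delta>_def abs_torus_eq_iff by blast
  qed
  have "continuous_on UNIV \<delta>" unfolding \<delta>_def
    by (intro continuous_intros continuous_on_compose2[OF cont]) auto
  then have "isCont \<delta> y" by (simp add: continuous_on_eq_continuous_at)
  then have "(\<delta> \<longlongrightarrow> \<delta> y) (nhds y)"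
    by (simp only: isCont_def tendsto_at_iff_tendsto_nhds[where g=\<delta>])
  then have "\<forall>\<^sub>F u in nhds y. dist (\<delta> u) (\<delta> y) < 1" by (rule tendstoD) simp
  then have "\<forall>\<^sub>F u in nhds y. \<phi> (u + m) - \<delta> y = \<phi> u"
  proof eventually_elim
    case (elim u)
    have "torus_rel (\<delta> u) (\<delta> y)"
      using \<delta>0 torus_rel_trans torus_rel_sym by blast
    then have "\<delta> u = \<delta> y" using elim torus_rel_separated by force
    then show ?case by (auto simp: \<delta>_def algebra_simps)
  qed
  moreover have "((\<lambda>u. \<phi> (u + m) - \<delta> y) has_derivative D) (at y)"
  proof -
    have "((\<lambda>u. u + m) has_derivative (\<lambda>h. h)) (at y)" by (auto intro!: derivative_eq_intros)
    moreover have "(\<phi> has_derivative D) (at (y + m))" using D by (simp add: m_def)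
    ultimately have "((\<lambda>u. \<phi> (u + m)) has_derivative (\<lambda>h. D h)) (at y)"
      by (rule has_derivative_compose[where g=\<phi>])
    then show ?thesis by (auto intro!: derivative_eq_intros)
  qed
  ultimately show ?thesis using has_derivative_transform_nhds by blast
qed

text \<open>All charts invert one projection and differ locally by translations, so every tangent
  space is identified with the plane in the same way. The chart at \<open>abs_torus x\<close> may
  see another representative \<open>y\<close> of \<open>x\<close>, which is why invariance of the
  derivative under integer translations is used.\<close>

lemma mderiv_torus:
  assumes lift: "torus_lift f \<phi>" and cont: "continuous_on UNIV \<phi>"
    and D: "(\<phi> has_derivative D) (at x)"
  shows "mderiv torus_atlas f (abs_torus x) = D"
proof -
  obtain z where z: "chart_at torus_atlas (abs_torus x) = torus_chart z"
      "abs_torus x \<in> fst (torus_chart z)" by (rule chart_at_torus)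
  obtain w where w: "chart_at torus_atlas (f (abs_torus x)) = torus_chart w"
      "f (abs_torus x) \<in> fst (torus_chart w)" by (rule chart_at_torus)
  obtain y where y: "y \<in> ball z (1/4)" "abs_torus x = abs_torus y"
    using z by (auto simp: fst_torus_chart)
  have "(\<phi> has_derivative D) (at y)"
    using has_derivative_lift_translate[OF lift cont D] y by (simp add: abs_torus_eq_iff)
  then have "((snd (torus_chart w) \<circ> f \<circ> chart_inv (torus_chart z)) has_derivative D) (at y)"
    using has_derivative_chart_expression[OF lift _ y(1)] w y by simp
  moreover have "snd (torus_chart z) (abs_torus x) = y" using y torus_chart_abs by metis
  ultimately show ?thesis
    unfolding mderiv_def z w by (metis frechet_derivative_at)
qed

lemma tcoord_torus:
  assumes "t \<in> fst (torus_chart z)" "t \<in> fst (torus_chart w)"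
  shows "tcoord (torus_chart z) (torus_chart w) t = (\<lambda>v. v)"
proof -
  obtain x where x: "x \<in> ball z (1/4)" "t = abs_torus x"
    using assms by (auto simp: fst_torus_chart)
  have "((snd (torus_chart w) \<circ> (\<lambda>t. t) \<circ> chart_inv (torus_chart z)) has_derivative (\<lambda>v. v)) (at x)"
    by (rule has_derivative_chart_expression[where \<phi>="\<lambda>x. x"]) (use x assms in \<open>auto simp: torus_lift_def\<close>)
  moreover have "snd (torus_chart z) t = x" using x torus_chart_abs by metis
  ultimately show ?thesis
    unfolding tcoord_def o_def by (metis frechet_derivative_at)
qed

lemma Ck_on_const: "Ck_on k (\<lambda>x. c) S"
proof (induction k arbitrary: c)
  case (Suc k)
  then show ?case by (auto intro!: exI[of _ "\<lambda>_ _. 0"])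
qed simp

lemma smooth_manifold_torus: "smooth_manifold euclidean torus_atlas"
  unfolding smooth_manifold_def
proof (intro conjI ballI)
  show "Hausdorff_space (euclidean :: torus topology)" by (rule Hausdorff_torus)
  show "second_countable (euclidean :: torus topology)" by (rule second_countable_torus)
  show "is_chart euclidean c" if "c \<in> torus_atlas" for c
    using that is_chart_torus_chart by (auto simp: torus_atlas_def)
  have "t \<in> (\<Union>c\<in>torus_atlas. fst c)" for t
    by (rule chart_at_torus[of t]) (auto simp: torus_atlas_def)
  then show "(\<Union>c\<in>torus_atlas. fst c) = topspace (euclidean :: torus topology)" by auto
next
  fix c d assume "c \<in> torus_atlas" "d \<in> torus_atlas"
  then obtain z w where cd: "c = torus_chart z" "d = torus_chart w" by (auto simp: torus_atlas_def)
  let ?S = "snd c ` (fst c \<inter> fst d)" and ?f = "snd d \<circ> chart_inv c"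
  have D: "(?f has_derivative (\<lambda>v. v)) (at x)" if xS: "x \<in> ?S" for x
  proof -
    obtain t where t: "t \<in> fst c" "t \<in> fst d" "x = snd c t" using xS by blast
    then obtain y where "y \<in> ball z (1/4)" "t = abs_torus y"
      unfolding cd fst_torus_chart by blast
    with t have y: "y \<in> ball z (1/4)" "abs_torus y \<in> fst d" "x = snd c (abs_torus y)" by auto
    then have "x = y" using torus_chart_abs cd by metis
    with y show ?thesis
      using has_derivative_chart_expression[of "\<lambda>t. t" "\<lambda>x. x" "\<lambda>v. v" y z w]
      by (simp add: cd o_def torus_lift_def)
  qed
  show "smooth_on ?f ?S"
    unfolding smooth_on_def
  proof
    fix k show "Ck_on k ?f ?S"
    proof (cases k)
      case 0
      then show ?thesis using D
        by (metis Ck_on.simps(1) continuous_at_imp_continuous_on has_derivative_continuous)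
    next
      case (Suc n)
      \<comment> \<open>The derivative of a transition map is the identity at every point, so its
        components are constant functions, which are of every class.\<close>
      have "Ck_on (Suc n) ?f ?S"
        unfolding Ck_on.simps by (intro exI[of _ "\<lambda>_ v. v"] conjI ballI allI D Ck_on_const)
      then show ?thesis by (simp only: Suc)
    qed
  qed
qed

section \<open>Locally Lipschitz derivatives and line fields\<close>

text \<open>The cutoffs constructed later are C^1 with Lipschitz derivative, and this is the
  matching class for the derivative of \<open>g\<close>. Unlike global Lipschitz continuity, it is
  stable under products of unbounded functions and under reciprocals of functions without
  zeros.\<close>

definition loclip :: "('a::metric_space \<Rightarrow> 'b::metric_space) \<Rightarrow> bool" where
  "loclip f \<longleftrightarrow> (\<forall>x. \<exists>e>0. \<exists>C. C-lipschitz_on (ball x e) f)"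

lemma loclipI:
  assumes "\<And>x. \<exists>e>0. \<exists>C. C-lipschitz_on (ball x e) f" shows "loclip f"
  using assms by (simp add: loclip_def)

lemma loclip_global: "C-lipschitz_on UNIV f \<Longrightarrow> loclip f"
  using lipschitz_on_subset[of C UNIV f] by (intro loclipI exI[of _ 1]) auto

lemma loclip_const: "loclip (\<lambda>x. c)"
  by (rule loclip_global[OF lipschitz_on_constant])

lemma loclip_bounded_linear: "bounded_linear f \<Longrightarrow> loclip f"
  by (metis bounded_linear.lipschitz_boundE loclip_global)

lemma loclip_continuous: "loclip f \<Longrightarrow> isCont f x"
  unfolding loclip_def
  by (meson centre_in_ball continuous_on_eq_continuous_at lipschitz_on_continuous_on open_ball)

lemma loclip_compose:
  assumes f: "loclip f" and g: "loclip g" shows "loclip (\<lambda>x. g (f x))"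
proof (rule loclipI)
  fix x
  obtain e C where e: "e > 0" "C-lipschitz_on (ball x e) f" using f unfolding loclip_def by blast
  obtain d D where d: "d > 0" "D-lipschitz_on (ball (f x) d) g" using g unfolding loclip_def by blast
  obtain r where r: "r > 0" "\<And>y. dist y x < r \<Longrightarrow> dist (f y) (f x) < d"
    using loclip_continuous[OF f, of x] d(1) unfolding continuous_at_eps_delta by blast
  let ?B = "ball x (min e r)"
  have "C-lipschitz_on ?B f" by (rule lipschitz_on_subset[OF e(2)]) auto
  moreover have "D-lipschitz_on (f ` ?B) g"
    by (rule lipschitz_on_subset[OF d(2)]) (auto simp: dist_commute r(2))
  ultimately have "(D * C)-lipschitz_on ?B (\<lambda>x. g (f x))" by (rule lipschitz_on_compose2)
  then show "\<exists>e>0. \<exists>C. C-lipschitz_on (ball x e) (\<lambda>x. g (f x))"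
    using e r by (intro exI[of _ "min e r"]) auto
qed

lemma loclip_pairE:
  assumes "loclip f" "loclip g"
  obtains e C D where "e > 0" "C-lipschitz_on (ball x e) f" "D-lipschitz_on (ball x e) g"
proof -
  obtain e C where e: "e > 0" "C-lipschitz_on (ball x e) f"
    using assms(1) unfolding loclip_def by blast
  obtain d D where d: "d > 0" "D-lipschitz_on (ball x d) g"
    using assms(2) unfolding loclip_def by blast
  have "C-lipschitz_on (ball x (min e d)) f" by (rule lipschitz_on_subset[OF e(2)]) auto
  moreover have "D-lipschitz_on (ball x (min e d)) g" by (rule lipschitz_on_subset[OF d(2)]) auto
  ultimately show thesis using that[of "min e d"] e d by auto
qed

lemma loclip_add:
  fixes f g :: "'a::metric_space \<Rightarrow> 'b::real_normed_vector"
  assumes "loclip f" "loclip g" shows "loclip (\<lambda>x. f x + g x)"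
proof (rule loclipI)
  fix x
  obtain e C D where "e > 0" "C-lipschitz_on (ball x e) f" "D-lipschitz_on (ball x e) g"
    using loclip_pairE[OF assms] by blast
  then show "\<exists>e>0. \<exists>C. C-lipschitz_on (ball x e) (\<lambda>x. f x + g x)"
    using lipschitz_on_add by blast
qed

lemma loclip_minus:
  fixes f :: "'a::metric_space \<Rightarrow> 'b::real_normed_vector"
  assumes "loclip f" shows "loclip (\<lambda>x. - f x)"
  using assms unfolding loclip_def by (simp add: lipschitz_on_minus_iff)

lemma loclip_diff:
  fixes f g :: "'a::metric_space \<Rightarrow> 'b::real_normed_vector"
  assumes "loclip f" "loclip g" shows "loclip (\<lambda>x. f x - g x)"
  using loclip_add[OF assms(1) loclip_minus[OF assms(2)]] by simp

lemma loclip_scaleR: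
  fixes f :: "'a::metric_space \<Rightarrow> real" and g :: "'a \<Rightarrow> 'b::real_normed_vector"
  assumes "loclip f" "loclip g" shows "loclip (\<lambda>x. f x *\<^sub>R g x)"
proof (rule loclipI)
  fix x
  obtain e C D where e: "e > 0" and f: "C-lipschitz_on (ball x e) f" and g: "D-lipschitz_on (ball x e) g"
    using loclip_pairE[OF assms] by blast
  have C: "C \<ge> 0" and D: "D \<ge> 0" using f g lipschitz_on_nonneg by blast+
  have bf: "\<bar>f y\<bar> \<le> \<bar>f x\<bar> + C * e" if "y \<in> ball x e" for y
  proof -
    have "\<bar>f y - f x\<bar> \<le> C * dist y x"
      using lipschitz_onD[OF f that, of x] e by (simp add: dist_real_def)
    also have "\<dots> \<le> C * e" using that C by (intro mult_left_mono) (auto simp: dist_commute)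
    finally show ?thesis by linarith
  qed
  have bg: "norm (g y) \<le> norm (g x) + D * e" if "y \<in> ball x e" for y
  proof -
    have "norm (g y - g x) \<le> D * dist y x"
      using lipschitz_onD[OF g that, of x] e by (simp add: dist_norm)
    also have "\<dots> \<le> D * e" using that D by (intro mult_left_mono) (auto simp: dist_commute)
    finally show ?thesis using norm_triangle_ineq2[of "g y" "g x"] by linarith
  qed
  have "((\<bar>f x\<bar> + C * e) * D + C * (norm (g x) + D * e))-lipschitz_on (ball x e) (\<lambda>x. f x *\<^sub>R g x)"
  proof (rule lipschitz_onI)
    fix y z assume yz: "y \<in> ball x e" "z \<in> ball x e"
    \<comment> \<open>Discrete Leibniz rule; the bounds \<open>bf\<close> and \<open>bg\<close> on
      the ball take the place of global boundedness of the factors.\<close>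
    have "dist (f y *\<^sub>R g y) (f z *\<^sub>R g z) = norm (f y *\<^sub>R (g y - g z) + (f y - f z) *\<^sub>R g z)"
      by (simp add: dist_norm algebra_simps)
    also have "\<dots> \<le> \<bar>f y\<bar> * norm (g y - g z) + \<bar>f y - f z\<bar> * norm (g z)"
      by (metis norm_scaleR norm_triangle_ineq)
    also have "\<dots> \<le> (\<bar>f x\<bar> + C * e) * (D * dist y z) + (C * dist y z) * (norm (g x) + D * e)"
      using bf[OF yz(1)] bg[OF yz(2)] lipschitz_onD[OF f yz] lipschitz_onD[OF g yz] C D e
      by (intro add_mono mult_mono) (auto simp: dist_norm)
    finally show "dist (f y *\<^sub>R g y) (f z *\<^sub>R g z)
      \<le> ((\<bar>f x\<bar> + C * e) * D + C * (norm (g x) + D * e)) * dist y z"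
      by (simp add: algebra_simps)
  qed (use C D e in auto)
  then show "\<exists>e>0. \<exists>C. C-lipschitz_on (ball x e) (\<lambda>x. f x *\<^sub>R g x)" using e by blast
qed

lemma loclip_mult:
  fixes f g :: "'a::metric_space \<Rightarrow> real"
  assumes "loclip f" "loclip g" shows "loclip (\<lambda>x. f x * g x)"
  using loclip_scaleR[OF assms] by simp

lemma loclip_inverse:
  fixes f :: "'a::metric_space \<Rightarrow> real"
  assumes "loclip f" and nz: "\<And>x. f x \<noteq> 0" shows "loclip (\<lambda>x. inverse (f x))"
proof (rule loclipI)
  fix x
  obtain e C where e: "e > 0" and f: "C-lipschitz_on (ball x e) f"
    using assms(1) unfolding loclip_def by blast
  have C: "C \<ge> 0" using f lipschitz_on_nonneg by blast
  define m where "m = \<bar>f x\<bar> / 2"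
  have m: "m > 0" using nz by (simp add: m_def)
  obtain r where r: "r > 0" "\<And>y. dist y x < r \<Longrightarrow> dist (f y) (f x) < m"
    using loclip_continuous[OF assms(1), of x] m unfolding continuous_at_eps_delta by blast
  have low: "m \<le> \<bar>f y\<bar>" if "y \<in> ball x r" for y
  proof -
    have "\<bar>f y - f x\<bar> < m" using r(2)[of y] that by (simp add: dist_real_def dist_commute)
    then show ?thesis unfolding m_def by linarith
  qed
  have "(C / m\<^sup>2)-lipschitz_on (ball x (min e r)) (\<lambda>x. inverse (f x))"
  proof (rule lipschitz_onI)
    fix y z assume yz: "y \<in> ball x (min e r)" "z \<in> ball x (min e r)"
    have "dist (inverse (f y)) (inverse (f z)) = \<bar>f y - f z\<bar> / (\<bar>f y\<bar> * \<bar>f z\<bar>)"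
    proof -
      have "inverse (f y) - inverse (f z) = (f z - f y) / (f y * f z)"
        using nz by (simp add: field_simps)
      then show ?thesis by (simp add: dist_real_def abs_mult abs_divide abs_minus_commute)
    qed
    also have "\<dots> \<le> (C * dist y z) / (m * m)"
    proof (rule frac_le)
      show "\<bar>f y - f z\<bar> \<le> C * dist y z"
        using lipschitz_onD[OF f, of y z] yz by (simp add: dist_real_def)
      show "m * m \<le> \<bar>f y\<bar> * \<bar>f z\<bar>" using low yz m by (intro mult_mono) auto
    qed (use C m in auto)
    finally show "dist (inverse (f y)) (inverse (f z)) \<le> C / m\<^sup>2 * dist y z"
      by (simp add: power2_eq_square)
  qed (use C in auto)
  then show "\<exists>e>0. \<exists>C. C-lipschitz_on (ball x e) (\<lambda>x. inverse (f x))"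
    using e r by (intro exI[of _ "min e r"]) auto
qed

lemma loclip_max:
  fixes f g :: "'a::metric_space \<Rightarrow> real"
  assumes "loclip f" "loclip g" shows "loclip (\<lambda>x. max (f x) (g x))"
proof -
  have "loclip (\<lambda>x. \<bar>f x - g x\<bar>)"
    by (rule loclip_compose[OF loclip_diff[OF assms]], rule loclip_global[of 1])
      (auto intro!: lipschitz_onI simp: dist_real_def)
  then have "loclip (\<lambda>x. (f x + g x + \<bar>f x - g x\<bar>) * (1/2))"
    using assms by (intro loclip_mult loclip_add loclip_const)
  moreover have "(\<lambda>x. (f x + g x + \<bar>f x - g x\<bar>) * (1/2)) = (\<lambda>x. max (f x) (g x))"
    by (auto simp: max_def)
  ultimately show ?thesis by simp
qed

text \<open>At distances at most 1 a Lipschitz bound implies a Hoelder bound with any exponent below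
  1; the value 1/2 is an arbitrary choice. The radius is capped at 1/2 so that any two points of the
  ball are that close.\<close>

lemma C1_holder_map_torus:
  assumes lift: "torus_lift f \<phi>" and D: "\<And>x. (\<phi> has_derivative blinfun_apply (D x)) (at x)"
    and lip: "loclip D"
  shows "C1_holder_map (1/2) euclidean torus_atlas f"
  unfolding C1_holder_map_def
proof (intro conjI ballI)
  have cont: "continuous_on UNIV \<phi>"
    by (intro continuous_at_imp_continuous_on ballI has_derivative_continuous[OF D])
  have "f \<circ> abs_torus = abs_torus \<circ> \<phi>" using lift by (auto simp: torus_lift_def)
  then have "continuous_on UNIV f" unfolding continuous_on_torus_iff
    using continuous_on_compose[OF cont continuous_on_abs_torus] by simp
  then show "continuous_map euclidean euclidean f" by simp
next
  fix c d assume "c \<in> torus_atlas" "d \<in> torus_atlas"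
  then obtain z w where cd: "c = torus_chart z" "d = torus_chart w" by (auto simp: torus_atlas_def)
  let ?S = "snd c ` (fst c \<inter> f -` fst d)" and ?f = "snd d \<circ> f \<circ> chart_inv c"
  have der: "(?f has_derivative blinfun_apply (D x)) (at x)" if xS: "x \<in> ?S" for x
  proof -
    obtain t where t: "t \<in> fst c" "f t \<in> fst d" "x = snd c t" using xS by blast
    then obtain y where y: "y \<in> ball z (1/4)" "t = abs_torus y"
      unfolding cd fst_torus_chart by blast
    then have "x = y" using torus_chart_abs cd t by metis
    with t y show ?thesis
      using has_derivative_chart_expression[OF lift D y(1), of w] by (simp add: cd)
  qed
  show "C1_holder_on (1/2) ?f ?S"
    unfolding C1_holder_on_def
  proof (intro exI[of _ D] conjI ballI der)
    fix x assume "x \<in> ?S"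
    obtain e C where e: "e > 0" and C: "C-lipschitz_on (ball x e) D"
      using lip unfolding loclip_def by blast
    have "norm (D y - D y') \<le> C * dist y y' powr (1/2)"
      if yy: "y \<in> ball x (min e (1/2)) \<inter> ?S" "y' \<in> ball x (min e (1/2)) \<inter> ?S" for y y'
    proof -
      have "dist y y' \<le> dist x y + dist x y'" by (metis dist_commute dist_triangle)
      then have d1: "dist y y' \<le> 1" using yy by auto
      have "dist y y' \<le> dist y y' powr (1/2)"
      proof (cases "y = y'")
        case False
        then have "dist y y' powr 1 \<le> dist y y' powr (1/2)"
          using d1 by (intro powr_mono') auto
        then show ?thesis by simp
      qed simp
      moreover have "norm (D y - D y') \<le> C * dist y y'"
        using lipschitz_onD[OF C, of y y'] yy by (simp add: dist_norm)
      moreover have "C \<ge> 0" using C lipschitz_on_nonneg by blast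
      ultimately show ?thesis by (meson mult_left_mono order_trans)
    qed
    then show "\<exists>\<epsilon>>0. \<exists>C. \<forall>y\<in>ball x \<epsilon> \<inter> ?S. \<forall>z\<in>ball x \<epsilon> \<inter> ?S.
        norm (D y - D z) \<le> C * dist y z powr (1/2)"
      using e by (intro exI[of _ "min e (1/2)"] conjI exI[of _ C] ballI) auto
  qed
qed

section \<open>Periodic fields, line bundles and metrics on the torus\<close>

definition torus_periodic :: "(real^2 \<Rightarrow> 'b) \<Rightarrow> bool" where
  "torus_periodic f \<longleftrightarrow> (\<forall>x y. torus_rel x y \<longrightarrow> f x = f y)"

lemma torus_periodicD: "torus_periodic f \<Longrightarrow> torus_rel x y \<Longrightarrow> f x = f y"
  by (auto simp: torus_periodic_def)

lemma torus_periodic_rep: "torus_periodic f \<Longrightarrow> f (rep_torus (abs_torus x)) = f x"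
  using torus_periodicD torus_rel_rep_abs by blast

lemma continuous_on_torus_periodic:
  assumes "continuous_on UNIV f" "torus_periodic f"
  shows "continuous_on UNIV (\<lambda>t. f (rep_torus t))"
  using assms by (simp add: continuous_on_torus_iff o_def torus_periodic_rep)

text \<open>A periodic field without zeros descends to the torus, and coordinate changes act as the
  identity on tangent vectors; so the field itself is a frame of rank one in every chart.\<close>

lemma continuous_subbundle_line:
  assumes cont: "continuous_on UNIV v" and per: "torus_periodic v" and nz: "\<And>x. v x \<noteq> 0"
  shows "continuous_subbundle euclidean torus_atlas (\<lambda>t. span {v (rep_torus t)})"
  unfolding continuous_subbundle_def
proof (intro conjI ballI)
  fix t :: torus
  obtain z where z: "chart_at torus_atlas t = torus_chart z" "t \<in> fst (torus_chart z)"
    by (rule chart_at_torus)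
  let ?W = "fst (torus_chart z)" and ?e = "\<lambda>(i::nat) t. v (rep_torus t)"
  have "open ?W" by (simp add: fst_torus_chart open_abs_torus_image)
  moreover have "continuous_map (subtopology euclidean ?W) euclidean (?e i)" for i
    using continuous_on_subset[OF continuous_on_torus_periodic[OF cont per], of ?W] by simp
  moreover have "inj_on (\<lambda>i. ?e i s) {..<1} \<and> independent ((\<lambda>i. ?e i s) ` {..<1}) \<and>
      tcoord (chart_at torus_atlas s) (torus_chart z) s ` span {v (rep_torus s)}
        = span ((\<lambda>i. ?e i s) ` {..<1})" if s: "s \<in> ?W" for s
  proof -
    obtain w where w: "chart_at torus_atlas s = torus_chart w" "s \<in> fst (torus_chart w)"
      by (rule chart_at_torus)
    have "{..<1::nat} = {0}" by auto
    then show ?thesis using s w nz by (simp add: tcoord_torus inj_on_def)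
  qed
  ultimately show "\<exists>c\<in>torus_atlas. \<exists>W (k::nat) (e :: nat \<Rightarrow> torus \<Rightarrow> real^2).
        openin euclidean W \<and> t \<in> W \<and> W \<subseteq> fst c \<and>
        (\<forall>i<k. continuous_map (subtopology euclidean W) euclidean (e i)) \<and>
        (\<forall>y\<in>W. inj_on (\<lambda>i. e i y) {..<k} \<and> independent ((\<lambda>i. e i y) ` {..<k}) \<and>
           tcoord (chart_at torus_atlas y) c y ` span {v (rep_torus y)} = span ((\<lambda>i. e i y) ` {..<k}))"
    using z
    by (intro bexI[of _ "torus_chart z"] exI[of _ ?W] exI[of _ 1] exI[of _ ?e])
      (simp_all add: torus_atlas_def)
qed simp

lemma continuous_riemannian_metric_const:
  assumes "bilinear Q" "\<And>u v. Q u v = Q v u" "\<And>v. v \<noteq> 0 \<Longrightarrow> Q v v > 0"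
  shows "continuous_riemannian_metric euclidean torus_atlas (\<lambda>_. Q)"
  unfolding continuous_riemannian_metric_def
proof (intro conjI ballI allI impI)
  fix c u v assume "c \<in> torus_atlas"
  then obtain z where z: "c = torus_chart z" by (auto simp: torus_atlas_def)
  have "tcoord c (chart_at torus_atlas x) x = (\<lambda>v. v)" if x: "x \<in> fst c" for x
  proof -
    obtain w where "chart_at torus_atlas x = torus_chart w" "x \<in> fst (torus_chart w)"
      by (rule chart_at_torus)
    then show ?thesis using tcoord_torus x z by metis
  qed
  then have "Q u v = Q (tcoord c (chart_at torus_atlas x) x u) (tcoord c (chart_at torus_atlas x) x v)"
    if "x \<in> topspace (subtopology euclidean (fst c))" for x
    using that by simp
  moreover have "continuous_map (subtopology euclidean (fst c)) euclideanreal (\<lambda>x. Q u v)"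
    by (metis continuous_map_const UNIV_I topspace_euclidean)
  ultimately show "continuous_map (subtopology euclidean (fst c)) euclideanreal
        (\<lambda>x. Q (tcoord c (chart_at torus_atlas x) x u) (tcoord c (chart_at torus_atlas x) x v))"
    by (rule continuous_map_eq[rotated])
next
  show "bilinear Q" by (rule assms(1))
  show "Q u v = Q v u" for u v by (rule assms(2))
  show "0 < Q v v" if "v \<noteq> 0" for v using that by (rule assms(3))
qed

section \<open>Anosov diffeomorphisms with a prescribed lift\<close>

definition torus_map :: "(real^2 \<Rightarrow> real^2) \<Rightarrow> torus \<Rightarrow> torus" where
  "torus_map \<phi> t = abs_torus (\<phi> (rep_torus t))"

text \<open>The displacement \<open>\<phi> (x + m) - \<phi> x\<close> for an integer vector
  \<open>m\<close> may be any integer vector; for a linear map \<open>A\<close> it is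
  \<open>A m\<close>, so commuting with translations would be too strong.\<close>

definition torus_equivariant :: "(real^2 \<Rightarrow> real^2) \<Rightarrow> bool" where
  "torus_equivariant \<phi> \<longleftrightarrow> (\<forall>x y. torus_rel x y \<longrightarrow> torus_rel (\<phi> x) (\<phi> y))"

lemma torus_equivariantD: "torus_equivariant \<phi> \<Longrightarrow> torus_rel x y \<Longrightarrow> torus_rel (\<phi> x) (\<phi> y)"
  by (auto simp: torus_equivariant_def)

lemma torus_lift_map: "torus_equivariant \<phi> \<Longrightarrow> torus_lift (torus_map \<phi>) \<phi>"
  by (simp add: torus_lift_def torus_map_def abs_torus_eq_iff torus_equivariantD torus_rel_rep_abs)

lemma torus_lift_funpow: "torus_lift f \<phi> \<Longrightarrow> torus_lift (f ^^ n) (\<phi> ^^ n)"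
  by (induction n) (auto simp: torus_lift_def)

lemma torus_equivariant_funpow: "torus_equivariant \<phi> \<Longrightarrow> torus_equivariant (\<phi> ^^ n)"
  by (induction n) (auto simp: torus_equivariant_def)

text \<open>The chain rule multiplies the factors met along the orbit. Only the action on the field
  \<open>v\<close> is recorded; the rest of the derivative of the iterate stays existential.\<close>

lemma has_derivative_funpow_cocycle:
  assumes D: "\<And>x. (\<phi> has_derivative D x) (at x)" and v: "\<And>x. D x (v x) = \<rho> x *\<^sub>R v (\<phi> x)"
  shows "\<exists>E. ((\<phi> ^^ n) has_derivative E) (at x) \<and>
    E (v x) = (\<Prod>i<n. \<rho> ((\<phi> ^^ i) x)) *\<^sub>R v ((\<phi> ^^ n) x)"
proof (induction n)
  case 0
  show ?case by (auto intro!: exI[of _ "\<lambda>x. x"] simp: id_def)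
next
  case (Suc n)
  then obtain E where E: "((\<phi> ^^ n) has_derivative E) (at x)"
    "E (v x) = (\<Prod>i<n. \<rho> ((\<phi> ^^ i) x)) *\<^sub>R v ((\<phi> ^^ n) x)" by blast
  have "((\<phi> ^^ Suc n) has_derivative (\<lambda>h. D ((\<phi> ^^ n) x) (E h))) (at x)"
    using has_derivative_compose[OF E(1) D] by (simp add: o_def)
  moreover have "D ((\<phi> ^^ n) x) (E (v x))
      = (\<Prod>i<Suc n. \<rho> ((\<phi> ^^ i) x)) *\<^sub>R v ((\<phi> ^^ Suc n) x)"
    using linear_scale[OF has_derivative_linear[OF D]] by (simp add: E(2) v)
  ultimately show ?case by blast
qed

lemma image_span_line:
  assumes "linear T" "T v = r *\<^sub>R w" "r \<noteq> 0" shows "T ` span {v} = span {w}"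
proof -
  have "T ` span {v} = span {r *\<^sub>R w}"
    using linear_span_image[OF assms(1), of "{v}"] assms(2) by simp
  also have "\<dots> = span {w}"
    using span_image_scale[of "{w}" "\<lambda>_. r"] assms(3) by simp
  finally show ?thesis .
qed

text \<open>Data in the plane that make a torus map Anosov. The invariant fields are normalized by
  \<open>S (vs x) = 1\<close> and \<open>U (vu x) = 1\<close> and lie in the stable and the unstable
  cone. Their lengths are thus bounded above and below, and the multipliers \<open>\<rho>s\<close>
  and \<open>\<rho>u\<close> alone measure contraction and expansion.\<close>

locale anosov_lift =
  fixes \<phi> \<phi>' :: "real^2 \<Rightarrow> real^2" and D D' :: "real^2 \<Rightarrow> ((real^2) \<Rightarrow>\<^sub>L (real^2))"
    and S U :: "real^2 \<Rightarrow> real" and vs vu :: "real^2 \<Rightarrow> real^2" and \<rho>s \<rho>u :: "real^2 \<Rightarrow> real" and \<tau> :: real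
  assumes equi: "torus_equivariant \<phi>" and equi': "torus_equivariant \<phi>'"
    and inv1: "\<And>x. \<phi>' (\<phi> x) = x" and inv2: "\<And>x. \<phi> (\<phi>' x) = x"
    and D: "\<And>x. (\<phi> has_derivative blinfun_apply (D x)) (at x)"
    and D': "\<And>x. (\<phi>' has_derivative blinfun_apply (D' x)) (at x)"
    and lipD: "loclip D" and lipD': "loclip D'"
    and linS: "linear S" and linU: "linear U" and SU: "\<And>x. S x = 0 \<Longrightarrow> U x = 0 \<Longrightarrow> x = 0"
    and vs_cont: "continuous_on UNIV vs" and vu_cont: "continuous_on UNIV vu"
    and vs_per: "torus_periodic vs" and vu_per: "torus_periodic vu"
    and Svs: "\<And>x. S (vs x) = 1" and Uvs: "\<And>x. \<bar>U (vs x)\<bar> < 1"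
    and Uvu: "\<And>x. U (vu x) = 1" and Svu: "\<And>x. \<bar>S (vu x)\<bar> < 1"
    and Dvs: "\<And>x. D x (vs x) = \<rho>s x *\<^sub>R vs (\<phi> x)" and Dvu: "\<And>x. D x (vu x) = \<rho>u x *\<^sub>R vu (\<phi> x)"
    and \<tau>: "0 < \<tau>" "\<tau> < 1"
    and \<rho>s: "\<And>x. \<rho>s x \<noteq> 0" "\<And>x. \<bar>\<rho>s x\<bar> \<le> \<tau>" and \<rho>u: "\<And>x. 1 / \<tau> \<le> \<bar>\<rho>u x\<bar>"
begin

text \<open>The inner product for which \<open>S\<close> and \<open>U\<close> are orthonormal
  coordinates. The squared lengths of the invariant fields then lie between 1 and 2.\<close>

definition "Q u v = S u * S v + U u * U v"

abbreviation "f \<equiv> torus_map \<phi>"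
abbreviation "f' \<equiv> torus_map \<phi>'"
definition "Es t = span {vs (rep_torus t)}"
definition "Eu t = span {vu (rep_torus t)}"

lemmas S_simps = linear_add[OF linS] linear_scale[OF linS] linear_0[OF linS] linear_diff[OF linS]
lemmas U_simps = linear_add[OF linU] linear_scale[OF linU] linear_0[OF linU] linear_diff[OF linU]

lemma lift: "torus_lift f \<phi>" and lift': "torus_lift f' \<phi>'"
  using equi equi' torus_lift_map by blast+

lemma f_inv: "f' (f t) = t" "f (f' t) = t"
  using inv1 inv2 torus_liftD[OF lift] torus_liftD[OF lift'] by (metis abs_rep_torus)+

lemma bij_f: "bij f"
  using f_inv by (metis bijI')

lemma inv_f: "inv_into UNIV f = f'"
  using f_inv by (intro inv_equality) auto

lemma Q_pos: "v \<noteq> 0 \<Longrightarrow> Q v v > 0"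
  using SU[of v] unfolding Q_def
  by (metis add_nonneg_pos add_pos_nonneg mult_eq_0_iff not_real_square_gt_zero zero_le_square)

lemma metric_Q: "continuous_riemannian_metric euclidean torus_atlas (\<lambda>_. Q)"
proof (rule continuous_riemannian_metric_const)
  show "bilinear Q" unfolding bilinear_def Q_def
    by (intro conjI allI linearI) (simp_all add: S_simps U_simps algebra_simps)
qed (auto simp: Q_def mult.commute intro: Q_pos[unfolded Q_def])

lemma nz: "vs x \<noteq> 0" "vu x \<noteq> 0"
  using Svs[of x] Uvu[of x] S_simps U_simps by auto

lemma span_rep: "torus_rel x y \<Longrightarrow> span {vs x} = span {vs y}" "torus_rel x y \<Longrightarrow> span {vu x} = span {vu y}"
  using torus_periodicD[OF vs_per] torus_periodicD[OF vu_per] by metis+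

lemma E_abs: "Es (abs_torus x) = span {vs x}" "Eu (abs_torus x) = span {vu x}"
  unfolding Es_def Eu_def using span_rep torus_rel_rep_abs by blast+

lemma subbundle: "continuous_subbundle euclidean torus_atlas Es" "continuous_subbundle euclidean torus_atlas Eu"
  unfolding Es_def[abs_def] Eu_def[abs_def]
  using continuous_subbundle_line vs_cont vu_cont vs_per vu_per nz by blast+

lemma dim_E: "dim (Es t) = 1" "dim (Eu t) = 1"
  unfolding Es_def Eu_def dim_span using nz by (simp_all add: dim_singleton)

text \<open>In the coordinates \<open>S\<close>, \<open>U\<close> the fields are the columns (1, z)
  and (w, 1). Their determinant \<open>1 - w * z\<close> is positive because both slopes are smaller
  than 1 in absolute value.\<close>

lemma splitting: "Es t \<inter> Eu t = {0}" "{v + w | v w. v \<in> Es t \<and> w \<in> Eu t} = UNIV"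
proof -
  define x where "x = rep_torus t"
  define z w where "z = U (vs x)" and "w = S (vu x)"
  have zw: "1 - w * z > 0"
  proof -
    have "\<bar>w * z\<bar> < 1 * 1" unfolding abs_mult z_def w_def using Uvs Svu by (intro mult_strict_mono') auto
    then show ?thesis by auto
  qed
  have "v = 0" if vE: "v \<in> Es t" "v \<in> Eu t" for v
  proof -
    obtain a b where ab: "v = a *\<^sub>R vs x" "v = b *\<^sub>R vu x"
      using vE unfolding Es_def Eu_def x_def span_singleton by blast
    have "a = b * w" using arg_cong[OF trans[OF ab(1)[symmetric] ab(2)], of S] Svs
      by (simp add: S_simps w_def)
    moreover have "a * z = b" using arg_cong[OF trans[OF ab(1)[symmetric] ab(2)], of U] Uvu
      by (simp add: U_simps z_def)
    ultimately have "b * (1 - w * z) = 0" by (simp add: algebra_simps)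
    then show ?thesis using zw ab by simp
  qed
  moreover have "0 \<in> Es t" "0 \<in> Eu t" by (simp_all add: Es_def Eu_def span_zero)
  ultimately show "Es t \<inter> Eu t = {0}" by blast
  have "\<exists>v w. u = v + w \<and> v \<in> Es t \<and> w \<in> Eu t" for u
  proof -
    \<comment> \<open>Coefficients of \<open>u\<close> with respect to the two fields, by Cramer's
      rule.\<close>
    define a b where "a = (S u - w * U u) / (1 - w * z)" and "b = (U u - z * S u) / (1 - w * z)"
    have "a + b * w = S u" "a * z + b = U u"
    proof -
      have "a + b * w = ((S u - w * U u) + (U u - z * S u) * w) / (1 - w * z)"
        unfolding a_def b_def by (simp add: add_divide_distrib)
      also have "\<dots> = S u * (1 - w * z) / (1 - w * z)" by (simp add: algebra_simps)
      finally show "a + b * w = S u" using zw by simp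
      have "a * z + b = ((S u - w * U u) * z + (U u - z * S u)) / (1 - w * z)"
        unfolding a_def b_def by (simp add: add_divide_distrib)
      also have "\<dots> = U u * (1 - w * z) / (1 - w * z)" by (simp add: algebra_simps)
      finally show "a * z + b = U u" using zw by simp
    qed
    then have "u - (a *\<^sub>R vs x + b *\<^sub>R vu x) = 0"
      by (intro SU) (simp_all add: S_simps U_simps Svs Uvu z_def[symmetric] w_def[symmetric])
    then show ?thesis
      by (intro exI[of _ "a *\<^sub>R vs x"] exI[of _ "b *\<^sub>R vu x"])
        (auto simp: Es_def Eu_def x_def span_scale span_base)
  qed
  then show "{v + w | v w. v \<in> Es t \<and> w \<in> Eu t} = UNIV" by blast
qed

lemma cont: "continuous_on UNIV \<phi>" "continuous_on UNIV \<phi>'"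
  by (intro continuous_at_imp_continuous_on ballI has_derivative_continuous[OF D]
      has_derivative_continuous[OF D'])+

lemma mderiv_f: "mderiv torus_atlas f (abs_torus x) = D x"
  by (rule mderiv_torus[OF lift cont(1) D])

lemma invariant: "mderiv torus_atlas f t ` Es t = Es (f t)" "mderiv torus_atlas f t ` Eu t = Eu (f t)"
proof -
  obtain x where t: "t = abs_torus x" by (metis abs_rep_torus)
  have "linear (blinfun_apply (D x))" by (simp add: blinfun.bounded_linear_right bounded_linear.linear)
  moreover have "\<rho>u x \<noteq> 0" using \<rho>u[of x] \<tau> by (auto simp: field_simps)
  ultimately show "mderiv torus_atlas f t ` Es t = Es (f t)" "mderiv torus_atlas f t ` Eu t = Eu (f t)"
    unfolding t mderiv_f torus_liftD[OF lift] E_abs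
    using image_span_line[of "blinfun_apply (D x)" "vs x", OF _ Dvs]
      image_span_line[of "blinfun_apply (D x)" "vu x", OF _ Dvu] \<rho>s(1) by blast+
qed

text \<open>Differentiating \<open>\<phi>' (\<phi> u) = u\<close> at \<open>\<phi>' y\<close>
  inverts the multiplier; hence the inverse map contracts the unstable field.\<close>

lemma D'_vu: "D' y (vu y) = (1 / \<rho>u (\<phi>' y)) *\<^sub>R vu (\<phi>' y)"
proof -
  let ?x = "\<phi>' y"
  have "((\<lambda>u. \<phi>' (\<phi> u)) has_derivative (\<lambda>h. D' (\<phi> ?x) (D ?x h))) (at ?x)"
    by (rule has_derivative_compose[OF D D'])
  moreover have "((\<lambda>u. \<phi>' (\<phi> u)) has_derivative (\<lambda>h. h)) (at ?x)"
    by (simp add: inv1)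
  ultimately have "(\<lambda>h. D' y (D ?x h)) = (\<lambda>h. h)"
    using has_derivative_unique by (metis inv2)
  then have "D' y (D ?x (vu ?x)) = vu ?x" by metis
  then have "\<rho>u ?x *\<^sub>R D' y (vu y) = vu ?x"
    by (simp add: Dvu blinfun.scaleR_right inv2)
  moreover have "\<rho>u ?x \<noteq> 0" using \<rho>u[of ?x] \<tau> by (auto simp: field_simps)
  ultimately show ?thesis by (metis inverse_eq_divide right_inverse_eq scaleR_one vector_fraction_eq_iff scaleR_left_imp_eq scaleR_scaleR divideR_right)
qed

lemma Q_bounds: "1 \<le> Q (vs x) (vs x)" "Q (vs x) (vs x) \<le> 2" "1 \<le> Q (vu x) (vu x)" "Q (vu x) (vu x) \<le> 2"
proof -
  have "U (vs x) * U (vs x) \<le> 1" "S (vu x) * S (vu x) \<le> 1"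
    using Uvs[of x] Svu[of x] by (metis abs_le_square_iff abs_one less_imp_le one_power2 power2_eq_square)+
  then show "1 \<le> Q (vs x) (vs x)" "Q (vs x) (vs x) \<le> 2" "1 \<le> Q (vu x) (vu x)" "Q (vu x) (vu x) \<le> 2"
    by (simp_all add: Q_def Svs Uvu)
qed

text \<open>Serves both halves of the Anosov estimate: \<open>\<phi>\<close> with the stable field
  and \<open>\<phi>'\<close> with the unstable one. The product of \<open>n\<close> multipliers is
  at most \<open>\<tau> ^ n\<close>, and the constant 2 absorbs the comparison of the field lengths
  at the two ends of the orbit segment.\<close>

lemma contraction:
  assumes lift: "torus_lift k \<psi>" and E: "\<And>x. (\<psi> has_derivative E x) (at x)"
    and v: "\<And>x. E x (v x) = \<rho> x *\<^sub>R v (\<psi> x)" and \<rho>: "\<And>x. \<bar>\<rho> x\<bar> \<le> \<tau>"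
    and Q1: "\<And>x. 1 \<le> Q (v x) (v x)" and Q2: "\<And>x. Q (v x) (v x) \<le> 2"
    and u: "u \<in> span {v (rep_torus t)}"
  shows "let y = (k ^^ n) t; w = mderiv torus_atlas (k ^^ n) t u in sqrt (Q w w) \<le> 2 * \<tau> ^ n * sqrt (Q u u)"
proof -
  define x where "x = rep_torus t"
  define R where "R = (\<Prod>i<n. \<rho> ((\<psi> ^^ i) x))"
  have der: "\<exists>F. ((\<psi> ^^ n) has_derivative F) (at x) \<and>
    F (v x) = (\<Prod>i<n. \<rho> ((\<psi> ^^ i) x)) *\<^sub>R v ((\<psi> ^^ n) x)" for x
    by (rule has_derivative_funpow_cocycle[OF E v])
  then obtain F where F: "((\<psi> ^^ n) has_derivative F) (at x)" "F (v x) = R *\<^sub>R v ((\<psi> ^^ n) x)"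
    unfolding R_def by blast
  have "continuous_on UNIV (\<psi> ^^ n)"
    by (intro continuous_at_imp_continuous_on ballI) (use der has_derivative_continuous in blast)
  then have m: "mderiv torus_atlas (k ^^ n) t = F"
    using mderiv_torus[OF torus_lift_funpow[OF lift] _ F(1)] by (simp add: x_def)
  obtain a where a: "u = a *\<^sub>R v x" using u by (auto simp: span_singleton x_def)
  have Qs: "sqrt (Q (c *\<^sub>R y) (c *\<^sub>R y)) = \<bar>c\<bar> * sqrt (Q y y)" for c y
    by (simp add: Q_def S_simps U_simps algebra_simps flip: real_sqrt_mult real_sqrt_abs)
       (simp add: algebra_simps power2_eq_square)
  have R: "\<bar>R\<bar> \<le> \<tau> ^ n"
    using prod_mono[of "{..<n}" "\<lambda>i. \<bar>\<rho> ((\<psi> ^^ i) x)\<bar>" "\<lambda>_. \<tau>"] \<rho> by (simp add: R_def abs_prod)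
  have Fu: "F u = (a * R) *\<^sub>R v ((\<psi> ^^ n) x)"
    using linear_scale[OF has_derivative_linear[OF F(1)]] by (simp add: a F(2))
  have "sqrt (Q (v ((\<psi> ^^ n) x)) (v ((\<psi> ^^ n) x))) \<le> sqrt 4"
    using Q2 by (intro real_sqrt_le_mono) (meson order_trans numeral_le_iff semiring_norm)
  then have "sqrt (Q (F u) (F u)) \<le> \<bar>a\<bar> * \<bar>R\<bar> * 2"
    unfolding Fu Qs abs_mult by (intro mult_left_mono) auto
  also have "\<dots> \<le> \<bar>a\<bar> * \<tau> ^ n * 2" using R by (intro mult_right_mono mult_left_mono) auto
  also have "\<dots> \<le> \<bar>a\<bar> * \<tau> ^ n * 2 * sqrt (Q (v x) (v x))"
  proof -
    have "0 \<le> \<bar>a\<bar> * \<tau> ^ n * 2" using \<tau> by simp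
    then show ?thesis using Q1[of x] mult_left_mono[of 1 "sqrt (Q (v x) (v x))"] by simp
  qed
  also have "\<dots> = 2 * \<tau> ^ n * sqrt (Q u u)" unfolding a Qs by simp
  finally show ?thesis by (simp add: m Let_def)
qed

lemma anosov: "anosov_diffeo (1/2) euclidean torus_atlas f Es Eu"
  unfolding anosov_diffeo_def C1_holder_diffeo_def anosov_splitting_def
proof (intro conjI ballI)
  show "smooth_manifold euclidean torus_atlas" by (rule smooth_manifold_torus)
  show "compact_space (euclidean :: torus topology)" using compact_torus by (simp add: compact_space_def)
  show "bij_betw f (topspace euclidean) (topspace euclidean)" using bij_f by simp
  show "C1_holder_map (1/2) euclidean torus_atlas f" by (rule C1_holder_map_torus[OF lift D lipD])
  show "C1_holder_map (1/2) euclidean torus_atlas (inv_into (topspace euclidean) f)"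
    using C1_holder_map_torus[OF lift' D' lipD'] by (simp add: inv_f)
  have c: "let y = (f ^^ n) x; w = mderiv torus_atlas (f ^^ n) x v in sqrt (Q w w) \<le> 2 * \<tau> ^ n * sqrt (Q v v)"
    if "v \<in> Es x" for v x n
    by (rule contraction[OF lift D Dvs]) (use that \<rho>s Q_bounds in \<open>auto simp: Es_def\<close>)
  have rho': "\<bar>1 / \<rho>u (\<phi>' x)\<bar> \<le> \<tau>" for x
  proof -
    have "1 / \<tau> > 0" using \<tau> by simp
    then have "1 / \<bar>\<rho>u (\<phi>' x)\<bar> \<le> 1 / (1 / \<tau>)" using \<rho>u[of "\<phi>' x"] \<tau> by (intro divide_left_mono mult_pos_pos) auto
    then show ?thesis by (simp add: abs_divide)
  qed
  have e: "let k = inv_into (topspace euclidean) f ^^ n; y = k x; w = mderiv torus_atlas k x v in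
       sqrt (Q w w) \<le> 2 * \<tau> ^ n * sqrt (Q v v)"
    if "v \<in> Eu x" for v x n
    using contraction[OF lift' D' D'_vu rho' Q_bounds(3,4), of v x n] that
    by (simp add: Eu_def inv_f Let_def)
  show "\<exists>G C \<mu>. continuous_riemannian_metric euclidean torus_atlas G \<and> 0 < C \<and> 0 < \<mu> \<and> \<mu> < 1 \<and>
     (\<forall>x\<in>topspace euclidean. \<forall>n.
         (\<forall>v\<in>Es x. let y = (f ^^ n) x; w = mderiv torus_atlas (f ^^ n) x v
             in sqrt (G y w w) \<le> C * \<mu> ^ n * sqrt (G x v v)) \<and>
         (\<forall>v\<in>Eu x. let k = inv_into (topspace euclidean) f ^^ n; y = k x; w = mderiv torus_atlas k x v
             in sqrt (G y w w) \<le> C * \<mu> ^ n * sqrt (G x v v)))"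
    using metric_Q \<tau> c e
    by (intro exI[of _ "\<lambda>_. Q"] exI[of _ 2] exI[of _ \<tau>] conjI ballI allI) simp_all
qed (simp_all only: subbundle splitting invariant)

text \<open>After one period the lift returns to \<open>x\<close> only up to an integer vector, and
  periodicity of \<open>v\<close> closes the loop. On the line the derivative is then a scalar,
  unique because \<open>v x\<close> is nonzero, as the definite description requires.\<close>

lemma periodic_eigenvalue_line:
  assumes v: "\<And>x. D x (v x) = \<rho> x *\<^sub>R v (\<phi> x)" and per: "torus_periodic v" and nz: "\<And>x. v x \<noteq> 0"
    and E: "E (abs_torus x) = span {v x}"
    and p: "(f ^^ m) (abs_torus x) = abs_torus x" "m > 0"
  shows "periodic_eigenvalue torus_atlas f E (abs_torus x)
    = (\<Prod>i<least_power f (abs_torus x). \<rho> ((\<phi> ^^ i) x))"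
proof -
  define n where "n = least_power f (abs_torus x)"
  have n: "(f ^^ n) (abs_torus x) = abs_torus x"
    unfolding n_def by (rule least_powerI[OF p])
  define R where "R = (\<Prod>i<n. \<rho> ((\<phi> ^^ i) x))"
  have der: "\<exists>F. ((\<phi> ^^ n) has_derivative F) (at x) \<and>
    F (v x) = (\<Prod>i<n. \<rho> ((\<phi> ^^ i) x)) *\<^sub>R v ((\<phi> ^^ n) x)" for x
    by (rule has_derivative_funpow_cocycle[OF D v])
  then obtain F where F: "((\<phi> ^^ n) has_derivative F) (at x)" "F (v x) = R *\<^sub>R v ((\<phi> ^^ n) x)"
    unfolding R_def by blast
  have "continuous_on UNIV (\<phi> ^^ n)"
    by (intro continuous_at_imp_continuous_on ballI) (use der has_derivative_continuous in blast)
  then have m: "mderiv torus_atlas (f ^^ n) (abs_torus x) = F"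
    using mderiv_torus[OF torus_lift_funpow[OF lift] _ F(1)] by simp
  have "torus_rel ((\<phi> ^^ n) x) x"
    using n torus_liftD[OF torus_lift_funpow[OF lift]] by (metis abs_torus_eq_iff)
  then have Fv: "F (v x) = R *\<^sub>R v x" using F(2) torus_periodicD[OF per] by metis
  have "(THE l. \<forall>u\<in>span {v x}. F u = l *\<^sub>R u) = R"
  proof (rule the_equality)
    show "\<forall>u\<in>span {v x}. F u = R *\<^sub>R u"
      using linear_scale[OF has_derivative_linear[OF F(1)]] Fv by (auto simp: span_singleton)
    fix l assume "\<forall>u\<in>span {v x}. F u = l *\<^sub>R u"
    then have "F (v x) = l *\<^sub>R v x" by (simp add: span_base)
    then show "l = R" using Fv nz[of x] by simp
  qed
  then show ?thesis
    unfolding periodic_eigenvalue_def E n_def[symmetric] m R_def[symmetric] .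
qed

lemma periodic_eigenvalues:
  assumes p: "(f ^^ m) (abs_torus x) = abs_torus x" "m > 0"
  shows "periodic_eigenvalue torus_atlas f Es (abs_torus x)
      = (\<Prod>i<least_power f (abs_torus x). \<rho>s ((\<phi> ^^ i) x))"
    and "periodic_eigenvalue torus_atlas f Eu (abs_torus x)
      = (\<Prod>i<least_power f (abs_torus x). \<rho>u ((\<phi> ^^ i) x))"
  by (rule periodic_eigenvalue_line[where v=vs and \<rho>=\<rho>s and E=Es, OF Dvs vs_per nz(1) E_abs(1) p],
      rule periodic_eigenvalue_line[where v=vu and \<rho>=\<rho>u and E=Eu, OF Dvu vu_per nz(2) E_abs(2) p])

end

section \<open>Invariant slopes and cohomological equations\<close>

text \<open>By Brouwer's theorem: the map sending \<open>v\<close> to \<open>y + (v - f v)\<close>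
  preserves \<open>cball y B\<close>, and its fixed points solve \<open>f v = y\<close>.\<close>

lemma surj_bounded_perturbation:
  fixes f :: "'a::euclidean_space \<Rightarrow> 'a"
  assumes "continuous_on UNIV f" "\<And>x. norm (f x - x) \<le> B"
  shows "surj f"
proof -
  have "\<exists>x\<in>cball y B. f x = y" for y
  proof (rule brouwer_surjective[where S="{y}"])
    have "0 \<le> B" using assms(2)[of 0] norm_ge_zero order_trans by blast
    then show "cball y B \<noteq> {}" by simp
    show "continuous_on (cball y B) f" using assms(1) continuous_on_subset by blast
    show "u + (v - f v) \<in> cball y B" if "u \<in> {y}" "v \<in> cball y B" for u v
      using that assms(2)[of v] by (simp add: dist_norm norm_minus_commute)
  qed auto
  then show ?thesis by (metis surjI)
qed

text \<open>On the interval from -1 to 1 the denominator is at least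
  \<open>\<bar>\<delta>\<bar> - \<bar>\<gamma>\<bar>\<close> in absolute value, and the difference
  of two values is the determinant times \<open>s - t\<close> over two such denominators. The
  determinant is at most \<open>(\<bar>\<alpha>\<bar> + \<bar>\<beta>\<bar>) *
  \<bar>\<delta>\<bar>\<close>, so the one hypothesis \<open>bound\<close> yields both the size of
  the image and the contraction factor.\<close>

lemma moebius_contraction:
  fixes \<alpha> \<beta> \<gamma> \<delta> \<kappa> s t :: real
  assumes \<gamma>: "\<bar>\<gamma>\<bar> < \<bar>\<delta>\<bar>" and \<kappa>: "0 \<le> \<kappa>"
    and bound: "(\<bar>\<alpha>\<bar> + \<bar>\<beta>\<bar>) * \<bar>\<delta>\<bar> \<le> \<kappa> * (\<bar>\<delta>\<bar> - \<bar>\<gamma>\<bar>)\<^sup>2" and s: "\<bar>s\<bar> \<le> 1" and t: "\<bar>t\<bar> \<le> 1"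
  shows "\<gamma> * t + \<delta> \<noteq> 0" and "\<bar>(\<alpha> * t + \<beta>) / (\<gamma> * t + \<delta>)\<bar> \<le> \<kappa>"
    and "\<bar>(\<alpha> * s + \<beta>) / (\<gamma> * s + \<delta>) - (\<alpha> * t + \<beta>) / (\<gamma> * t + \<delta>)\<bar> \<le> \<kappa> * \<bar>s - t\<bar>"
proof -
  define q where "q = \<bar>\<delta>\<bar> - \<bar>\<gamma>\<bar>"
  have q: "q > 0" using \<gamma> by (simp add: q_def)
  have low: "q \<le> \<bar>\<gamma> * r + \<delta>\<bar>" if "\<bar>r\<bar> \<le> 1" for r
  proof -
    have "\<bar>\<gamma> * r\<bar> \<le> \<bar>\<gamma>\<bar>" using that by (simp add: abs_mult mult_left_le)
    then show ?thesis unfolding q_def by linarith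
  qed
  show nz: "\<gamma> * t + \<delta> \<noteq> 0" using low[OF t] q by auto
  have nzs: "\<gamma> * s + \<delta> \<noteq> 0" using low[OF s] q by auto
  have ab: "\<bar>\<alpha>\<bar> + \<bar>\<beta>\<bar> \<le> \<kappa> * q"
  proof -
    have "(\<bar>\<alpha>\<bar> + \<bar>\<beta>\<bar>) * \<bar>\<delta>\<bar> \<le> (\<kappa> * q) * q" using bound by (simp add: q_def power2_eq_square)
    also have "\<dots> \<le> (\<kappa> * q) * \<bar>\<delta>\<bar>" using q \<kappa> by (intro mult_left_mono) (auto simp: q_def)
    finally show ?thesis using \<gamma> by (simp add: mult_le_cancel_right)
  qed
  have "\<bar>\<alpha> * t + \<beta>\<bar> \<le> \<bar>\<alpha>\<bar> + \<bar>\<beta>\<bar>"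
    using t by (intro order_trans[OF abs_triangle_ineq] add_mono) (auto simp: abs_mult mult_left_le)
  also have "\<dots> \<le> \<kappa> * \<bar>\<gamma> * t + \<delta>\<bar>"
    using ab low[OF t] \<kappa> by (meson mult_left_mono order_trans)
  finally show "\<bar>(\<alpha> * t + \<beta>) / (\<gamma> * t + \<delta>)\<bar> \<le> \<kappa>"
    using nz by (simp add: abs_divide divide_le_eq)
  have "(\<alpha> * s + \<beta>) / (\<gamma> * s + \<delta>) - (\<alpha> * t + \<beta>) / (\<gamma> * t + \<delta>)
      = (\<alpha> * \<delta> - \<beta> * \<gamma>) * (s - t) / ((\<gamma> * s + \<delta>) * (\<gamma> * t + \<delta>))"
    using nz nzs by (simp add: field_simps)
  moreover have "\<bar>(\<alpha> * \<delta> - \<beta> * \<gamma>) * (s - t)\<bar> \<le> \<kappa> * \<bar>s - t\<bar> * \<bar>(\<gamma> * s + \<delta>) * (\<gamma> * t + \<delta>)\<bar>"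
  proof -
    have "\<bar>\<alpha> * \<delta> - \<beta> * \<gamma>\<bar> \<le> \<bar>\<alpha>\<bar> * \<bar>\<delta>\<bar> + \<bar>\<beta>\<bar> * \<bar>\<gamma>\<bar>"
      by (metis abs_mult abs_triangle_ineq4)
    also have "\<dots> \<le> (\<bar>\<alpha>\<bar> + \<bar>\<beta>\<bar>) * \<bar>\<delta>\<bar>"
      using \<gamma> by (simp add: distrib_right mult_left_mono)
    also have "\<dots> \<le> \<kappa> * (q * q)" using bound by (simp add: q_def power2_eq_square)
    also have "\<dots> \<le> \<kappa> * (\<bar>\<gamma> * s + \<delta>\<bar> * \<bar>\<gamma> * t + \<delta>\<bar>)"
      using low[OF s] low[OF t] q \<kappa> by (intro mult_left_mono mult_mono) auto
    finally have "\<bar>\<alpha> * \<delta> - \<beta> * \<gamma>\<bar> * \<bar>s - t\<bar> \<le> \<kappa> * (\<bar>\<gamma> * s + \<delta>\<bar> * \<bar>\<gamma> * t + \<delta>\<bar>) * \<bar>s - t\<bar>"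
      by (rule mult_right_mono) simp
    then show ?thesis by (simp add: abs_mult mult_ac)
  qed
  ultimately show "\<bar>(\<alpha> * s + \<beta>) / (\<gamma> * s + \<delta>) - (\<alpha> * t + \<beta>) / (\<gamma> * t + \<delta>)\<bar> \<le> \<kappa> * \<bar>s - t\<bar>"
    using nz nzs by (simp add: abs_divide divide_le_eq abs_mult mult_ac)
qed

text \<open>The slope of an invariant line field is a fixed point of the graph transform, which acts on
  slopes by Moebius maps contracting the interval \<open>[-1, 1]\<close>.\<close>

lemma invariant_slope:
  fixes \<phi> :: "real^2 \<Rightarrow> real^2" and \<alpha> \<beta> \<gamma> \<delta> :: "real^2 \<Rightarrow> real"
  assumes cont: "continuous_on UNIV \<phi>" "continuous_on UNIV \<alpha>" "continuous_on UNIV \<beta>"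
      "continuous_on UNIV \<gamma>" "continuous_on UNIV \<delta>"
    and equi: "torus_equivariant \<phi>"
    and per: "torus_periodic \<alpha>" "torus_periodic \<beta>" "torus_periodic \<gamma>" "torus_periodic \<delta>"
    and \<gamma>: "\<And>x. \<bar>\<gamma> x\<bar> < \<bar>\<delta> x\<bar>" and \<kappa>: "0 \<le> \<kappa>" "\<kappa> < 1"
    and bound: "\<And>x. (\<bar>\<alpha> x\<bar> + \<bar>\<beta> x\<bar>) * \<bar>\<delta> x\<bar> \<le> \<kappa> * (\<bar>\<delta> x\<bar> - \<bar>\<gamma> x\<bar>)\<^sup>2"
  obtains w where "continuous_on UNIV w" "torus_periodic w" "\<And>x. \<bar>w x\<bar> < 1"
    "\<And>x. w x = (\<alpha> x * w (\<phi> x) + \<beta> x) / (\<gamma> x * w (\<phi> x) + \<delta> x)"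
proof -
  \<comment> \<open>The bound and the lattice invariance are closed conditions built into the
    complete space, so the fixed point inherits them.\<close>
  define X :: "((real^2) \<Rightarrow>\<^sub>C real) set" where
    "X = {w. (\<forall>x. \<bar>apply_bcontfun w x\<bar> \<le> 1) \<and>
      (\<forall>x y. torus_rel x y \<longrightarrow> apply_bcontfun w x = apply_bcontfun w y)}"
  define T where "T w x = (\<alpha> x * w (\<phi> x) + \<beta> x) / (\<gamma> x * w (\<phi> x) + \<delta> x)" for w :: "real^2 \<Rightarrow> real" and x
  note mc = moebius_contraction[OF \<gamma> \<kappa>(1) bound]
  have T_cont: "continuous_on UNIV (T (apply_bcontfun w))" if "w \<in> X" for w
    unfolding T_def using cont
    by (intro continuous_intros continuous_on_compose2[OF _ cont(1)])
      (use mc(1)[where s=0 and t="apply_bcontfun w (\<phi> x)" for x] that in \<open>auto simp: X_def\<close>)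
  have T_bound: "\<bar>T (apply_bcontfun w) x\<bar> \<le> \<kappa>" if "w \<in> X" for w x
    unfolding T_def by (rule mc(2)[where s=0]) (use that in \<open>auto simp: X_def\<close>)
  have T_bcont: "T (apply_bcontfun w) \<in> bcontfun" if "w \<in> X" for w
    using T_cont[OF that] T_bound[OF that] by (intro bcontfun_normI) auto
  define F where "F w = Bcontfun (T (apply_bcontfun w))" for w
  have F: "apply_bcontfun (F w) = T (apply_bcontfun w)" if "w \<in> X" for w
    unfolding F_def using T_bcont[OF that] by (simp add: Bcontfun_inverse)
  have "\<exists>!w\<in>X. F w = w"
  proof (rule Banach_fix)
    have "X = (\<Inter>x. {w. \<bar>apply_bcontfun w x\<bar> \<le> 1}) \<inter>
        (\<Inter>(x,y)\<in>{(x,y). torus_rel x y}. {w. apply_bcontfun w x = apply_bcontfun w y})"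
      by (auto simp: X_def)
    moreover have ev: "continuous_on UNIV (\<lambda>w :: (real^2) \<Rightarrow>\<^sub>C real. apply_bcontfun w x)" for x
      by (rule lipschitz_on_continuous_on[of 1], rule lipschitz_onI) (simp_all add: dist_bounded)
    ultimately have "closed X"
      by (auto intro!: closed_Int closed_INT closed_Collect_le closed_Collect_eq continuous_intros ev)
    then show "complete X" by (simp add: complete_eq_closed)
    have "0 \<in> X" by (simp add: X_def)
    then show "X \<noteq> {}" by blast
    show "F ` X \<subseteq> X"
    proof (rule image_subsetI)
      fix w assume w: "w \<in> X"
      have "T (apply_bcontfun w) x = T (apply_bcontfun w) y" if "torus_rel x y" for x y
        using w torus_equivariantD[OF equi that] per[THEN torus_periodicD, OF that]
        unfolding T_def X_def by force
      moreover have "\<bar>T (apply_bcontfun w) x\<bar> \<le> 1" for x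
        using T_bound[OF w, of x] \<kappa> by linarith
      ultimately show "F w \<in> X" using F[OF w] by (auto simp: X_def)
    qed
    fix v w assume vw: "v \<in> X" "w \<in> X"
    show "dist (F v) (F w) \<le> \<kappa> * dist v w"
    proof (rule dist_bound)
      fix x
      have "dist (F v x) (F w x) \<le> \<kappa> * \<bar>v (\<phi> x) - w (\<phi> x)\<bar>"
        using vw moebius_contraction(3)[OF \<gamma>[of x] \<kappa>(1) bound[of x], of "v (\<phi> x)" "w (\<phi> x)"] by (simp add: F T_def dist_real_def X_def)
      also have "\<dots> \<le> \<kappa> * dist v w"
        using dist_bounded[of v "\<phi> x" w] \<kappa> by (intro mult_left_mono) (auto simp: dist_real_def)
      finally show "dist (F v x) (F w x) \<le> \<kappa> * dist v w" .
    qed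
  qed (use \<kappa> in auto)
  then obtain w where w: "w \<in> X" "F w = w" by blast
  then have fixw: "apply_bcontfun w = T (apply_bcontfun w)" using F by metis
  show thesis
  proof (rule that)
    show "continuous_on UNIV (apply_bcontfun w)" by (metis T_cont fixw w(1))
    show "torus_periodic (apply_bcontfun w)" using w by (auto simp: X_def torus_periodic_def)
    \<comment> \<open>The transform takes values of modulus at most \<open>\<kappa>\<close>, so the
      fixed point satisfies the strict bound although \<open>X\<close> asks only for the weak
      one.\<close>
    show "\<bar>w x\<bar> < 1" for x using T_bound[OF w(1), of x] fixw \<kappa> by (metis order_le_less_trans)
    show "w x = (\<alpha> x * w (\<phi> x) + \<beta> x) / (\<gamma> x * w (\<phi> x) + \<delta> x)" for x
      using fixw unfolding T_def by metis
  qed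
qed

text \<open>Iterating the equation gives the uniformly convergent sum of
  \<open>\<nu> ^ n * f ((\<phi> ^^ n) x)\<close>. Its vanishing along orbits on which
  \<open>f\<close> vanishes is what makes the conjugacy fix the prescribed points.\<close>

lemma series_solution:
  fixes \<phi> :: "real^2 \<Rightarrow> real^2" and f :: "real^2 \<Rightarrow> real"
  assumes cont: "continuous_on UNIV \<phi>" "continuous_on UNIV f" and equi: "torus_equivariant \<phi>"
    and per: "torus_periodic f" and B: "\<And>x. \<bar>f x\<bar> \<le> B" and \<nu>: "\<bar>\<nu>\<bar> < 1"
  obtains \<kappa> C where "continuous_on UNIV \<kappa>" "torus_periodic \<kappa>" "\<And>x. \<bar>\<kappa> x\<bar> \<le> C"
    "\<And>x. \<kappa> x = f x + \<nu> * \<kappa> (\<phi> x)" "\<And>x. (\<And>n. f ((\<phi> ^^ n) x) = 0) \<Longrightarrow> \<kappa> x = 0"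
proof -
  define t where "t n x = \<nu> ^ n * f ((\<phi> ^^ n) x)" for n :: nat and x
  define \<kappa> where "\<kappa> x = (\<Sum>n. t n x)" for x
  have t: "norm (t n x) \<le> \<bar>\<nu>\<bar> ^ n * B" for n x
    using B[of "(\<phi> ^^ n) x"] by (simp add: t_def abs_mult power_abs mult_left_mono)
  have sumB: "summable (\<lambda>n. \<bar>\<nu>\<bar> ^ n * B)" using \<nu> by (intro summable_mult2 summable_geometric) simp
  have sumt: "summable (\<lambda>n. t n x)" for x
    by (rule summable_comparison_test[OF _ sumB]) (use t in auto)
  have pow: "continuous_on UNIV (\<phi> ^^ n)" for n
    by (induction n) (auto simp: cont(1) intro!: continuous_on_compose[OF _ continuous_on_subset[OF cont(1)], unfolded o_def])
  show thesis
  proof (rule that)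
    have "uniform_limit UNIV (\<lambda>n x. \<Sum>i<n. t i x) \<kappa> sequentially"
      unfolding \<kappa>_def by (rule Weierstrass_m_test[OF t sumB])
    moreover have "continuous_on UNIV (\<lambda>x. \<Sum>i<n. t i x)" for n
      unfolding t_def by (intro continuous_intros continuous_on_compose2[OF cont(2) pow]) auto
    ultimately show "continuous_on UNIV \<kappa>"
      by (intro uniform_limit_theorem) (auto intro: always_eventually)
    show "torus_periodic \<kappa>"
      unfolding torus_periodic_def
    proof (intro allI impI)
      fix x y :: "real^2" assume "torus_rel x y"
      then have "t n x = t n y" for n
        unfolding t_def using torus_equivariantD[OF torus_equivariant_funpow[OF equi]] torus_periodicD[OF per] by metis
      then show "\<kappa> x = \<kappa> y" by (simp add: \<kappa>_def)
    qed
    show "\<bar>\<kappa> x\<bar> \<le> (\<Sum>n. \<bar>\<nu>\<bar> ^ n * B)" for x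
      unfolding \<kappa>_def real_norm_def[symmetric]
      by (rule order_trans[OF summable_norm suminf_le])
        (use t sumB in \<open>auto intro: summable_comparison_test[OF _ sumB] summable_norm_cancel\<close>)
    show "\<kappa> x = f x + \<nu> * \<kappa> (\<phi> x)" for x
    proof -
      have "\<kappa> x = t 0 x + (\<Sum>n. t (Suc n) x)"
        unfolding \<kappa>_def using suminf_split_head[OF sumt] by simp
      also have "(\<Sum>n. t (Suc n) x) = (\<Sum>n. \<nu> * t n (\<phi> x))"
        by (simp add: t_def funpow_swap1 mult.assoc)
      also have "\<dots> = \<nu> * \<kappa> (\<phi> x)" unfolding \<kappa>_def by (rule suminf_mult[OF sumt])
      finally show ?thesis by (simp add: t_def)
    qed
    show "\<kappa> x = 0" if "\<And>n. f ((\<phi> ^^ n) x) = 0" for x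
      by (simp add: \<kappa>_def t_def that)
  qed
qed

section \<open>Perturbed automorphisms\<close>

lemma bounded_geometric_zero:
  fixes t \<tau> C :: real
  assumes "0 < \<tau>" "\<tau> < 1" "\<And>n. t \<le> \<tau> ^ n * C" "0 \<le> t"
  shows "t = 0"
proof -
  have "(\<lambda>n. \<tau> ^ n * C) \<longlonglongrightarrow> 0 * C"
    by (intro tendsto_mult_right LIMSEQ_power_zero) (use assms in auto)
  then have "t \<le> 0 * C" by (rule LIMSEQ_le_const) (use assms in auto)
  then show ?thesis using assms by simp
qed

text \<open>In \<open>\<eta>s\<close>, \<open>\<eta>u\<close>, \<open>\<psi>s\<close>,
  \<open>\<psi>u\<close> the last letter names the direction of the partial derivative. The diagonal
  bounds are one-sided: \<open>1 + \<eta>s\<close> may drop to \<open>m\<close>, and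
  \<open>\<psi>u\<close> has no upper bound. The square of \<open>\<mu>u\<close> in
  \<open>off\<close> is the ratio of the two eigenvalues up to sign, by which the equation for the
  stable slope amplifies \<open>\<psi>s\<close>. The set \<open>P\<close> stands for the preimage of
  the prescribed orbits.\<close>

locale perturbed_automorphism =
  fixes A Ai :: "real^2 \<Rightarrow> real^2" and S U :: "real^2 \<Rightarrow> real" and es eu :: "real^2"
    and \<mu>s \<mu>u :: real and \<eta> \<eta>s \<eta>u \<psi> \<psi>s \<psi>u :: "real^2 \<Rightarrow> real"
    and P :: "(real^2) set" and \<epsilon> \<tau> m B :: real
  assumes linA: "linear A" and linAi: "linear Ai"
    and equiA: "torus_equivariant A" and equiAi: "torus_equivariant Ai"
    and AiA: "\<And>x. Ai (A x) = x" and AAi: "\<And>x. A (Ai x) = x"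
    and linS: "linear S" and linU: "linear U"
    and basis: "\<And>x. x = S x *\<^sub>R es + U x *\<^sub>R eu"
    and dual: "S es = 1" "S eu = 0" "U es = 0" "U eu = 1"
    and SA: "\<And>x. S (A x) = \<mu>s * S x" and UA: "\<And>x. U (A x) = \<mu>u * U x"
    and \<mu>: "\<bar>\<mu>s\<bar> * \<bar>\<mu>u\<bar> = 1"
    and \<eta>: "\<And>x. (\<eta> has_derivative (\<lambda>h. \<eta>s x * S h + \<eta>u x * U h)) (at x)"
    and \<psi>: "\<And>x. (\<psi> has_derivative (\<lambda>h. \<psi>s x * S h + \<psi>u x * U h)) (at x)"
    and lip: "loclip \<eta>s" "loclip \<eta>u" "loclip \<psi>s" "loclip \<psi>u"
    and per: "torus_periodic \<eta>" "torus_periodic \<psi>"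
      "torus_periodic \<eta>s" "torus_periodic \<eta>u" "torus_periodic \<psi>s" "torus_periodic \<psi>u"
    and bd: "\<And>x. \<bar>\<eta> x\<bar> \<le> B" "\<And>x. \<bar>\<psi> x\<bar> \<le> B"
    and \<tau>: "0 < \<tau>" "\<tau> < 1" and \<epsilon>: "0 < \<epsilon>" "\<tau> * (1 + 2 * \<epsilon>) \<le> 1" "1 \<le> \<tau> * (\<bar>\<mu>u\<bar> * (1 - 2 * \<epsilon>))"
    and m: "\<epsilon> < m"
    and \<eta>s: "\<And>x. m \<le> 1 + \<eta>s x" "\<And>x. \<eta>s x \<le> \<epsilon>" and \<psi>u: "\<And>x. - \<epsilon> \<le> \<psi>u x"
    and off: "\<And>x. \<bar>\<eta>u x\<bar> * (\<bar>\<mu>u\<bar> * \<bar>\<mu>u\<bar>) \<le> \<epsilon>" "\<And>x. \<bar>\<psi>s x\<bar> * (\<bar>\<mu>u\<bar> * \<bar>\<mu>u\<bar>) \<le> \<epsilon>"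
    and P: "\<And>x. x \<in> P \<Longrightarrow> A x \<in> P" "\<And>x. x \<in> P \<Longrightarrow> Ai x \<in> P"
      "\<And>x. x \<in> P \<Longrightarrow> \<eta> x = 0" "\<And>x. x \<in> P \<Longrightarrow> \<psi> x = 0"
      "\<And>x. x \<in> P \<Longrightarrow> \<eta>u x = 0" "\<And>x. x \<in> P \<Longrightarrow> \<psi>s x = 0"
begin

section \<open>Bounds for the perturbation of the identity\<close>

definition "a x = 1 + \<eta>s x"
definition "d x = 1 + \<psi>u x"
definition "\<Lambda> = \<bar>\<mu>u\<bar>"

lemma S_simps: "S (x + y) = S x + S y" "S (x - y) = S x - S y" "S (c *\<^sub>R x) = c * S x" "S 0 = 0"
  using linS by (simp_all add: linear_add linear_diff linear_scale linear_0)

lemma U_simps: "U (x + y) = U x + U y" "U (x - y) = U x - U y" "U (c *\<^sub>R x) = c * U x" "U 0 = 0"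
  using linU by (simp_all add: linear_add linear_diff linear_scale linear_0)

lemma eqI: "S x = S y \<Longrightarrow> U x = U y \<Longrightarrow> x = y"
  by (metis basis)

lemma \<epsilon>_half: "2 * \<epsilon> < 1"
proof (rule ccontr)
  assume "\<not> 2 * \<epsilon> < 1"
  then have "\<tau> * (\<bar>\<mu>u\<bar> * (1 - 2 * \<epsilon>)) \<le> 0" using \<tau> by (intro mult_nonneg_nonpos) auto
  then show False using \<epsilon> by linarith
qed

text \<open>Expansion is forced by
  \<open>1 \<le> \<tau> * (\<Lambda> * (1 - 2 * \<epsilon>))\<close> together with
  \<open>\<tau> < 1\<close>; the product condition then determines the modulus of
  \<open>\<mu>s\<close>.\<close>

lemma \<Lambda>: "1 < \<Lambda>" "\<bar>\<mu>s\<bar> = 1 / \<Lambda>" "\<bar>\<mu>u\<bar> = \<Lambda>" "\<mu>s \<noteq> 0" "\<mu>u \<noteq> 0"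
proof -
  have "1 \<le> \<tau> * (\<Lambda> * (1 - 2 * \<epsilon>))" using \<epsilon> by (simp add: \<Lambda>_def)
  also have "\<dots> \<le> \<tau> * (\<Lambda> * 1)" using \<tau> \<epsilon> by (intro mult_left_mono) (auto simp: \<Lambda>_def)
  also have "\<dots> < 1 * \<Lambda>"
  proof -
    have "\<Lambda> \<noteq> 0" using \<epsilon> by (auto simp: \<Lambda>_def)
    then show ?thesis using \<tau> by (simp add: \<Lambda>_def)
  qed
  finally show *: "1 < \<Lambda>" by simp
  show "\<bar>\<mu>s\<bar> = 1 / \<Lambda>" using \<mu> * by (simp add: \<Lambda>_def field_simps)
  then show "\<bar>\<mu>u\<bar> = \<Lambda>" "\<mu>s \<noteq> 0" "\<mu>u \<noteq> 0" using * \<mu> by (auto simp: \<Lambda>_def)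
qed

lemma ad: "m \<le> a x" "a x \<le> 1 + \<epsilon>" "1 - \<epsilon> \<le> d x" "0 < a x" "0 < d x"
  using \<eta>s[of x] \<psi>u[of x] m \<epsilon> \<epsilon>_half by (simp_all add: a_def d_def)

lemma off': "\<bar>\<eta>u x\<bar> * \<Lambda> \<le> \<epsilon>" "\<bar>\<psi>s x\<bar> * \<Lambda> \<le> \<epsilon>" "\<bar>\<eta>u x\<bar> \<le> \<epsilon>" "\<bar>\<psi>s x\<bar> \<le> \<epsilon>"
proof -
  have *: "y * \<Lambda> \<le> \<epsilon> \<and> y \<le> \<epsilon>" if "0 \<le> y" "y * (\<Lambda> * \<Lambda>) \<le> \<epsilon>" for y
  proof -
    have "y \<le> y * \<Lambda>" "y * \<Lambda> \<le> y * (\<Lambda> * \<Lambda>)"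
      using that \<Lambda> by (simp_all add: mult_left_le mult_le_cancel_left1 mult_left_mono)
    then show ?thesis using that by linarith
  qed
  show "\<bar>\<eta>u x\<bar> * \<Lambda> \<le> \<epsilon>" "\<bar>\<psi>s x\<bar> * \<Lambda> \<le> \<epsilon>" "\<bar>\<eta>u x\<bar> \<le> \<epsilon>" "\<bar>\<psi>s x\<bar> \<le> \<epsilon>"
    using *[of "\<bar>\<eta>u x\<bar>"] *[of "\<bar>\<psi>s x\<bar>"] off[of x] unfolding \<Lambda> by auto
qed

text \<open>The nonlinear factor of \<open>g\<close>, which will be \<open>A\<close> after
  \<open>G\<close>. It differs from the identity by a bounded lattice-periodic field.\<close>

definition "G x = x + \<eta> x *\<^sub>R es + \<psi> x *\<^sub>R eu"

lemma SG: "S (G x) = S x + \<eta> x" and UG: "U (G x) = U x + \<psi> x"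
  by (simp_all add: G_def S_simps U_simps dual)

text \<open>For a scalar function the mean value theorem along the segment gives an exact identity
  at one point \<open>\<xi>\<close>. The two coordinates of \<open>G\<close> have different points
  \<open>\<xi>\<close>, which is harmless because all estimates treat them separately.\<close>

lemma mean_value:
  assumes F: "\<And>x. (F has_derivative (\<lambda>h. p x * S h + q x * U h)) (at x)"
  obtains \<xi> where "F x - F y = p \<xi> * (S x - S y) + q \<xi> * (U x - U y)"
proof -
  have "\<exists>t\<in>{0<..<1}. F (y + 1 *\<^sub>R (x - y)) - F (y + 0 *\<^sub>R (x - y)) =
      (\<lambda>h. p (y + t *\<^sub>R (x - y)) * (h * S (x - y)) + q (y + t *\<^sub>R (x - y)) * (h * U (x - y))) (1 - 0)"
  proof (rule mvt_simple[where f="\<lambda>t. F (y + t *\<^sub>R (x - y))"])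
    fix t :: real
    have "((\<lambda>t. y + t *\<^sub>R (x - y)) has_derivative (\<lambda>h. h *\<^sub>R (x - y))) (at t)"
      by (auto intro!: derivative_eq_intros)
    from has_derivative_compose[OF this F]
    have "((\<lambda>t. F (y + t *\<^sub>R (x - y))) has_derivative
        (\<lambda>h. p (y + t *\<^sub>R (x - y)) * (h * S (x - y)) + q (y + t *\<^sub>R (x - y)) * (h * U (x - y)))) (at t)"
      by (simp add: S_simps U_simps)
    then show "((\<lambda>t. F (y + t *\<^sub>R (x - y))) has_derivative
        (\<lambda>h. p (y + t *\<^sub>R (x - y)) * (h * S (x - y)) + q (y + t *\<^sub>R (x - y)) * (h * U (x - y))))
        (at t within {0..1})" by (rule has_derivative_at_withinI)
  qed simp
  then show thesis using that by (auto simp: S_simps U_simps)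
qed

lemma SG_diff:
  obtains \<xi> where "S (G x) - S (G y) = a \<xi> * (S x - S y) + \<eta>u \<xi> * (U x - U y)"
proof -
  obtain \<xi> where "\<eta> x - \<eta> y = \<eta>s \<xi> * (S x - S y) + \<eta>u \<xi> * (U x - U y)"
    using mean_value[OF \<eta>] by blast
  then show thesis using that[of \<xi>] by (simp add: SG a_def algebra_simps)
qed

lemma UG_diff:
  obtains \<xi> where "U (G x) - U (G y) = \<psi>s \<xi> * (S x - S y) + d \<xi> * (U x - U y)"
proof -
  obtain \<xi> where "\<psi> x - \<psi> y = \<psi>s \<xi> * (S x - S y) + \<psi>u \<xi> * (U x - U y)"
    using mean_value[OF \<psi>] by blast
  then show thesis using that[of \<xi>] by (simp add: UG d_def algebra_simps)
qed

lemma SG_bounds: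
  shows "\<bar>S (G x) - S (G y)\<bar> \<le> (1 + \<epsilon>) * \<bar>S x - S y\<bar> + \<epsilon> * \<bar>U x - U y\<bar>"
    and "m * \<bar>S x - S y\<bar> - \<epsilon> * \<bar>U x - U y\<bar> \<le> \<bar>S (G x) - S (G y)\<bar>"
proof -
  obtain \<xi> where \<xi>: "S (G x) - S (G y) = a \<xi> * (S x - S y) + \<eta>u \<xi> * (U x - U y)"
    using SG_diff by blast
  have 1: "m * \<bar>S x - S y\<bar> \<le> \<bar>a \<xi> * (S x - S y)\<bar>" "\<bar>a \<xi> * (S x - S y)\<bar> \<le> (1 + \<epsilon>) * \<bar>S x - S y\<bar>"
    unfolding abs_mult using ad[of \<xi>] by (auto intro!: mult_right_mono)
  have 2: "\<bar>\<eta>u \<xi> * (U x - U y)\<bar> \<le> \<epsilon> * \<bar>U x - U y\<bar>"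
    unfolding abs_mult using off'[of \<xi>] by (intro mult_right_mono) auto
  show "\<bar>S (G x) - S (G y)\<bar> \<le> (1 + \<epsilon>) * \<bar>S x - S y\<bar> + \<epsilon> * \<bar>U x - U y\<bar>"
    and "m * \<bar>S x - S y\<bar> - \<epsilon> * \<bar>U x - U y\<bar> \<le> \<bar>S (G x) - S (G y)\<bar>"
    unfolding \<xi> using 1 2 by linarith+
qed

lemma UG_bound: "(1 - \<epsilon>) * \<bar>U x - U y\<bar> - \<epsilon> * \<bar>S x - S y\<bar> \<le> \<bar>U (G x) - U (G y)\<bar>"
proof -
  obtain \<xi> where \<xi>: "U (G x) - U (G y) = \<psi>s \<xi> * (S x - S y) + d \<xi> * (U x - U y)"
    using UG_diff by blast
  have "(1 - \<epsilon>) * \<bar>U x - U y\<bar> \<le> \<bar>d \<xi> * (U x - U y)\<bar>"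
    unfolding abs_mult using ad[of \<xi>] by (intro mult_right_mono) auto
  moreover have "\<bar>\<psi>s \<xi> * (S x - S y)\<bar> \<le> \<epsilon> * \<bar>S x - S y\<bar>"
    unfolding abs_mult using off'[of \<xi>] by (intro mult_right_mono) auto
  ultimately show ?thesis unfolding \<xi> by linarith
qed

definition "coord_norm x = \<bar>S x\<bar> + \<bar>U x\<bar>"

lemma coord_norm_equiv:
  obtains K where "K > 0" "\<And>x. norm x \<le> K * coord_norm x" "\<And>x. coord_norm x \<le> K * norm x"
proof -
  have blS: "bounded_linear S" "bounded_linear U"
    using linS linU by (simp_all add: linear_conv_bounded_linear)
  obtain KS where KS: "KS > 0" "\<And>x. norm (S x) \<le> norm x * KS" using bounded_linear.pos_bounded[OF blS(1)] by blast
  obtain KU where KU: "KU > 0" "\<And>x. norm (U x) \<le> norm x * KU" using bounded_linear.pos_bounded[OF blS(2)] by blast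
  let ?K = "KS + KU + norm es + norm eu"
  have "norm x \<le> ?K * coord_norm x" for x
  proof -
    have "norm x \<le> \<bar>S x\<bar> * norm es + \<bar>U x\<bar> * norm eu"
      by (subst basis[of x]) (metis norm_scaleR norm_triangle_ineq)
    also have "\<dots> \<le> \<bar>S x\<bar> * ?K + \<bar>U x\<bar> * ?K"
      using KS(1) KU(1) by (intro add_mono mult_left_mono) auto
    finally show ?thesis by (simp add: coord_norm_def algebra_simps)
  qed
  moreover have "coord_norm x \<le> ?K * norm x" for x
  proof -
    have "coord_norm x \<le> norm x * KS + norm x * KU"
      using KS(2)[of x] KU(2)[of x] by (simp add: coord_norm_def)
    also have "\<dots> \<le> ?K * norm x" by (simp add: algebra_simps)
    finally show ?thesis .
  qed
  moreover have "?K > 0" using KS(1) KU(1) by (simp add: add_pos_nonneg)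
  ultimately show thesis using that by blast
qed

text \<open>Adding the lower bounds for the two coordinates costs \<open>\<epsilon>\<close> in each
  coefficient and leaves \<open>m - \<epsilon>\<close> and \<open>1 - 2 * \<epsilon>\<close>; the
  first is positive by \<open>\<epsilon> < m\<close>. Injectivity and a Lipschitz inverse follow
  even where \<open>\<eta>s\<close> is not small.\<close>

lemma G_expand:
  defines "r \<equiv> min (m - \<epsilon>) (1 - 2 * \<epsilon>)"
  shows "0 < r" and "r * coord_norm (x - y) \<le> coord_norm (G x - G y)"
proof -
  show "0 < r" using m \<epsilon>_half by (simp add: r_def)
  have "r * coord_norm (x - y) = r * \<bar>S x - S y\<bar> + r * \<bar>U x - U y\<bar>"
    by (simp add: coord_norm_def S_simps U_simps algebra_simps)
  also have "\<dots> \<le> (m - \<epsilon>) * \<bar>S x - S y\<bar> + (1 - 2 * \<epsilon>) * \<bar>U x - U y\<bar>"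
    by (intro add_mono mult_right_mono) (auto simp: r_def)
  also have "\<dots> \<le> coord_norm (G x - G y)"
    using SG_bounds(2)[of x y] UG_bound[of x y]
    by (simp add: coord_norm_def S_simps U_simps algebra_simps)
  finally show "r * coord_norm (x - y) \<le> coord_norm (G x - G y)" .
qed

lemma coord_norm_eq_0: "coord_norm x = 0 \<Longrightarrow> x = 0"
  by (rule eqI) (simp_all add: coord_norm_def S_simps U_simps)

lemma inj_G: "inj G"
proof (rule injI)
  fix x y assume "G x = G y"
  then have "min (m - \<epsilon>) (1 - 2 * \<epsilon>) * coord_norm (x - y) \<le> 0"
    using G_expand(2)[of x y] by (simp add: coord_norm_def S_simps U_simps)
  then have "coord_norm (x - y) \<le> 0" using G_expand(1) by (simp add: mult_le_0_iff)
  moreover have "0 \<le> coord_norm (x - y)" by (simp add: coord_norm_def)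
  ultimately have "coord_norm (x - y) = 0" by simp
  then have "x - y = 0" by (rule coord_norm_eq_0)
  then show "x = y" by simp
qed

lemma cont_\<eta>\<psi>: "continuous_on UNIV \<eta>" "continuous_on UNIV \<psi>"
  by (intro continuous_at_imp_continuous_on ballI has_derivative_continuous[OF \<eta>]
      has_derivative_continuous[OF \<psi>])+

lemma surj_G: "surj G"
proof (rule surj_bounded_perturbation)
  show "continuous_on UNIV G" unfolding G_def by (intro continuous_intros cont_\<eta>\<psi>)
  fix x
  have "norm (G x - x) \<le> \<bar>\<eta> x\<bar> * norm es + \<bar>\<psi> x\<bar> * norm eu"
    by (metis (no_types) G_def add_diff_cancel_left' add.assoc norm_scaleR norm_triangle_ineq)
  also have "\<dots> \<le> B * norm es + B * norm eu"
    using bd by (intro add_mono mult_right_mono) auto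
  finally show "norm (G x - x) \<le> B * norm es + B * norm eu" .
qed

section \<open>The perturbed diffeomorphism and its inverse\<close>

definition "g x = A (G x)"
definition "g' y = inv G (Ai y)"

lemma g'_g: "g' (g x) = x" and g_g': "g (g' y) = y"
  unfolding g_def g'_def using inj_G surj_G AiA AAi by (simp_all add: surj_f_inv_f)

lemma Sg: "S (g x) = \<mu>s * S (G x)" and Ug: "U (g x) = \<mu>u * U (G x)"
  by (simp_all add: g_def SA UA)

lemma equi_g: "torus_equivariant g"
  unfolding torus_equivariant_def g_def
proof (intro allI impI torus_equivariantD[OF equiA])
  fix x y assume xy: "torus_rel x y"
  have "G x - G y = x - y"
    using torus_periodicD[OF per(1) xy] torus_periodicD[OF per(2) xy] by (simp add: G_def)
  then show "torus_rel (G x) (G y)" using xy torus_rel_diff by metis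
qed

text \<open>\<open>G\<close> commutes with integer translations. Moving \<open>g' v\<close> by the
  integer vector \<open>Ai u - Ai v\<close> therefore gives a point with the same
  \<open>G\<close>-image as \<open>g' u\<close>, and injectivity identifies the two.\<close>

lemma equi_g': "torus_equivariant g'"
  unfolding torus_equivariant_def
proof (intro allI impI)
  fix u v assume "torus_rel u v"
  then have uv: "torus_rel (Ai u) (Ai v)" using equiAi torus_equivariantD by blast
  let ?x = "g' u" and ?y = "g' v"
  let ?z = "?y + (Ai u - Ai v)"
  have zy: "torus_rel ?z ?y" using uv torus_rel_diff[of ?z ?y] torus_rel_diff[of "Ai u"] by simp
  have G: "G ?x = Ai u" "G ?y = Ai v" using surj_G by (simp_all add: g'_def surj_f_inv_f)
  have "G ?z - G ?y = ?z - ?y"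
    using torus_periodicD[OF per(1) zy] torus_periodicD[OF per(2) zy] by (simp add: G_def)
  then have "G ?z = G ?x" using G by (simp add: algebra_simps)
  then have "?z = ?x" using inj_G by (simp add: inj_eq)
  then show "torus_rel ?x ?y" using zy by simp
qed

text \<open>Rank-one operators: with them the derivative is a combination of four constant
  operators, and its Lipschitz property reduces to that of scalar coefficients.\<close>

definition "lin p F = Blinfun (\<lambda>v. F v *\<^sub>R p)" for p :: "real^2" and F :: "real^2 \<Rightarrow> real"

lemma lin: "linear F \<Longrightarrow> blinfun_apply (lin p F) v = F v *\<^sub>R p"
  unfolding lin_def
  by (subst bounded_linear_Blinfun_apply)
    (auto simp: linear_conv_bounded_linear intro!: bounded_linear_intros)

definition "Dg x = (\<mu>s * a x) *\<^sub>R lin es S + (\<mu>s * \<eta>u x) *\<^sub>R lin es U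
  + (\<mu>u * \<psi>s x) *\<^sub>R lin eu S + (\<mu>u * d x) *\<^sub>R lin eu U"

lemma Dg_apply: "Dg x v = (\<mu>s * (a x * S v + \<eta>u x * U v)) *\<^sub>R es + (\<mu>u * (\<psi>s x * S v + d x * U v)) *\<^sub>R eu"
  by (simp add: Dg_def lin linS linU blinfun.add_left blinfun.scaleR_left algebra_simps)

lemma S_Dg: "S (Dg x v) = \<mu>s * (a x * S v + \<eta>u x * U v)"
  and U_Dg: "U (Dg x v) = \<mu>u * (\<psi>s x * S v + d x * U v)"
  by (simp_all add: Dg_apply S_simps U_simps dual)

lemma g_eq: "g x = (\<mu>s * (S x + \<eta> x)) *\<^sub>R es + (\<mu>u * (U x + \<psi> x)) *\<^sub>R eu"
  by (rule eqI) (simp_all add: Sg Ug SG UG S_simps U_simps dual)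

lemma g_deriv: "(g has_derivative blinfun_apply (Dg x)) (at x)"
proof -
  have S': "(S has_derivative S) (at x)" and U': "(U has_derivative U) (at x)"
    using linS linU by (auto intro!: bounded_linear_imp_has_derivative simp: linear_conv_bounded_linear)
  have "((\<lambda>x. (\<mu>s * (S x + \<eta> x)) *\<^sub>R es + (\<mu>u * (U x + \<psi> x)) *\<^sub>R eu) has_derivative
      (\<lambda>h. (\<mu>s * (S h + (\<eta>s x * S h + \<eta>u x * U h))) *\<^sub>R es +
        (\<mu>u * (U h + (\<psi>s x * S h + \<psi>u x * U h))) *\<^sub>R eu)) (at x)"
    by (intro derivative_intros has_derivative_scaleR_left has_derivative_mult_right S' U' \<eta> \<psi>)
  moreover have "(\<lambda>h. (\<mu>s * (S h + (\<eta>s x * S h + \<eta>u x * U h))) *\<^sub>R es +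
        (\<mu>u * (U h + (\<psi>s x * S h + \<psi>u x * U h))) *\<^sub>R eu) = blinfun_apply (Dg x)"
    by (rule ext) (simp add: Dg_apply a_def d_def algebra_simps)
  ultimately show ?thesis by (simp add: g_eq[abs_def])
qed

text \<open>The determinant of the derivative in eigencoordinates; \<open>Dgi\<close> is the
  adjugate divided by it.\<close>

definition "J x = \<mu>s * \<mu>u * (a x * d x - \<eta>u x * \<psi>s x)"

definition "Dgi x = inverse (J x) *\<^sub>R ((\<mu>u * d x) *\<^sub>R lin es S - (\<mu>s * \<eta>u x) *\<^sub>R lin es U
  - (\<mu>u * \<psi>s x) *\<^sub>R lin eu S + (\<mu>s * a x) *\<^sub>R lin eu U)"

text \<open>The off-diagonal product is at most \<open>\<epsilon> / 2\<close> and the diagonal one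
  at least \<open>m * (1 - \<epsilon>)\<close>, which is larger by \<open>\<epsilon> < m\<close> and
  \<open>2 * \<epsilon> < 1\<close>.\<close>

lemma J_nz: "J x \<noteq> 0"
proof -
  have "\<bar>\<eta>u x * \<psi>s x\<bar> \<le> \<epsilon> * (1/2)"
    unfolding abs_mult using off'[of x] \<epsilon>_half \<epsilon> by (intro mult_mono) auto
  also have "\<dots> < m * (1 - \<epsilon>)" using m \<epsilon> \<epsilon>_half by (intro mult_strict_mono) auto
  also have "\<dots> \<le> a x * d x" using ad[of x] \<epsilon>_half \<epsilon> m by (intro mult_mono) auto
  finally show ?thesis using \<Lambda> by (auto simp: J_def)
qed

lemma Dgi_Dg: "Dgi x (Dg x v) = v"
proof (rule eqI)
  have *: "Dgi x w = (inverse (J x) * (\<mu>u * d x * S w - \<mu>s * \<eta>u x * U w)) *\<^sub>R es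
      + (inverse (J x) * (\<mu>s * a x * U w - \<mu>u * \<psi>s x * S w)) *\<^sub>R eu" for w
    by (simp add: Dgi_def lin linS linU blinfun.add_left blinfun.diff_left blinfun.scaleR_left algebra_simps)
  have "\<mu>u * d x * S (Dg x v) - \<mu>s * \<eta>u x * U (Dg x v) = J x * S v"
    by (simp add: S_Dg U_Dg J_def algebra_simps)
  then show "S (Dgi x (Dg x v)) = S v"
    unfolding * using J_nz[of x] by (simp add: S_simps dual)
  have "\<mu>s * a x * U (Dg x v) - \<mu>u * \<psi>s x * S (Dg x v) = J x * U v"
    by (simp add: S_Dg U_Dg J_def algebra_simps)
  then show "U (Dgi x (Dg x v)) = U v"
    unfolding * using J_nz[of x] by (simp add: U_simps dual)
qed

lemma loclip_ad: "loclip a" "loclip d"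
  unfolding a_def[abs_def] d_def[abs_def] by (intro loclip_add loclip_const lip)+

lemma loclip_Dg: "loclip Dg"
  unfolding Dg_def[abs_def]
  by (intro loclip_add loclip_scaleR loclip_mult loclip_const lip loclip_ad)

lemma loclip_Dgi: "loclip Dgi"
proof -
  have "loclip J" unfolding J_def[abs_def]
    by (intro loclip_diff loclip_mult loclip_const lip loclip_ad)
  then have "loclip (\<lambda>x. inverse (J x))" by (rule loclip_inverse) (rule J_nz)
  then show ?thesis unfolding Dgi_def[abs_def]
    by (intro loclip_add loclip_diff loclip_scaleR loclip_mult loclip_const lip loclip_ad)
qed

text \<open>Expansion of \<open>G\<close> in \<open>coord_norm\<close> inverts to a global Lipschitz
  bound; passing to the Euclidean norm and back costs \<open>K\<close> twice. Differentiating the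
  inverse needs the continuity obtained here.\<close>

lemma loclip_g': "loclip g'"
proof -
  obtain K where K: "K > 0" "\<And>x. norm x \<le> K * coord_norm x" "\<And>x. coord_norm x \<le> K * norm x"
    using coord_norm_equiv by blast
  define r where "r = min (m - \<epsilon>) (1 - 2 * \<epsilon>)"
  have r: "r > 0" "\<And>x y. r * coord_norm (x - y) \<le> coord_norm (G x - G y)"
    using G_expand by (simp_all add: r_def)
  have "(K * K / r)-lipschitz_on UNIV (inv G)"
  proof (rule lipschitz_onI)
    fix u v
    let ?x = "inv G u" and ?y = "inv G v"
    have G: "G ?x = u" "G ?y = v" using surj_G by (simp_all add: surj_f_inv_f)
    have "r * norm (?x - ?y) \<le> r * (K * coord_norm (?x - ?y))"
      using K(2) r(1) by (intro mult_left_mono) auto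
    also have "\<dots> \<le> K * coord_norm (u - v)"
      using r(2)[of ?x ?y] K(1) G by (simp add: mult.left_commute)
    also have "\<dots> \<le> K * (K * norm (u - v))" using K by (intro mult_left_mono) auto
    finally show "dist ?x ?y \<le> K * K / r * dist u v"
      using r(1) by (simp add: dist_norm field_simps)
  qed (use K r in auto)
  then have "loclip (inv G)" by (rule loclip_global)
  moreover have "loclip Ai" using linAi by (intro loclip_bounded_linear) (simp add: linear_conv_bounded_linear)
  ultimately show ?thesis unfolding g'_def[abs_def] using loclip_compose by blast
qed

lemma g'_deriv: "(g' has_derivative blinfun_apply (Dgi (g' y))) (at y)"
proof (rule has_derivative_inverse_basic[where T=UNIV])
  show "(g has_derivative blinfun_apply (Dg (g' y))) (at (g' y))" by (rule g_deriv)
  show "bounded_linear (blinfun_apply (Dgi (g' y)))" by (rule blinfun.bounded_linear_right)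
  show "blinfun_apply (Dgi (g' y)) \<circ> blinfun_apply (Dg (g' y)) = id" by (auto simp: Dgi_Dg)
  show "isCont g' y" by (rule loclip_continuous[OF loclip_g'])
qed (auto simp: g_g')

lemma cont_g: "continuous_on UNIV g" "continuous_on UNIV g'"
  by (intro continuous_at_imp_continuous_on ballI has_derivative_continuous[OF g_deriv]
      has_derivative_continuous[OF g'_deriv])+

section \<open>Invariant line fields\<close>

lemma rate: "1 + 2 * \<epsilon> \<le> \<tau> * \<Lambda>" "1 / \<tau> \<le> \<Lambda> * (1 - 2 * \<epsilon>)"
proof -
  have 1: "1 \<le> \<tau> * (\<Lambda> * (1 - 2 * \<epsilon>))" using \<epsilon> by (simp add: \<Lambda>_def)
  have "(1 + 2 * \<epsilon>) * 1 \<le> (1 + 2 * \<epsilon>) * (\<tau> * (\<Lambda> * (1 - 2 * \<epsilon>)))"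
    using 1 \<epsilon> by (intro mult_left_mono) auto
  also have "\<dots> = \<tau> * \<Lambda> * (1 - 4 * (\<epsilon> * \<epsilon>))" by (simp add: algebra_simps)
  also have "\<dots> \<le> \<tau> * \<Lambda> * 1" using \<tau> \<Lambda> by (intro mult_left_mono) auto
  finally show "1 + 2 * \<epsilon> \<le> \<tau> * \<Lambda>" by simp
  show "1 / \<tau> \<le> \<Lambda> * (1 - 2 * \<epsilon>)" using 1 \<tau> by (simp add: divide_le_eq mult.commute)
qed

text \<open>The contraction condition for slopes has to hold for all
  \<open>d x \<ge> 1 - \<epsilon>\<close>, however large. With \<open>t\<close> the excess of
  \<open>d x\<close> over \<open>1 - \<epsilon>\<close>, the difference in fact 2 is a polynomial in
  \<open>t\<close> with nonnegative coefficients.\<close>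

lemma square_rate: "(1 + 2 * \<epsilon>) * d x \<le> \<tau> * (\<Lambda> * (d x - \<epsilon>))\<^sup>2"
proof -
  let ?q = "1 - 2 * \<epsilon>"
  have q: "0 < ?q" using \<epsilon>_half by simp
  have "1 * 1 \<le> (\<tau> * (\<Lambda> * ?q)) * (\<tau> * (\<Lambda> * ?q))"
    using \<epsilon> by (intro mult_mono) (auto simp: \<Lambda>_def)
  then have "(1 + 2 * \<epsilon>) * 1 \<le> (1 + 2 * \<epsilon>) * ((\<tau> * (\<Lambda> * ?q)) * (\<tau> * (\<Lambda> * ?q)))"
    using \<epsilon> by (intro mult_left_mono) auto
  also have "\<dots> = (\<tau> * (1 + 2 * \<epsilon>)) * (\<tau> * (\<Lambda> * ?q)\<^sup>2)" by (simp add: power2_eq_square)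
  also have "\<dots> \<le> 1 * (\<tau> * (\<Lambda> * ?q)\<^sup>2)"
    using \<epsilon> \<tau> by (intro mult_right_mono) auto
  finally have 1: "1 + 2 * \<epsilon> \<le> \<tau> * (\<Lambda>\<^sup>2 * ?q\<^sup>2)" by (simp add: power_mult_distrib)
  have 2: "?q\<^sup>2 * d x \<le> (d x - \<epsilon>)\<^sup>2"
  proof -
    define t where "t = d x - (1 - \<epsilon>)"
    have t: "0 \<le> t" using ad[of x] by (simp add: t_def)
    have "(d x - \<epsilon>)\<^sup>2 - ?q\<^sup>2 * d x = ?q\<^sup>2 * \<epsilon> + t * (?q * (1 + 2 * \<epsilon>)) + t\<^sup>2"
      by (simp add: t_def power2_eq_square algebra_simps)
    also have "\<dots> \<ge> 0" using t q \<epsilon> by (intro add_nonneg_nonneg mult_nonneg_nonneg) auto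
    finally show ?thesis by simp
  qed
  have "(1 + 2 * \<epsilon>) * d x \<le> \<tau> * (\<Lambda>\<^sup>2 * ?q\<^sup>2) * d x"
    using 1 ad[of x] by (intro mult_right_mono) auto
  also have "\<dots> = \<tau> * \<Lambda>\<^sup>2 * (?q\<^sup>2 * d x)" by simp
  also have "\<dots> \<le> \<tau> * \<Lambda>\<^sup>2 * (d x - \<epsilon>)\<^sup>2" using 2 \<tau> by (intro mult_left_mono) auto
  finally show ?thesis by (simp add: power_mult_distrib)
qed

lemma cont_partials: "continuous_on UNIV a" "continuous_on UNIV d" "continuous_on UNIV \<eta>u" "continuous_on UNIV \<psi>s"
  using loclip_ad lip by (auto intro!: continuous_at_imp_continuous_on loclip_continuous)

lemma per_ad: "torus_periodic a" "torus_periodic d"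
  using per by (simp_all add: torus_periodic_def a_def d_def)

text \<open>The slope of the line through \<open>w x *\<^sub>R es + eu\<close> is determined by the
  slope at \<open>g' x\<close> and the derivative there, so the graph transform runs over the
  inverse map. Since the eigenvalues have product of modulus 1, the contraction condition reduces to
  \<open>square_rate\<close>.\<close>

lemma unstable_slope:
  obtains w where "continuous_on UNIV w" "torus_periodic w" "\<And>x. \<bar>w x\<bar> < 1"
    "\<And>x. w (g x) * (\<mu>u * (\<psi>s x * w x + d x)) = \<mu>s * (a x * w x + \<eta>u x)"
proof -
  have per': "torus_periodic (\<lambda>x. c * p (g' x))" if "torus_periodic p" for c and p :: "real^2 \<Rightarrow> real"
    using that torus_equivariantD[OF equi_g'] unfolding torus_periodic_def by metis
  have cont': "continuous_on UNIV (\<lambda>x. c * p (g' x))" if "continuous_on UNIV p" for c and p :: "real^2 \<Rightarrow> real"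
    using that by (intro continuous_intros continuous_on_compose2[OF _ cont_g(2)]) auto
  have less: "\<bar>\<mu>u * \<psi>s (g' x)\<bar> < \<bar>\<mu>u * d (g' x)\<bar>" for x
    using off'(4)[of "g' x"] ad[of "g' x"] \<epsilon>_half \<Lambda> by (simp add: abs_mult)
  have bound: "(\<bar>\<mu>s * a (g' x)\<bar> + \<bar>\<mu>s * \<eta>u (g' x)\<bar>) * \<bar>\<mu>u * d (g' x)\<bar>
      \<le> \<tau> * (\<bar>\<mu>u * d (g' x)\<bar> - \<bar>\<mu>u * \<psi>s (g' x)\<bar>)\<^sup>2" for x
  proof -
    let ?y = "g' x"
    have "(\<bar>\<mu>s * a ?y\<bar> + \<bar>\<mu>s * \<eta>u ?y\<bar>) * \<bar>\<mu>u * d ?y\<bar> = (\<bar>\<mu>s\<bar> * \<Lambda>) * ((a ?y + \<bar>\<eta>u ?y\<bar>) * d ?y)"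
      using \<Lambda>(3) ad[of ?y] by (simp add: abs_mult algebra_simps)
    also have "\<dots> = (a ?y + \<bar>\<eta>u ?y\<bar>) * d ?y" using \<Lambda>(1,2) by simp
    also have "\<dots> \<le> (1 + 2 * \<epsilon>) * d ?y"
      using ad[of ?y] off'(3)[of ?y] by (intro mult_right_mono) auto
    also have "\<dots> \<le> \<tau> * (\<Lambda> * (d ?y - \<epsilon>))\<^sup>2" by (rule square_rate)
    also have "\<dots> \<le> \<tau> * (\<Lambda> * (d ?y - \<bar>\<psi>s ?y\<bar>))\<^sup>2"
      using \<tau> \<Lambda> ad[of ?y] off'(4)[of ?y] \<epsilon>_half
      by (intro mult_left_mono power_mono mult_nonneg_nonneg) auto
    also have "\<Lambda> * (d ?y - \<bar>\<psi>s ?y\<bar>) = \<bar>\<mu>u * d ?y\<bar> - \<bar>\<mu>u * \<psi>s ?y\<bar>"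
      using \<Lambda> ad[of ?y] by (simp add: abs_mult algebra_simps)
    finally show ?thesis .
  qed
  obtain w where w: "continuous_on UNIV w" "torus_periodic w" "\<And>x. \<bar>w x\<bar> < 1"
    "\<And>x. w x = (\<mu>s * a (g' x) * w (g' x) + \<mu>s * \<eta>u (g' x)) / (\<mu>u * \<psi>s (g' x) * w (g' x) + \<mu>u * d (g' x))"
    using invariant_slope[OF cont_g(2) cont'[OF cont_partials(1)] cont'[OF cont_partials(3)]
        cont'[OF cont_partials(4)] cont'[OF cont_partials(2)] equi_g'
        per'[OF per_ad(1)] per'[OF per(4)] per'[OF per(5)] per'[OF per_ad(2)] less _ \<tau>(2) bound] \<tau>(1)
    by (metis less_imp_le)
  have "w (g x) * (\<mu>u * (\<psi>s x * w x + d x)) = \<mu>s * (a x * w x + \<eta>u x)" for x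
  proof -
    have "\<mu>u * \<psi>s x * w x + \<mu>u * d x \<noteq> 0"
      using moebius_contraction(1)[OF less[of "g x"] less_imp_le[OF \<tau>(1)] bound[of "g x"], of 0 "w x"] w(3)[of x]
      by (simp add: g'_g)
    then show ?thesis using w(4)[of "g x"] by (simp add: g'_g field_simps)
  qed
  with w that show thesis by blast
qed

text \<open>Invariance of the line through \<open>es + z x *\<^sub>R eu\<close> is solved for
  \<open>z x\<close> in terms of \<open>z (g x)\<close>. This applies the inverse of the derivative
  up to a scalar, whence the minus signs, and runs over \<open>g\<close> itself. In the contraction
  condition \<open>\<psi>s\<close> appears multiplied by
  \<open>\<Lambda> * \<Lambda>\<close>.\<close>

lemma stable_slope:
  obtains z where "continuous_on UNIV z" "torus_periodic z" "\<And>x. \<bar>z x\<bar> < 1"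
    "\<And>x. z (g x) * (\<mu>s * (a x + \<eta>u x * z x)) = \<mu>u * (\<psi>s x + d x * z x)"
proof -
  have per': "torus_periodic (\<lambda>x. c * p x)" if "torus_periodic p" for c and p :: "real^2 \<Rightarrow> real"
    using that unfolding torus_periodic_def by metis
  have cont': "continuous_on UNIV (\<lambda>x. c * p x)" if "continuous_on UNIV p" for c and p :: "real^2 \<Rightarrow> real"
    using that by (intro continuous_intros)
  have small: "\<bar>\<eta>u x\<bar> / \<Lambda> \<le> \<Lambda> * \<epsilon>" for x
  proof -
    have "\<bar>\<eta>u x\<bar> / \<Lambda> \<le> \<bar>\<eta>u x\<bar>" using \<Lambda> by (simp add: divide_le_eq mult_le_cancel_left1)
    also have "\<dots> \<le> \<epsilon>" by (rule off')
    also have "\<dots> \<le> \<Lambda> * \<epsilon>" using \<Lambda> \<epsilon> by simp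
    finally show ?thesis .
  qed
  have low: "\<Lambda> * (d x - \<epsilon>) \<le> \<bar>\<mu>u * d x\<bar> - \<bar>- \<mu>s * \<eta>u x\<bar>" for x
    using \<Lambda> ad[of x] small[of x] by (simp add: abs_mult algebra_simps)
  have pos: "0 < \<Lambda> * (d x - \<epsilon>)" for x
    using \<Lambda> ad[of x] \<epsilon>_half by (intro mult_pos_pos) auto
  have less: "\<bar>- \<mu>s * \<eta>u x\<bar> < \<bar>\<mu>u * d x\<bar>" for x
    using low[of x] pos[of x] by linarith
  have bound: "(\<bar>\<mu>s * a x\<bar> + \<bar>- \<mu>u * \<psi>s x\<bar>) * \<bar>\<mu>u * d x\<bar>
      \<le> \<tau> * (\<bar>\<mu>u * d x\<bar> - \<bar>- \<mu>s * \<eta>u x\<bar>)\<^sup>2" for x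
  proof -
    have "(\<bar>\<mu>s * a x\<bar> + \<bar>- \<mu>u * \<psi>s x\<bar>) * \<bar>\<mu>u * d x\<bar> = (a x + \<bar>\<psi>s x\<bar> * (\<Lambda> * \<Lambda>)) * d x"
      using \<Lambda> ad[of x] by (simp add: abs_mult field_simps)
    also have "\<dots> \<le> (1 + 2 * \<epsilon>) * d x"
      using ad[of x] off(2)[of x] \<Lambda>(3) by (intro mult_right_mono) auto
    also have "\<dots> \<le> \<tau> * (\<Lambda> * (d x - \<epsilon>))\<^sup>2" by (rule square_rate)
    also have "\<dots> \<le> \<tau> * (\<bar>\<mu>u * d x\<bar> - \<bar>- \<mu>s * \<eta>u x\<bar>)\<^sup>2"
      using low[of x] pos[of x] \<tau> by (intro mult_left_mono power_mono) auto
    finally show ?thesis .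
  qed
  obtain z where z: "continuous_on UNIV z" "torus_periodic z" "\<And>x. \<bar>z x\<bar> < 1"
    "\<And>x. z x = (\<mu>s * a x * z (g x) + - \<mu>u * \<psi>s x) / (- \<mu>s * \<eta>u x * z (g x) + \<mu>u * d x)"
    using invariant_slope[OF cont_g(1) cont'[OF cont_partials(1)] cont'[OF cont_partials(4)]
        cont'[OF cont_partials(3)] cont'[OF cont_partials(2)] equi_g
        per'[OF per_ad(1)] per'[OF per(5)] per'[OF per(4)] per'[OF per_ad(2)] less _ \<tau>(2) bound] \<tau>(1)
    by (metis less_imp_le)
  have "z (g x) * (\<mu>s * (a x + \<eta>u x * z x)) = \<mu>u * (\<psi>s x + d x * z x)" for x
  proof -
    have "- \<mu>s * \<eta>u x * z (g x) + \<mu>u * d x \<noteq> 0"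
      using moebius_contraction(1)[OF less[of x] less_imp_le[OF \<tau>(1)] bound[of x], of 0 "z (g x)"] z(3)[of "g x"]
      by simp
    then have "z x * (- \<mu>s * \<eta>u x * z (g x) + \<mu>u * d x) = \<mu>s * a x * z (g x) + - \<mu>u * \<psi>s x"
      using z(4)[of x] by (simp add: nonzero_eq_divide_eq)
    then show ?thesis by (simp add: algebra_simps)
  qed
  with z that show thesis by blast
qed

section \<open>Conjugacy with the linear automorphism\<close>

lemma g_P: assumes "x \<in> P" shows "g x = A x" "g' x = Ai x"
proof -
  have *: "g y = A y" if "y \<in> P" for y
    using P[OF that] by (simp add: g_def G_def)
  show "g x = A x" using * assms by blast
  have "g (Ai x) = x" using *[OF P(2)[OF assms]] AAi by simp
  then show "g' x = Ai x" by (metis g'_g)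
qed

lemma funpow_g_P: "x \<in> P \<Longrightarrow> (g ^^ n) x \<in> P" "x \<in> P \<Longrightarrow> (g' ^^ n) x \<in> P"
  by (induction n) (auto simp: g_P P)

text \<open>With \<open>k\<close> the identity plus \<open>\<kappa>s\<close> along \<open>es\<close>
  and \<open>\<kappa>u\<close> along \<open>eu\<close>, the equation
  \<open>k (g x) = A (k x)\<close> splits. The unstable part is
  \<open>\<kappa>u x = \<psi> x + (1 / \<mu>u) * \<kappa>u (g x)\<close>, summed along forward
  orbits; the stable part is solved along backward orbits, where the factor is
  \<open>\<mu>s\<close>. On \<open>P\<close> all terms vanish.\<close>

lemma conjugacy_lift:
  obtains k C where "continuous_on UNIV k" "\<And>x y. torus_rel x y \<Longrightarrow> k x - k y = x - y"
    "\<And>x. \<bar>S (k x) - S x\<bar> \<le> C" "\<And>x. \<bar>U (k x) - U x\<bar> \<le> C" "\<And>x. k (g x) = A (k x)"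
    "\<And>x. x \<in> P \<Longrightarrow> k x = x"
proof -
  have nu: "\<bar>1 / \<mu>u\<bar> < 1" "\<bar>\<mu>s\<bar> < 1" using \<Lambda> by (simp_all add: abs_divide)
  obtain \<kappa>u Cu where u: "continuous_on UNIV \<kappa>u" "torus_periodic \<kappa>u" "\<And>x. \<bar>\<kappa>u x\<bar> \<le> Cu"
    "\<And>x. \<kappa>u x = \<psi> x + (1 / \<mu>u) * \<kappa>u (g x)" "\<And>x. (\<And>n. \<psi> ((g ^^ n) x) = 0) \<Longrightarrow> \<kappa>u x = 0"
    using series_solution[OF cont_g(1) cont_\<eta>\<psi>(2) equi_g per(2) bd(2) nu(1)] by blast
  have "continuous_on UNIV (\<lambda>x. - \<mu>s * \<eta> (g' x))"
    by (intro continuous_intros continuous_on_compose2[OF cont_\<eta>\<psi>(1) cont_g(2)]) auto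
  moreover have "torus_periodic (\<lambda>x. - \<mu>s * \<eta> (g' x))"
    using per(1) torus_equivariantD[OF equi_g'] unfolding torus_periodic_def by metis
  moreover have "\<bar>- \<mu>s * \<eta> (g' x)\<bar> \<le> \<bar>\<mu>s\<bar> * B" for x
    using bd(1)[of "g' x"] by (simp add: abs_mult mult_left_mono)
  ultimately obtain \<kappa>s Cs where s: "continuous_on UNIV \<kappa>s" "torus_periodic \<kappa>s" "\<And>x. \<bar>\<kappa>s x\<bar> \<le> Cs"
    "\<And>x. \<kappa>s x = - \<mu>s * \<eta> (g' x) + \<mu>s * \<kappa>s (g' x)"
    "\<And>x. (\<And>n. - \<mu>s * \<eta> (g' ((g' ^^ n) x)) = 0) \<Longrightarrow> \<kappa>s x = 0"
    using series_solution[OF cont_g(2) _ equi_g' _ _ nu(2), of "\<lambda>x. - \<mu>s * \<eta> (g' x)" "\<bar>\<mu>s\<bar> * B"] by blast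
  define k where "k x = x + \<kappa>s x *\<^sub>R es + \<kappa>u x *\<^sub>R eu" for x
  have k: "S (k x) = S x + \<kappa>s x" "U (k x) = U x + \<kappa>u x" for x
    by (simp_all add: k_def S_simps U_simps dual)
  show thesis
  proof (rule that)
    show "continuous_on UNIV k" unfolding k_def by (intro continuous_intros s u)
    show "k x - k y = x - y" if "torus_rel x y" for x y
      using torus_periodicD[OF s(2) that] torus_periodicD[OF u(2) that] by (simp add: k_def)
    show "\<bar>S (k x) - S x\<bar> \<le> max Cs Cu" for x using s(3)[of x] by (simp add: k)
    show "\<bar>U (k x) - U x\<bar> \<le> max Cs Cu" for x using u(3)[of x] by (simp add: k)
    show "k (g x) = A (k x)" for x
    proof (rule eqI)
      show "S (k (g x)) = S (A (k x))"
        using s(4)[of "g x"] by (simp add: k SA Sg SG g'_g algebra_simps)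
      show "U (k (g x)) = U (A (k x))"
        using u(4)[of x] \<Lambda>(5) by (simp add: k UA Ug UG field_simps)
    qed
    show "k x = x" if "x \<in> P" for x
    proof -
      have "\<kappa>u x = 0" by (rule u(5)) (use funpow_g_P[OF that] P in auto)
      moreover have "\<kappa>s x = 0"
        by (rule s(5)) (use funpow_g_P(2)[OF that] funpow_g_P(2)[of _ 1] P in auto)
      ultimately show ?thesis by (simp add: k_def)
    qed
  qed
qed

text \<open>A cone condition for differences of arbitrary pairs of points, not only for tangent
  vectors. The diagonal and the off-diagonal term lose at most \<open>\<epsilon>\<close> each, hence
  the losses \<open>2 * \<epsilon>\<close> in the rates.\<close>

lemma cone_unstable:
  assumes "\<bar>S x - S y\<bar> \<le> \<bar>U x - U y\<bar>"
  shows "\<bar>U x - U y\<bar> \<le> \<tau> * \<bar>U (g x) - U (g y)\<bar>"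
    and "\<bar>S (g x) - S (g y)\<bar> \<le> \<bar>U (g x) - U (g y)\<bar>"
proof -
  let ?u = "\<bar>U x - U y\<bar>"
  have Ug': "\<bar>U (g x) - U (g y)\<bar> = \<Lambda> * \<bar>U (G x) - U (G y)\<bar>"
    using \<Lambda>(3) by (simp add: Ug abs_mult flip: right_diff_distrib)
  have Sg': "\<bar>S (g x) - S (g y)\<bar> = \<bar>S (G x) - S (G y)\<bar> / \<Lambda>"
    using \<Lambda>(2) by (simp add: Sg abs_mult flip: right_diff_distrib)
  have "(1 - 2 * \<epsilon>) * ?u \<le> (1 - \<epsilon>) * ?u - \<epsilon> * \<bar>S x - S y\<bar>"
    using mult_left_mono[OF assms, of \<epsilon>] \<epsilon> by (simp add: algebra_simps)
  also have "\<dots> \<le> \<bar>U (G x) - U (G y)\<bar>" by (rule UG_bound)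
  finally have "\<tau> * (\<Lambda> * ((1 - 2 * \<epsilon>) * ?u)) \<le> \<tau> * (\<Lambda> * \<bar>U (G x) - U (G y)\<bar>)"
    using \<tau> \<Lambda> by (intro mult_left_mono) auto
  moreover have "1 * ?u \<le> (\<tau> * (\<Lambda> * (1 - 2 * \<epsilon>))) * ?u"
    using \<epsilon> by (intro mult_right_mono) (auto simp: \<Lambda>_def)
  ultimately show 1: "?u \<le> \<tau> * \<bar>U (g x) - U (g y)\<bar>" unfolding Ug' by (simp add: mult.assoc)
  have "\<bar>S (G x) - S (G y)\<bar> \<le> (1 + \<epsilon>) * \<bar>S x - S y\<bar> + \<epsilon> * ?u" by (rule SG_bounds)
  also have "\<dots> \<le> (1 + \<epsilon>) * ?u + \<epsilon> * ?u" using assms \<epsilon> by (intro add_mono mult_left_mono) auto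
  also have "\<dots> = (1 + 2 * \<epsilon>) * ?u" by (simp add: algebra_simps)
  also have "\<dots> \<le> \<Lambda> * ?u"
    using rate(1) \<tau> \<Lambda> by (intro mult_right_mono) (auto intro: order_trans[OF _ mult_left_le_one_le[of \<Lambda> \<tau>]])
  finally have "\<bar>S (g x) - S (g y)\<bar> \<le> ?u" unfolding Sg' using \<Lambda>(1) by (simp add: divide_le_eq mult.commute)
  also have "\<dots> \<le> \<tau> * \<bar>U (g x) - U (g y)\<bar>" by (rule 1)
  also have "\<dots> \<le> \<bar>U (g x) - U (g y)\<bar>" using \<tau> by (simp add: mult_left_le_one_le)
  finally show "\<bar>S (g x) - S (g y)\<bar> \<le> \<bar>U (g x) - U (g y)\<bar>" .
qed

text \<open>By contradiction: a pair strictly inside the unstable cone is mapped strictly inside it,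
  so an image pair in the stable cone comes from the stable cone. The contraction of
  \<open>S\<close> is then read off from the upper bound for \<open>G\<close>.\<close>

lemma cone_stable:
  assumes "\<bar>U (g x) - U (g y)\<bar> \<le> \<bar>S (g x) - S (g y)\<bar>"
  shows "\<bar>U x - U y\<bar> \<le> \<bar>S x - S y\<bar>" and "\<bar>S (g x) - S (g y)\<bar> \<le> \<tau> * \<bar>S x - S y\<bar>"
proof -
  let ?s = "\<bar>S x - S y\<bar>"
  have Sg': "\<bar>S (g x) - S (g y)\<bar> = \<bar>S (G x) - S (G y)\<bar> / \<Lambda>"
    using \<Lambda>(2) by (simp add: Sg abs_mult flip: right_diff_distrib)
  show us: "\<bar>U x - U y\<bar> \<le> ?s"
  proof (rule ccontr)
    assume "\<not> \<bar>U x - U y\<bar> \<le> ?s"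
    then have su: "?s < \<bar>U x - U y\<bar>" by simp
    note c = cone_unstable[OF less_imp_le[OF su]]
    have eq: "\<bar>S (g x) - S (g y)\<bar> = \<bar>U (g x) - U (g y)\<bar>" using c(2) assms by linarith
    have "\<bar>S (G x) - S (G y)\<bar> \<le> (1 + \<epsilon>) * ?s + \<epsilon> * \<bar>U x - U y\<bar>" by (rule SG_bounds)
    also have "\<dots> < (1 + \<epsilon>) * \<bar>U x - U y\<bar> + \<epsilon> * \<bar>U x - U y\<bar>"
      using su \<epsilon> by (intro add_less_le_mono mult_strict_left_mono) auto
    also have "\<dots> = (1 + 2 * \<epsilon>) * \<bar>U x - U y\<bar>" by (simp add: algebra_simps)
    also have "\<dots> \<le> (1 + 2 * \<epsilon>) * (\<tau> * \<bar>U (g x) - U (g y)\<bar>)"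
      using c(1) \<epsilon> by (intro mult_left_mono) auto
    also have "\<dots> = (\<tau> * (1 + 2 * \<epsilon>)) * \<bar>U (g x) - U (g y)\<bar>" by simp
    also have "\<dots> \<le> 1 * \<bar>U (g x) - U (g y)\<bar>" using \<epsilon> by (intro mult_right_mono) auto
    also have "\<dots> = \<bar>S (G x) - S (G y)\<bar> / \<Lambda>" using eq Sg' by simp
    also have "\<dots> \<le> \<bar>S (G x) - S (G y)\<bar>" using \<Lambda>(1) by (simp add: divide_le_eq mult_le_cancel_left1)
    finally show False by simp
  qed
  have "\<bar>S (G x) - S (G y)\<bar> \<le> (1 + \<epsilon>) * ?s + \<epsilon> * \<bar>U x - U y\<bar>" by (rule SG_bounds)
  also have "\<dots> \<le> (1 + \<epsilon>) * ?s + \<epsilon> * ?s" using us \<epsilon> by (intro add_mono mult_left_mono) auto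
  also have "\<dots> = (1 + 2 * \<epsilon>) * ?s" by (simp add: algebra_simps)
  also have "\<dots> \<le> (\<tau> * \<Lambda>) * ?s" using rate(1) by (intro mult_right_mono) auto
  finally show "\<bar>S (g x) - S (g y)\<bar> \<le> \<tau> * ?s"
    unfolding Sg' using \<Lambda>(1) by (simp add: divide_le_eq mult_ac)
qed

text \<open>A pair in the unstable cone stays there under \<open>g\<close> and its
  \<open>U\<close>-separation grows geometrically; any other pair does the same with
  \<open>S\<close> under \<open>g'\<close>. Bounded separation makes the dominant difference zero,
  and the cone condition then kills the other one.\<close>

lemma expansive:
  assumes fwd: "\<And>n. \<bar>U ((g ^^ n) x) - U ((g ^^ n) y)\<bar> \<le> C"
    and bwd: "\<And>n. \<bar>S ((g' ^^ n) x) - S ((g' ^^ n) y)\<bar> \<le> C"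
  shows "x = y"
proof (cases "\<bar>S x - S y\<bar> \<le> \<bar>U x - U y\<bar>")
  case True
  have "\<bar>S ((g ^^ n) x) - S ((g ^^ n) y)\<bar> \<le> \<bar>U ((g ^^ n) x) - U ((g ^^ n) y)\<bar> \<and>
      \<bar>U x - U y\<bar> \<le> \<tau> ^ n * \<bar>U ((g ^^ n) x) - U ((g ^^ n) y)\<bar>" for n
  proof (induction n)
    case (Suc n)
    note c = cone_unstable[OF conjunct1[OF Suc]]
    have "\<bar>U x - U y\<bar> \<le> \<tau> ^ n * \<bar>U ((g ^^ n) x) - U ((g ^^ n) y)\<bar>" using Suc by blast
    also have "\<dots> \<le> \<tau> ^ n * (\<tau> * \<bar>U (g ((g ^^ n) x)) - U (g ((g ^^ n) y))\<bar>)"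
      using c(1) \<tau> by (intro mult_left_mono) auto
    finally show ?case using c(2) by (simp add: mult_ac)
  qed (use True in auto)
  then have "\<bar>U x - U y\<bar> \<le> \<tau> ^ n * C" for n
    using fwd[of n] \<tau> by (meson less_imp_le mult_left_mono order_trans zero_le_power)
  then have "\<bar>U x - U y\<bar> = 0" by (intro bounded_geometric_zero[OF \<tau>]) auto
  then show ?thesis using True by (intro eqI) auto
next
  case False
  have "\<bar>U ((g' ^^ n) x) - U ((g' ^^ n) y)\<bar> \<le> \<bar>S ((g' ^^ n) x) - S ((g' ^^ n) y)\<bar> \<and>
      \<bar>S x - S y\<bar> \<le> \<tau> ^ n * \<bar>S ((g' ^^ n) x) - S ((g' ^^ n) y)\<bar>" for n
  proof (induction n)
    case (Suc n)
    let ?x = "(g' ^^ Suc n) x" and ?y = "(g' ^^ Suc n) y"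
    have gx: "g ?x = (g' ^^ n) x" "g ?y = (g' ^^ n) y" by (simp_all add: g_g')
    note c = cone_stable[of ?x ?y, unfolded gx, OF conjunct1[OF Suc]]
    have "\<bar>S x - S y\<bar> \<le> \<tau> ^ n * \<bar>S ((g' ^^ n) x) - S ((g' ^^ n) y)\<bar>" using Suc by blast
    also have "\<dots> \<le> \<tau> ^ n * (\<tau> * \<bar>S ?x - S ?y\<bar>)"
      using c(2) \<tau> by (intro mult_left_mono) auto
    finally show ?case using c(1) by (simp add: mult_ac)
  qed (use False in auto)
  then have "\<bar>S x - S y\<bar> \<le> \<tau> ^ n * C" for n
    using bwd[of n] \<tau> by (meson less_imp_le mult_left_mono order_trans zero_le_power)
  then have "\<bar>S x - S y\<bar> = 0" by (intro bounded_geometric_zero[OF \<tau>]) auto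
  then show ?thesis using False by (intro eqI) auto
qed

text \<open>\<open>k\<close> leads from the dynamics of \<open>g\<close> to that of
  \<open>A\<close>, so \<open>h\<close> is the inverse of the torus map of \<open>k\<close>. Points
  with equal \<open>k\<close>-image have orbits whose separation is bounded in the coordinates,
  because \<open>k\<close> is close to the identity; expansiveness then gives injectivity.
  Compactness supplies continuity of the inverse.\<close>

lemma conjugacy:
  obtains h where "homeomorphic_map euclidean euclidean h" "torus_map g \<circ> h = h \<circ> torus_map A"
    "\<And>x. x \<in> P \<Longrightarrow> h (abs_torus x) = abs_torus x"
proof -
  obtain k C where k: "continuous_on UNIV k" "\<And>x y. torus_rel x y \<Longrightarrow> k x - k y = x - y"
    "\<And>x. \<bar>S (k x) - S x\<bar> \<le> C" "\<And>x. \<bar>U (k x) - U x\<bar> \<le> C" "\<And>x. k (g x) = A (k x)"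
    "\<And>x. x \<in> P \<Longrightarrow> k x = x"
    using conjugacy_lift by blast
  have kg: "k ((g ^^ n) x) = (A ^^ n) (k x)" for n x by (induction n) (simp_all add: k(5))
  have kg1: "k (g' x) = Ai (k x)" for x using k(5)[of "g' x"] AiA g_g' by metis
  have kg': "k ((g' ^^ n) x) = (Ai ^^ n) (k x)" for n x by (induction n) (simp_all add: kg1)
  have inj_k: "x = y" if "k x = k y" for x y
  proof (rule expansive)
    show "\<bar>U ((g ^^ n) x) - U ((g ^^ n) y)\<bar> \<le> 2 * C" for n
      using k(4)[of "(g ^^ n) x"] k(4)[of "(g ^^ n) y"] that by (simp add: kg)
    show "\<bar>S ((g' ^^ n) x) - S ((g' ^^ n) y)\<bar> \<le> 2 * C" for n
      using k(3)[of "(g' ^^ n) x"] k(3)[of "(g' ^^ n) y"] that by (simp add: kg')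
  qed
  have surj_k: "surj k"
  proof (rule surj_bounded_perturbation[OF k(1)])
    fix x
    have "norm (k x - x) \<le> \<bar>S (k x - x)\<bar> * norm es + \<bar>U (k x - x)\<bar> * norm eu"
      by (subst basis[of "k x - x"]) (metis norm_scaleR norm_triangle_ineq)
    also have "\<dots> \<le> C * norm es + C * norm eu"
      using k(3,4)[of x] by (intro add_mono mult_right_mono) (auto simp: S_simps U_simps)
    finally show "norm (k x - x) \<le> C * norm es + C * norm eu" .
  qed
  have equi_k: "torus_equivariant k"
    unfolding torus_equivariant_def using k(2) torus_rel_diff by metis
  define K where "K = torus_map k"
  have K: "K (abs_torus x) = abs_torus (k x)" for x
    using torus_liftD[OF torus_lift_map[OF equi_k]] by (simp add: K_def)
  have L: "torus_map A (abs_torus x) = abs_torus (A x)" for x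
    using torus_liftD[OF torus_lift_map[OF equiA]] .
  have gt: "torus_map g (abs_torus x) = abs_torus (g x)" for x
    using torus_liftD[OF torus_lift_map[OF equi_g]] .
  have "inj K"
  proof (rule injI)
    fix s t assume st: "K s = K t"
    obtain x y where xy: "s = abs_torus x" "t = abs_torus y" by (metis abs_rep_torus)
    have rel: "torus_rel (k x) (k y)" using st by (simp add: xy K abs_torus_eq_iff)
    \<comment> \<open>The images in the plane differ by an integer vector; shifting \<open>y\<close>
      by it makes them equal, so that injectivity of \<open>k\<close> applies.\<close>
    let ?z = "y + (k x - k y)"
    have zy: "torus_rel ?z y" using rel torus_rel_diff[of "k x"] torus_rel_diff[of ?z y] by simp
    then have "k ?z = k x" using k(2)[OF zy] by (simp add: algebra_simps)
    then have "?z = x" by (rule inj_k)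
    then show "s = t" using zy xy by (simp add: abs_torus_eq_iff)
  qed
  moreover have "surj K" by (metis K abs_rep_torus surj_def surj_k)
  moreover have "continuous_on UNIV K"
    using continuous_on_compose[OF k(1) continuous_on_abs_torus] by (simp add: continuous_on_torus_iff o_def K)
  ultimately have homeo: "homeomorphic_map euclidean euclidean K"
    using compact_torus Hausdorff_torus
    by (intro continuous_imp_homeomorphic_map) (simp_all add: compact_space_def)
  have iK: "inv K (K t) = t" "K (inv K t) = t" for t
    using \<open>inj K\<close> \<open>surj K\<close> by (simp_all add: surj_f_inv_f)
  have "homeomorphic_maps euclidean euclidean K (inv K)"
  proof -
    obtain h where h: "homeomorphic_maps euclidean euclidean K h"
      using homeo homeomorphic_map_maps by blast
    then have "h t = inv K t" for t using iK unfolding homeomorphic_maps_def by (metis UNIV_I topspace_euclidean)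
    then have "h = inv K" by blast
    then show ?thesis using h by simp
  qed
  then have "homeomorphic_map euclidean euclidean (inv K)" using homeomorphic_maps_map by blast
  moreover have "torus_map g \<circ> inv K = inv K \<circ> torus_map A"
  proof
    fix t
    have KL: "K (torus_map g s) = torus_map A (K s)" for s
      by (metis (no_types) K L gt k(5) abs_rep_torus)
    show "(torus_map g \<circ> inv K) t = (inv K \<circ> torus_map A) t"
      using KL[of "inv K t"] iK by (metis comp_apply)
  qed
  moreover have "inv K (abs_torus x) = abs_torus x" if "x \<in> P" for x
    using iK(1)[of "abs_torus x"] K[of x] k(6)[OF that] by simp
  ultimately show thesis by (rule that)
qed

text \<open>On \<open>P\<close> the off-diagonal entries vanish, so the multipliers of the invariant
  fields are \<open>\<mu>u * (1 + \<psi>u x)\<close> and \<open>\<mu>s * (1 + \<eta>s x)\<close>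
  whatever the slopes are. Since \<open>g\<close> and \<open>A\<close> agree on \<open>P\<close>,
  the least periods agree as well.\<close>

theorem anosov_conjugate:
  obtains Es Eu h where "anosov_diffeo (1/2) euclidean torus_atlas (torus_map g) Es Eu"
    "\<And>t. dim (Es t) = 1 \<and> dim (Eu t) = 1"
    "homeomorphic_map euclidean euclidean h" "torus_map g \<circ> h = h \<circ> torus_map A"
    "\<And>x n. x \<in> P \<Longrightarrow> torus_rel ((A ^^ n) x) x \<Longrightarrow> 0 < n \<Longrightarrow> h (abs_torus x) = abs_torus x \<and>
      periodic_eigenvalue torus_atlas (torus_map g) Eu (abs_torus x)
        = (\<Prod>i<least_power (torus_map A) (abs_torus x). \<mu>u * (1 + \<psi>u ((A ^^ i) x))) \<and>
      periodic_eigenvalue torus_atlas (torus_map g) Es (abs_torus x)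
        = (\<Prod>i<least_power (torus_map A) (abs_torus x). \<mu>s * (1 + \<eta>s ((A ^^ i) x)))"
proof -
  obtain w where w: "continuous_on UNIV w" "torus_periodic w" "\<And>x. \<bar>w x\<bar> < 1"
    "\<And>x. w (g x) * (\<mu>u * (\<psi>s x * w x + d x)) = \<mu>s * (a x * w x + \<eta>u x)"
    using unstable_slope by blast
  obtain z where z: "continuous_on UNIV z" "torus_periodic z" "\<And>x. \<bar>z x\<bar> < 1"
    "\<And>x. z (g x) * (\<mu>s * (a x + \<eta>u x * z x)) = \<mu>u * (\<psi>s x + d x * z x)"
    using stable_slope by blast
  define vs where "vs x = es + z x *\<^sub>R eu" for x
  define vu where "vu x = w x *\<^sub>R es + eu" for x
  define \<rho>s where "\<rho>s x = \<mu>s * (a x + \<eta>u x * z x)" for x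
  define \<rho>u where "\<rho>u x = \<mu>u * (\<psi>s x * w x + d x)" for x
  have bz: "\<bar>\<eta>u x * z x\<bar> \<le> \<epsilon>" "\<bar>\<psi>s x * w x\<bar> \<le> \<epsilon>" for x
    using mult_mono[of "\<bar>\<eta>u x\<bar>" \<epsilon> "\<bar>z x\<bar>" 1] mult_mono[of "\<bar>\<psi>s x\<bar>" \<epsilon> "\<bar>w x\<bar>" 1]
      off'[of x] w(3)[of x] z(3)[of x] \<epsilon> by (simp_all add: abs_mult)
  interpret L: anosov_lift g g' Dg "\<lambda>y. Dgi (g' y)" S U vs vu \<rho>s \<rho>u \<tau>
  proof
    show "loclip (\<lambda>y. Dgi (g' y))" by (rule loclip_compose[OF loclip_g' loclip_Dgi])
    show "S x = 0 \<Longrightarrow> U x = 0 \<Longrightarrow> x = 0" for x using eqI[of x 0] by (simp add: S_simps U_simps)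
    show "continuous_on UNIV vs" "continuous_on UNIV vu"
      unfolding vs_def vu_def by (intro continuous_intros w z)+
    show "torus_periodic vs" "torus_periodic vu"
      using w(2) z(2) unfolding torus_periodic_def vs_def vu_def by metis+
    show "S (vs x) = 1" "\<bar>U (vs x)\<bar> < 1" "U (vu x) = 1" "\<bar>S (vu x)\<bar> < 1" for x
      using w(3) z(3) by (simp_all add: vs_def vu_def S_simps U_simps dual)
    show "Dg x (vs x) = \<rho>s x *\<^sub>R vs (g x)" for x
      by (rule eqI) (use z(4)[of x] in \<open>simp_all add: S_Dg U_Dg S_simps U_simps dual vs_def \<rho>s_def mult_ac\<close>)
    show "Dg x (vu x) = \<rho>u x *\<^sub>R vu (g x)" for x
      by (rule eqI) (use w(4)[of x] in \<open>simp_all add: S_Dg U_Dg S_simps U_simps dual vu_def \<rho>u_def mult_ac\<close>)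
    show "\<rho>s x \<noteq> 0" for x using bz(1)[of x] ad[of x] m \<Lambda>(4) by (auto simp: \<rho>s_def)
    show "\<bar>\<rho>s x\<bar> \<le> \<tau>" for x
    proof -
      have "\<bar>a x + \<eta>u x * z x\<bar> \<le> \<tau> * \<Lambda>" using bz(1)[of x] ad[of x] m rate(1) \<epsilon> by linarith
      then show ?thesis using \<Lambda>(1,2) by (simp add: \<rho>s_def abs_mult divide_le_eq)
    qed
    show "1 / \<tau> \<le> \<bar>\<rho>u x\<bar>" for x
    proof -
      have "1 - 2 * \<epsilon> \<le> \<bar>\<psi>s x * w x + d x\<bar>" using bz(2)[of x] ad[of x] by linarith
      then have "\<Lambda> * (1 - 2 * \<epsilon>) \<le> \<Lambda> * \<bar>\<psi>s x * w x + d x\<bar>" using \<Lambda>(1) by (intro mult_left_mono) auto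
      then show ?thesis using rate(2) \<Lambda>(3) by (simp add: \<rho>u_def abs_mult)
    qed
  qed (simp_all add: equi_g equi_g' g'_g g_g' g_deriv g'_deriv loclip_Dg S_simps U_simps \<tau>)
  obtain h where h: "homeomorphic_map euclidean euclidean h" "torus_map g \<circ> h = h \<circ> torus_map A"
    "\<And>x. x \<in> P \<Longrightarrow> h (abs_torus x) = abs_torus x"
    using conjugacy by blast
  show thesis
  proof (rule that[OF L.anosov _ h(1,2)])
    show "dim (L.Es t) = 1 \<and> dim (L.Eu t) = 1" for t using L.dim_E by blast
    fix x n assume x: "x \<in> P" and n: "torus_rel ((A ^^ n) x) x" "0 < (n::nat)"
    have gA: "(g ^^ i) x = (A ^^ i) x" for i
    proof (induction i)
      case (Suc i)
      then show ?case using g_P(1)[OF funpow_g_P(1)[OF x, of i]] by simp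
    qed simp
    have fg: "(torus_map g ^^ i) (abs_torus x) = abs_torus ((A ^^ i) x)" for i
      using torus_liftD[OF torus_lift_funpow[OF torus_lift_map[OF equi_g]]] gA by metis
    have fA: "(torus_map A ^^ i) (abs_torus x) = abs_torus ((A ^^ i) x)" for i
      using torus_liftD[OF torus_lift_funpow[OF torus_lift_map[OF equiA]]] by metis
    have lp: "least_power (torus_map g) (abs_torus x) = least_power (torus_map A) (abs_torus x)"
      unfolding least_power_def fg fA ..
    have per: "(torus_map g ^^ n) (abs_torus x) = abs_torus x"
      unfolding fg using n by (simp add: abs_torus_eq_iff)
    have "\<rho>s ((g ^^ i) x) = \<mu>s * (1 + \<eta>s ((A ^^ i) x))" "\<rho>u ((g ^^ i) x) = \<mu>u * (1 + \<psi>u ((A ^^ i) x))" for i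
      using P(5,6)[OF funpow_g_P(1)[OF x, of i]] by (simp_all add: \<rho>s_def \<rho>u_def a_def d_def gA)
    then show "h (abs_torus x) = abs_torus x \<and>
      periodic_eigenvalue torus_atlas (torus_map g) L.Eu (abs_torus x)
        = (\<Prod>i<least_power (torus_map A) (abs_torus x). \<mu>u * (1 + \<psi>u ((A ^^ i) x))) \<and>
      periodic_eigenvalue torus_atlas (torus_map g) L.Es (abs_torus x)
        = (\<Prod>i<least_power (torus_map A) (abs_torus x). \<mu>s * (1 + \<eta>s ((A ^^ i) x)))"
      using h(3)[OF x] L.periodic_eigenvalues[OF per n(2)] by (simp add: lp)
  qed
qed

end

section \<open>Hyperbolic eigenbases\<close>

text \<open>General in the field because it is used twice: over the complex numbers to turn the
  hypothesis on eigenvectors into one on roots, and over the reals to produce eigenvectors. One of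
  \<open>(q, z - p)\<close> and \<open>(z - t, r)\<close> is nonzero unless the matrix is
  scalar.\<close>

lemma eigenvector_2:
  fixes p q r t z :: "'a::field"
  assumes "z * z - (p + t) * z + (p * t - q * r) = 0"
  obtains x y where "x \<noteq> 0 \<or> y \<noteq> 0" "p * x + q * y = z * x" "r * x + t * y = z * y"
proof -
  have *: "(z - p) * (z - t) = q * r" using assms by (simp add: algebra_simps)
  consider "q \<noteq> 0 \<or> z - p \<noteq> 0" | "r \<noteq> 0 \<or> z - t \<noteq> 0" | "q = 0" "z = p" "r = 0" "z = t" by auto
  then show thesis
  proof cases
    case 1
    then show ?thesis using * by (intro that[of q "z - p"]) (auto simp: algebra_simps)
  next
    case 2
    then show ?thesis using * by (intro that[of "z - t" r]) (auto simp: algebra_simps)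
  next
    case 3
    then show ?thesis by (intro that[of 1 0]) auto
  qed
qed

lemma int_matrix_vector:
  "(int_matrix M *v x) $ i = of_int (M $ i $ 1) * x $ 1 + of_int (M $ i $ 2) * x $ 2"
  by (simp add: int_matrix_def matrix_vector_mult_def sum_2)

lemma int_matrix_mult: "int_matrix (M ** N) = int_matrix M ** int_matrix N"
  by (simp add: vec_eq_iff int_matrix_def matrix_matrix_mult_def)

lemma int_matrix_id: "int_matrix (mat 1) = mat 1"
  by (simp add: vec_eq_iff int_matrix_def mat_def)

lemma torus_equivariant_int_matrix: "torus_equivariant (\<lambda>x. int_matrix M *v x)"
  unfolding torus_equivariant_def torus_rel_def
proof (intro allI impI)
  fix x y :: "real^2" and i assume *: "\<forall>i. x $ i - y $ i \<in> \<int>"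
  have "(int_matrix M *v x) $ i - (int_matrix M *v y) $ i
    = of_int (M $ i $ 1) * (x $ 1 - y $ 1) + of_int (M $ i $ 2) * (x $ 2 - y $ 2)"
    by (simp add: int_matrix_vector algebra_simps)
  then show "(int_matrix M *v x) $ i - (int_matrix M *v y) $ i \<in> \<int>" using * by simp
qed

lemma toral_map_eq: "toral_map M = torus_map (\<lambda>x. int_matrix M *v x)"
proof
  fix t
  have "toral_map M (abs_torus (rep_torus t)) = abs_torus (int_matrix M *v rep_torus t)"
    by (rule toral_map.abs_eq)
  then show "toral_map M t = torus_map (\<lambda>x. int_matrix M *v x) t" by (simp add: torus_map_def)
qed

text \<open>The determinant is 1 or -1. A negative discriminant would force determinant 1 and
  conjugate roots of modulus 1, which hyperbolicity excludes. So the roots are real, their product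
  has modulus 1, and neither has modulus 1.\<close>

lemma hyperbolic_eigenvalues:
  assumes "hyperbolic_matrix M"
  obtains \<mu>s \<mu>u :: real where "\<bar>\<mu>s\<bar> * \<bar>\<mu>u\<bar> = 1" "1 < \<bar>\<mu>u\<bar>"
    "\<And>\<mu>. \<mu> \<in> {\<mu>s, \<mu>u} \<Longrightarrow> \<mu> * \<mu> - (of_int (M $ 1 $ 1) + of_int (M $ 2 $ 2)) * \<mu> +
      (of_int (M $ 1 $ 1) * of_int (M $ 2 $ 2) - of_int (M $ 1 $ 2) * of_int (M $ 2 $ 1)) = 0"
proof -
  define p q r t :: real where "p = of_int (M $ 1 $ 1)" and "q = of_int (M $ 1 $ 2)"
    and "r = of_int (M $ 2 $ 1)" and "t = of_int (M $ 2 $ 2)"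
  define \<Delta> where "\<Delta> = p * t - q * r"
  obtain N where "M ** N = mat 1"
    using assms unfolding hyperbolic_matrix_def invertible_def by blast
  then have "det M * det N = 1" by (metis det_I det_mul)
  then have "\<bar>det M\<bar> = 1" by (metis abs_mult abs_one abs_zmult_eq_1)
  moreover have "\<Delta> = of_int (det M)" by (simp add: \<Delta>_def p_def q_def r_def t_def det_2)
  ultimately have \<Delta>: "\<bar>\<Delta>\<bar> = 1" by (metis of_int_1 of_int_abs)
  have no_unit_root: "norm z \<noteq> 1" if z: "z * z - (complex_of_real p + complex_of_real t) * z +
      (complex_of_real p * complex_of_real t - complex_of_real q * complex_of_real r) = 0" for z
  proof -
    obtain x y where xy: "x \<noteq> 0 \<or> y \<noteq> 0" "complex_of_real p * x + complex_of_real q * y = z * x"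
      "complex_of_real r * x + complex_of_real t * y = z * y" using eigenvector_2[OF z] by blast
    define v :: "complex^2" where "v = vector [x, y]"
    have "v \<noteq> 0" using xy(1) by (auto simp: v_def vec_eq_iff forall_2)
    moreover have "int_matrix M *v v = z *s v"
      using xy(2,3) by (simp add: vec_eq_iff forall_2 int_matrix_vector v_def p_def q_def r_def t_def)
    ultimately show ?thesis using assms unfolding hyperbolic_matrix_def by blast
  qed
  have disc: "0 \<le> (p + t)\<^sup>2 - 4 * \<Delta>"
  proof (rule ccontr)
    assume neg: "\<not> 0 \<le> (p + t)\<^sup>2 - 4 * \<Delta>"
    define s where "s = sqrt (4 * \<Delta> - (p + t)\<^sup>2)"
    have s: "s * s = 4 * \<Delta> - (p + t)\<^sup>2" using neg by (simp add: s_def)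
    have "\<Delta> > 0" using neg zero_le_power2[of "p + t"] by linarith
    then have "\<Delta> = 1" using \<Delta> by simp
    define z where "z = Complex ((p + t) / 2) (s / 2)"
    have "z * z - (complex_of_real p + complex_of_real t) * z +
      (complex_of_real p * complex_of_real t - complex_of_real q * complex_of_real r) = 0"
      using s by (auto simp: z_def complex_eq_iff \<Delta>_def power2_eq_square field_simps)
    moreover have "norm z = 1"
      using s \<open>\<Delta> = 1\<close> by (simp add: z_def cmod_def power2_eq_square field_simps)
    ultimately show False using no_unit_root by blast
  qed
  define s where "s = sqrt ((p + t)\<^sup>2 - 4 * \<Delta>)"
  have s: "s * s = (p + t)\<^sup>2 - 4 * \<Delta>" using disc by (simp add: s_def)
  define z1 z2 where "z1 = (p + t + s) / 2" and "z2 = (p + t - s) / 2"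
  have root: "z * z - (p + t) * z + \<Delta> = 0" if "z \<in> {z1, z2}" for z
  proof -
    have "(2 * z - (p + t)) * (2 * z - (p + t)) = s * s"
    proof -
      have "2 * z - (p + t) = s \<or> 2 * z - (p + t) = - s" using that by (auto simp: z1_def z2_def field_simps)
      then show ?thesis by auto
    qed
    moreover have "4 * (z * z - (p + t) * z + \<Delta>)
        = (2 * z - (p + t)) * (2 * z - (p + t)) - ((p + t)\<^sup>2 - 4 * \<Delta>)"
      by (simp add: power2_eq_square algebra_simps)
    ultimately show ?thesis using s by simp
  qed
  have prod: "\<bar>z1\<bar> * \<bar>z2\<bar> = 1"
  proof -
    have "z1 * z2 = \<Delta>" using s by (simp add: z1_def z2_def power2_eq_square field_simps)
    then show ?thesis using \<Delta> by (metis abs_mult)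
  qed
  have ne1: "\<bar>z\<bar> \<noteq> 1" if "z \<in> {z1, z2}" for z
  proof -
    have "complex_of_real (z * z - (p + t) * z + \<Delta>) = 0" using root[OF that] by simp
    then have "norm (complex_of_real z) \<noteq> 1"
      by (intro no_unit_root) (simp add: \<Delta>_def)
    then show ?thesis by simp
  qed
  show thesis
  proof (cases "1 < \<bar>z1\<bar>")
    case True
    show ?thesis
      by (rule that[of z2 z1]) (use True prod root in \<open>auto simp: mult.commute \<Delta>_def p_def q_def r_def t_def\<close>)
  next
    case False
    then have "\<bar>z1\<bar> < 1" using ne1[of z1] by simp
    then have "1 < \<bar>z2\<bar>"
      using prod by (metis abs_ge_zero linorder_not_less mult_le_one mult_less_cancel_right2 mult_strict_mono' nle_le order_less_le mult.right_neutral)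
    then show ?thesis
      by (intro that[of z1 z2]) (use prod root in \<open>auto simp: mult.commute \<Delta>_def p_def q_def r_def t_def\<close>)
  qed
qed

text \<open>Distinct eigenvalues make the eigenvectors independent. \<open>S\<close> and
  \<open>U\<close> are the coordinates in this basis, given by Cramer's rule, and they are
  eigenfunctionals because \<open>A\<close> acts diagonally.\<close>

lemma hyperbolic_eigenbasis:
  assumes "hyperbolic_matrix M"
  defines "A \<equiv> (\<lambda>x :: real^2. int_matrix M *v x)"
  obtains S U :: "real^2 \<Rightarrow> real" and es eu :: "real^2" and \<mu>s \<mu>u :: real
  where "linear S" "linear U" "\<And>x. x = S x *\<^sub>R es + U x *\<^sub>R eu"
    "S es = 1" "S eu = 0" "U es = 0" "U eu = 1"
    "\<And>x. S (A x) = \<mu>s * S x" "\<And>x. U (A x) = \<mu>u * U x" "\<bar>\<mu>s\<bar> * \<bar>\<mu>u\<bar> = 1" "1 < \<bar>\<mu>u\<bar>"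
proof -
  obtain \<mu>s \<mu>u :: real where \<mu>: "\<bar>\<mu>s\<bar> * \<bar>\<mu>u\<bar> = 1" "1 < \<bar>\<mu>u\<bar>" and
    root: "\<And>\<mu>. \<mu> \<in> {\<mu>s, \<mu>u} \<Longrightarrow> \<mu> * \<mu> - (of_int (M $ 1 $ 1) + of_int (M $ 2 $ 2)) * \<mu> +
      (of_int (M $ 1 $ 1) * of_int (M $ 2 $ 2) - of_int (M $ 1 $ 2) * of_int (M $ 2 $ 1)) = 0"
    using hyperbolic_eigenvalues[OF assms(1)] by metis
  have ev: "\<exists>e. e \<noteq> 0 \<and> A e = \<mu> *\<^sub>R e" if \<mu>: "\<mu> \<in> {\<mu>s, \<mu>u}" for \<mu>
  proof -
    obtain x y where xy: "x \<noteq> 0 \<or> y \<noteq> 0"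
      "of_int (M $ 1 $ 1) * x + of_int (M $ 1 $ 2) * y = \<mu> * x"
      "of_int (M $ 2 $ 1) * x + of_int (M $ 2 $ 2) * y = \<mu> * y"
      using eigenvector_2[OF root[OF \<mu>]] by blast
    define e :: "real^2" where "e = vector [x, y]"
    have "e \<noteq> 0" using xy(1) by (auto simp: e_def vec_eq_iff forall_2)
    moreover have "A e = \<mu> *\<^sub>R e"
      using xy(2,3) by (simp add: A_def vec_eq_iff forall_2 int_matrix_vector e_def)
    ultimately show ?thesis by blast
  qed
  obtain es where es: "es \<noteq> 0" "A es = \<mu>s *\<^sub>R es" using ev by blast
  obtain eu where eu: "eu \<noteq> 0" "A eu = \<mu>u *\<^sub>R eu" using ev by blast
  have ne: "\<mu>s \<noteq> \<mu>u" using \<mu> by (metis less_1_mult less_irrefl)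
  have linA: "linear A" unfolding A_def by (rule matrix_vector_mul_linear)
  define \<Delta> where "\<Delta> = es $ 1 * eu $ 2 - es $ 2 * eu $ 1"
  have "\<Delta> \<noteq> 0"
  proof
    assume "\<Delta> = 0"
    then have d: "es $ 1 * eu $ 2 = es $ 2 * eu $ 1" by (simp add: \<Delta>_def)
    have "\<exists>c. eu = c *\<^sub>R es"
    proof (cases "es $ 1 = 0")
      case True
      then have "es $ 2 \<noteq> 0" using es(1) by (auto simp: vec_eq_iff forall_2)
      then show ?thesis using d True
        by (intro exI[of _ "eu $ 2 / es $ 2"]) (simp add: vec_eq_iff forall_2)
    next
      case False
      then show ?thesis using d
        by (intro exI[of _ "eu $ 1 / es $ 1"]) (simp add: vec_eq_iff forall_2 field_simps)
    qed
    then obtain c where c: "eu = c *\<^sub>R es" by blast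
    have "A eu = \<mu>s *\<^sub>R eu"
      unfolding c using es(2) linear_scale[OF linA, of c es] by (simp add: mult.commute)
    then have "\<mu>u *\<^sub>R eu = \<mu>s *\<^sub>R eu" using eu(2) by metis
    then show False using ne eu(1) by simp
  qed
  define S where "S x = (x $ 1 * eu $ 2 - x $ 2 * eu $ 1) / \<Delta>" for x :: "real^2"
  define U where "U x = (es $ 1 * x $ 2 - es $ 2 * x $ 1) / \<Delta>" for x :: "real^2"
  have lin: "linear S" "linear U"
    by (auto intro!: linearI simp: S_def U_def algebra_simps add_divide_distrib diff_divide_distrib)
  have dual: "S es = 1" "S eu = 0" "U es = 0" "U eu = 1"
    using \<open>\<Delta> \<noteq> 0\<close> by (simp_all add: S_def U_def \<Delta>_def)
  have basis: "x = S x *\<^sub>R es + U x *\<^sub>R eu" for x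
  proof -
    have "\<Delta> * x $ i = (x $ 1 * eu $ 2 - x $ 2 * eu $ 1) * es $ i + (es $ 1 * x $ 2 - es $ 2 * x $ 1) * eu $ i" for i
      using exhaust_2[of i] by (auto simp: \<Delta>_def algebra_simps)
    then have "\<Delta> * x $ i / \<Delta> = S x * es $ i + U x * eu $ i" for i
      by (simp add: S_def U_def add_divide_distrib)
    then have "x $ i = S x * es $ i + U x * eu $ i" for i
      using \<open>\<Delta> \<noteq> 0\<close> by (metis nonzero_mult_div_cancel_left)
    then show ?thesis by (simp add: vec_eq_iff)
  qed
  have Ax: "A x = (\<mu>s * S x) *\<^sub>R es + (\<mu>u * U x) *\<^sub>R eu" for x
    by (subst basis[of x]) (simp add: linear_add[OF linA] linear_scale[OF linA] es eu mult.commute)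
  have "S (A x) = \<mu>s * S x" "U (A x) = \<mu>u * U x" for x
    unfolding Ax by (simp_all add: linear_add[OF lin(1)] linear_scale[OF lin(1)]
        linear_add[OF lin(2)] linear_scale[OF lin(2)] dual)
  then show thesis using that[OF lin basis dual _ _ \<mu>] by blast
qed

section \<open>Periodic perturbations\<close>

text \<open>The positive part alone has a corner at \<open>t = 1\<close>; its square is
  differentiable there, because the difference quotient is bounded by the increment, and has a
  Lipschitz derivative.\<close>

lemma DERIV_max_0_square: "((\<lambda>t. (max 0 (1 - t))\<^sup>2) has_real_derivative - 2 * max 0 (1 - t)) (at t)"
proof -
  consider "t < 1" | "t > 1" | "t = 1" by linarith
  then show ?thesis
  proof cases
    case 1
    have "((\<lambda>t. (1 - t)\<^sup>2) has_real_derivative - 2 * max 0 (1 - t)) (at t)"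
      using 1 by (auto intro!: derivative_eq_intros)
    moreover have "\<forall>\<^sub>F x in nhds t. (1 - x)\<^sup>2 = (max 0 (1 - x))\<^sup>2"
      by (rule eventually_mono[OF eventually_nhds_in_open[of "{..<1}" t]]) (use 1 in auto)
    ultimately show ?thesis
      unfolding has_field_derivative_def by (rule has_derivative_transform_nhds)
  next
    case 2
    have "((\<lambda>t. 0) has_real_derivative - 2 * max 0 (1 - t)) (at t)"
      using 2 by simp
    moreover have "\<forall>\<^sub>F x in nhds t. 0 = (max 0 (1 - x))\<^sup>2"
      by (rule eventually_mono[OF eventually_nhds_in_open[of "{1<..}" t]]) (use 2 in auto)
    ultimately show ?thesis
      unfolding has_field_derivative_def by (rule has_derivative_transform_nhds)
  next
    case 3
    have "((\<lambda>h. ((max 0 (1 - (1 + h)))\<^sup>2 - (max 0 (1 - 1))\<^sup>2) / h) \<longlongrightarrow> 0) (at (0::real))"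
    proof (rule Lim_null_comparison)
      show "\<forall>\<^sub>F h in at 0. norm (((max 0 (1 - (1 + h)))\<^sup>2 - (max 0 (1 - 1))\<^sup>2) / h) \<le> \<bar>h\<bar>"
        by (intro always_eventually allI) (auto simp: max_def power2_eq_square)
      show "((\<lambda>h::real. \<bar>h\<bar>) \<longlongrightarrow> 0) (at 0)" by (intro tendsto_rabs_zero tendsto_ident_at)
    qed
    then show ?thesis unfolding 3 by (simp add: DERIV_def)
  qed
qed

text \<open>The profile \<open>\<delta> arctan (t / \<delta>)\<close> has slope \<open>1\<close> at \<open>0\<close>, is increasing, and is uniformly small, so
  after multiplication by a cutoff the slope in the direction \<open>eu\<close> stays almost nonnegative.\<close>

lemma bump:
  fixes S U :: "real^2 \<Rightarrow> real"
  assumes linU: "linear U" and basis: "\<And>x. x = S x *\<^sub>R es + U x *\<^sub>R eu"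
    and dual: "U es = 0" "U eu = 1" and r: "0 < r" and \<omega>: "0 < \<omega>"
  obtains \<beta> \<beta>s \<beta>u :: "real^2 \<Rightarrow> real" where
    "\<And>v. (\<beta> has_derivative (\<lambda>h. \<beta>s v * S h + \<beta>u v * U h)) (at v)"
    "loclip \<beta>s" "loclip \<beta>u"
    "\<And>v. \<bar>\<beta> v\<bar> \<le> \<omega>" "\<And>v. \<bar>\<beta>s v\<bar> \<le> \<omega>" "\<And>v. - \<omega> \<le> \<beta>u v" "\<And>v. \<beta>u v \<le> 1 + \<omega>"
    "\<beta> 0 = 0" "\<beta>s 0 = 0" "\<beta>u 0 = 1"
    "\<And>v. r \<le> norm v \<Longrightarrow> \<beta> v = 0 \<and> \<beta>s v = 0 \<and> \<beta>u v = 0"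
proof -
  define K where "K = 1 + norm es + norm eu"
  have K: "K \<ge> 1" "norm es \<le> K" "norm eu \<le> K" by (simp_all add: K_def)
  \<comment> \<open>The profile is bounded by \<open>2 * \<delta>\<close>, which the first term
    keeps below \<open>\<omega>\<close>. The second absorbs the derivative of the cutoff, which
    contributes at most \<open>8 * \<delta> * K / r\<close>.\<close>
  define \<delta> where "\<delta> = min (\<omega> / 2) (\<omega> * r / (8 * K))"
  have \<delta>: "0 < \<delta>" "2 * \<delta> \<le> \<omega>" "8 * \<delta> * K \<le> \<omega> * r"
  proof -
    show "0 < \<delta>" using \<omega> r K by (simp add: \<delta>_def)
    show "2 * \<delta> \<le> \<omega>" unfolding \<delta>_def by linarith
    have "\<delta> \<le> \<omega> * r / (8 * K)" by (simp add: \<delta>_def)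
    then show "8 * \<delta> * K \<le> \<omega> * r" using K by (simp add: pos_le_divide_eq mult_ac)
  qed
  define q where "q v = max 0 (1 - (v \<bullet> v) / r\<^sup>2)" for v :: "real^2"
  define f where "f v = \<delta> * arctan (U v / \<delta>)" for v
  define f' where "f' v = inverse (1 + (U v / \<delta>)\<^sup>2)" for v
  define \<beta> where "\<beta> v = f v * (q v)\<^sup>2" for v
  \<comment> \<open>The contribution of the cutoff to the derivative in direction \<open>e\<close>.
    Along \<open>es\<close> it is the whole derivative, since the profile depends on
    \<open>U\<close> only and \<open>U es = 0\<close>.\<close>
  define \<gamma> where "\<gamma> e v = f v * (- 2 * q v) * (2 * (v \<bullet> e) / r\<^sup>2)" for e v
  define \<beta>u where "\<beta>u v = f' v * (q v)\<^sup>2 + \<gamma> eu v" for v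
  have blU: "bounded_linear U" using linU by (simp add: linear_conv_bounded_linear)
  have U': "(U has_derivative U) (at v)" for v
    by (rule bounded_linear_imp_has_derivative[OF blU])
  have q01: "0 \<le> q v" "q v \<le> 1" for v by (simp_all add: q_def)
  have q_out: "q v = 0" if "r \<le> norm v" for v
  proof -
    have "r\<^sup>2 \<le> (norm v)\<^sup>2" using that r by (intro power_mono) auto
    then show ?thesis using r by (simp add: q_def power2_norm_eq_inner)
  qed
  have fb: "\<bar>f v\<bar> \<le> 2 * \<delta>" for v
  proof -
    have "\<bar>arctan (U v / \<delta>)\<bar> \<le> 2"
      using arctan_bounded[of "U v / \<delta>"] pi_less_4 by (simp add: abs_le_iff)
    then show ?thesis using \<delta> by (simp add: f_def abs_mult mult.commute)
  qed
  have f'b: "0 \<le> f' v" "f' v \<le> 1" for v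
    by (simp_all add: f'_def inverse_le_1_iff)
  have \<gamma>b: "\<bar>\<gamma> e v\<bar> \<le> \<omega>" if e: "norm e \<le> K" for e v
  proof (cases "r \<le> norm v")
    case True
    then show ?thesis using q_out \<omega> by (simp add: \<gamma>_def)
  next
    case False
    have "\<bar>v \<bullet> e\<bar> \<le> norm v * norm e" by (rule Cauchy_Schwarz_ineq2)
    also have "\<dots> \<le> r * K" using False e r by (intro mult_mono) auto
    finally have ve: "\<bar>v \<bullet> e\<bar> \<le> r * K" .
    have "\<bar>\<gamma> e v\<bar> = \<bar>f v\<bar> * (2 * q v) * (2 * \<bar>v \<bullet> e\<bar> / r\<^sup>2)"
      using q01 by (simp add: \<gamma>_def abs_mult)
    also have "\<dots> \<le> (2 * \<delta>) * (2 * 1) * (2 * (r * K) / r\<^sup>2)"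
      using fb[of v] q01[of v] ve \<delta> r K
      by (intro mult_mono divide_right_mono mult_nonneg_nonneg) auto
    also have "\<dots> = 8 * \<delta> * K / r" using r by (simp add: power2_eq_square)
    also have "\<dots> \<le> \<omega>" using \<delta>(3) r by (simp add: divide_le_eq)
    finally show ?thesis .
  qed
  have lipU: "loclip U" by (rule loclip_bounded_linear[OF blU])
  have lipi: "loclip (\<lambda>v. v \<bullet> e)" for e :: "real^2"
    by (rule loclip_bounded_linear[OF bounded_linear_inner_left])
  have lipvv: "loclip (\<lambda>v :: real^2. v \<bullet> v)"
  proof -
    have "loclip (norm :: real^2 \<Rightarrow> real)"
      by (rule loclip_global[of 1], rule lipschitz_onI) (simp_all add: dist_norm norm_triangle_ineq3)
    then have "loclip (\<lambda>v :: real^2. norm v * norm v)" by (intro loclip_mult)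
    moreover have "norm v * norm v = v \<bullet> v" for v :: "real^2"
      by (metis power2_norm_eq_inner power2_eq_square)
    ultimately show ?thesis by simp
  qed
  have lipq: "loclip q"
  proof -
    have "loclip (\<lambda>v :: real^2. max 0 (1 - (v \<bullet> v) * (1 / r\<^sup>2)))"
      by (intro loclip_max loclip_diff loclip_mult loclip_const lipvv)
    then show ?thesis by (simp add: q_def[abs_def])
  qed
  have lipf: "loclip f"
  proof -
    have "1-lipschitz_on UNIV arctan"
    proof (rule lipschitz_onI)
      fix x y :: real
      have "norm (arctan x - arctan y) \<le> 1 * norm (x - y)"
        by (rule field_differentiable_bound[where S=UNIV and f'="\<lambda>x. inverse (1 + x\<^sup>2)"])
          (auto intro!: DERIV_arctan simp: inverse_le_1_iff abs_of_pos add_pos_nonneg)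
      then show "dist (arctan x) (arctan y) \<le> 1 * dist x y" by (simp add: dist_norm)
    qed simp
    then have "loclip (\<lambda>v. arctan (U v * (1 / \<delta>)))"
      by (intro loclip_compose[OF loclip_mult[OF lipU loclip_const]] loclip_global)
    then have "loclip (\<lambda>v. \<delta> * arctan (U v * (1 / \<delta>)))" by (intro loclip_mult loclip_const)
    then show ?thesis by (simp add: f_def[abs_def])
  qed
  have lipf': "loclip f'"
  proof -
    have "loclip (\<lambda>v. inverse (1 + (U v * (1 / \<delta>)) * (U v * (1 / \<delta>))))"
    proof (rule loclip_inverse)
      show "loclip (\<lambda>v. 1 + (U v * (1 / \<delta>)) * (U v * (1 / \<delta>)))"
        by (intro loclip_add loclip_mult loclip_const lipU)
      show "1 + (U v * (1 / \<delta>)) * (U v * (1 / \<delta>)) \<noteq> 0" for v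
        using zero_le_square[of "U v * (1 / \<delta>)"] by linarith
    qed
    then show ?thesis by (simp add: f'_def[abs_def] power2_eq_square)
  qed
  have lip\<gamma>: "loclip (\<gamma> e)" for e
  proof -
    have "loclip (\<lambda>v. f v * (- 2 * q v) * ((v \<bullet> e) * (2 / r\<^sup>2)))"
      by (intro loclip_mult loclip_const lipf lipq lipi)
    then show ?thesis by (simp add: \<gamma>_def[abs_def] mult.commute)
  qed
  show thesis
  proof (rule that[of \<beta> "\<gamma> es" \<beta>u])
    fix v
    have df: "(f has_derivative (\<lambda>h. f' v * U h)) (at v)"
    proof -
      have "((\<lambda>v. U v / \<delta>) has_derivative (\<lambda>h. U h / \<delta>)) (at v)"
        using \<delta>(1) by (auto intro!: derivative_eq_intros U')
      from DERIV_compose_FDERIV[OF DERIV_arctan this]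
      have "((\<lambda>v. arctan (U v / \<delta>)) has_derivative (\<lambda>h. (U h / \<delta>) * f' v)) (at v)"
        by (simp add: f'_def)
      from has_derivative_mult_right[OF this, of \<delta>] show ?thesis
        using \<delta>(1) by (simp add: f_def[abs_def] mult.commute)
    qed
    have dq: "((\<lambda>v. (q v)\<^sup>2) has_derivative (\<lambda>h. (2 * (v \<bullet> h) / r\<^sup>2) * (- 2 * q v))) (at v)"
    proof -
      have "((\<lambda>v. (v \<bullet> v) / r\<^sup>2) has_derivative (\<lambda>h. 2 * (v \<bullet> h) / r\<^sup>2)) (at v)"
      proof -
        have "((\<lambda>v. v \<bullet> v) has_derivative (\<lambda>h. v \<bullet> h + h \<bullet> v)) (at v)"
          by (rule has_derivative_inner[OF has_derivative_ident has_derivative_ident])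
        from has_derivative_mult_left[OF this, of "1 / r\<^sup>2"] show ?thesis by (simp add: inner_commute)
      qed
      from DERIV_compose_FDERIV[OF DERIV_max_0_square this] show ?thesis by (simp add: q_def)
    qed
    have "(\<beta> has_derivative (\<lambda>h. f v * ((2 * (v \<bullet> h) / r\<^sup>2) * (- 2 * q v)) + (f' v * U h) * (q v)\<^sup>2)) (at v)"
      unfolding \<beta>_def[abs_def] by (rule has_derivative_mult[OF df dq])
    moreover have "(\<lambda>h. f v * ((2 * (v \<bullet> h) / r\<^sup>2) * (- 2 * q v)) + (f' v * U h) * (q v)\<^sup>2)
      = (\<lambda>h. \<gamma> es v * S h + \<beta>u v * U h)"
    proof
      fix h
      have "v \<bullet> h = S h * (v \<bullet> es) + U h * (v \<bullet> eu)"
        by (subst basis[of h]) (simp add: inner_right_distrib)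
      then show "f v * ((2 * (v \<bullet> h) / r\<^sup>2) * (- 2 * q v)) + (f' v * U h) * (q v)\<^sup>2
          = \<gamma> es v * S h + \<beta>u v * U h"
        by (simp add: \<gamma>_def \<beta>u_def algebra_simps add_divide_distrib)
    qed
    ultimately show "(\<beta> has_derivative (\<lambda>h. \<gamma> es v * S h + \<beta>u v * U h)) (at v)" by metis
    show "\<bar>\<beta> v\<bar> \<le> \<omega>"
    proof -
      have "\<bar>\<beta> v\<bar> \<le> (2 * \<delta>) * 1"
        unfolding \<beta>_def abs_mult using fb[of v] q01[of v] \<delta>
        by (intro mult_mono) (auto simp: power_le_one)
      then show ?thesis using \<delta>(2) by simp
    qed
    show "\<bar>\<gamma> es v\<bar> \<le> \<omega>" by (rule \<gamma>b[OF K(2)])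
    have "0 \<le> f' v * (q v)\<^sup>2" "f' v * (q v)\<^sup>2 \<le> 1"
      using f'b[of v] q01[of v] by (auto intro!: mult_le_one power_le_one)
    then show "- \<omega> \<le> \<beta>u v" "\<beta>u v \<le> 1 + \<omega>"
      using \<gamma>b[OF K(3), of v] unfolding \<beta>u_def by linarith+
    show "\<beta> v = 0 \<and> \<gamma> es v = 0 \<and> \<beta>u v = 0" if "r \<le> norm v"
      using q_out[OF that] by (simp add: \<beta>_def \<gamma>_def \<beta>u_def)
  next
    have "f 0 = 0" by (simp add: f_def linear_0[OF linU])
    then show "\<beta> 0 = 0" "\<gamma> es 0 = 0" "\<beta>u 0 = 1"
      by (simp_all add: \<beta>_def \<gamma>_def \<beta>u_def f'_def q_def linear_0[OF linU])
    show "loclip (\<gamma> es)" by (rule lip\<gamma>)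
    show "loclip \<beta>u" unfolding \<beta>u_def[abs_def] power2_eq_square
      by (intro loclip_add loclip_mult lipf' lipq lip\<gamma>)
  qed
qed

section \<open>Spreading a bump over a lattice-invariant set\<close>

definition periodize :: "(real^2) set \<Rightarrow> real \<Rightarrow> (real^2 \<Rightarrow> real) \<Rightarrow> (real^2 \<Rightarrow> real) \<Rightarrow> real^2 \<Rightarrow> real" where
  "periodize Z r c f x =
    (if \<exists>y\<in>Z. dist x y < r then (let y = (SOME y. y \<in> Z \<and> dist x y < r) in c y * f (x - y)) else 0)"

text \<open>Separation by \<open>3 * r\<close> rather than \<open>2 * r\<close> ensures that each
  ball of radius \<open>r / 2\<close> meets the support of at most one bump.
  \<open>periodize\<close> picks the only centre within \<open>r\<close>, so no infinite sum has to
  be handled.\<close>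

locale separated_periodic_set =
  fixes Z :: "(real^2) set" and r :: real and c :: "real^2 \<Rightarrow> real"
  assumes r: "0 < r" and sep: "\<And>x y. x \<in> Z \<Longrightarrow> y \<in> Z \<Longrightarrow> x \<noteq> y \<Longrightarrow> 3 * r \<le> dist x y"
    and sat: "\<And>x y. torus_rel x y \<Longrightarrow> x \<in> Z \<Longrightarrow> y \<in> Z" and c: "torus_periodic c"
begin

lemma near_unique:
  assumes "x \<in> Z" "y \<in> Z" "dist u x < 3 * r / 2" "dist u y < 3 * r / 2" shows "x = y"
proof (rule ccontr)
  assume "x \<noteq> y"
  then have "3 * r \<le> dist x y" using sep assms by blast
  also have "\<dots> \<le> dist u x + dist u y" by (metis dist_commute dist_triangle)
  finally show False using assms by simp
qed

lemma periodize_near: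
  assumes "y \<in> Z" "dist x y < r" shows "periodize Z r c f x = c y * f (x - y)"
proof -
  have "(SOME y. y \<in> Z \<and> dist x y < r) = y"
  proof (rule some_equality)
    fix y' assume "y' \<in> Z \<and> dist x y' < r"
    then show "y' = y" using near_unique[of y' y x] assms r by linarith
  qed (use assms in blast)
  moreover have "\<exists>y\<in>Z. dist x y < r" using assms by blast
  ultimately show ?thesis by (simp add: periodize_def)
qed

lemma periodize_far: "(\<And>y. y \<in> Z \<Longrightarrow> r \<le> dist x y) \<Longrightarrow> periodize Z r c f x = 0"
  unfolding periodize_def by (metis linorder_not_less)

lemma periodize_on: "y \<in> Z \<Longrightarrow> periodize Z r c f y = c y * f 0"
  using periodize_near[of y y] r by simp

lemma periodize_cases:
  obtains "periodize Z r c f x = 0" | y where "y \<in> Z" "periodize Z r c f x = c y * f (x - y)"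
proof (cases "\<exists>y\<in>Z. dist x y < r")
  case True
  then show ?thesis using that(2) periodize_near by blast
next
  case False
  then show ?thesis using that(1) by (simp add: periodize_def)
qed

text \<open>The witnesses \<open>y\<close> and \<open>b\<close> do not depend on \<open>f\<close>,
  so a bump and its partial derivatives have the same local form near \<open>x0\<close>; regularity
  and the derivative formula are then inherited from a single translate.\<close>

lemma periodize_local:
  obtains y b where "\<And>f x. (\<And>v. r \<le> norm v \<Longrightarrow> f v = 0) \<Longrightarrow> x \<in> ball x0 (r/2) \<Longrightarrow>
    periodize Z r c f x = b * f (x - y)"
proof (cases "\<exists>y\<in>Z. dist x0 y < 3 * r / 2")
  case True
  then obtain y where y: "y \<in> Z" "dist x0 y < 3 * r / 2" by blast
  show thesis
  proof (rule that[of "c y" y])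
    fix f :: "real^2 \<Rightarrow> real" and x assume f: "\<And>v. r \<le> norm v \<Longrightarrow> f v = 0" and x: "x \<in> ball x0 (r/2)"
    show "periodize Z r c f x = c y * f (x - y)"
    proof (cases "dist x y < r")
      case True
      then show ?thesis using periodize_near y by blast
    next
      case False
      have "r \<le> dist x y'" if "y' \<in> Z" for y'
      proof (rule ccontr)
        assume "\<not> r \<le> dist x y'"
        moreover have "dist x0 y' \<le> dist x0 x + dist x y'" by (rule dist_triangle)
        ultimately have "dist x0 y' < 3 * r / 2" using x by simp
        then have "y' = y" using near_unique y that by blast
        then show False using False \<open>\<not> r \<le> dist x y'\<close> by simp
      qed
      then have "periodize Z r c f x = 0" by (rule periodize_far)
      moreover have "f (x - y) = 0" using f False by (simp add: dist_norm)
      ultimately show ?thesis by simp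
    qed
  qed
next
  case False
  show thesis
  proof (rule that[of 0 0])
    fix f :: "real^2 \<Rightarrow> real" and x assume x: "x \<in> ball x0 (r/2)"
    have "r \<le> dist x y" if "y \<in> Z" for y
    proof -
      have "dist x0 y \<le> dist x0 x + dist x y" by (rule dist_triangle)
      moreover have "3 * r / 2 \<le> dist x0 y" using False that by force
      ultimately show ?thesis using x by simp
    qed
    then show "periodize Z r c f x = 0 * f (x - 0)" by (simp add: periodize_far)
  qed
qed

lemma torus_periodic_periodize: "torus_periodic (periodize Z r c f)"
  unfolding torus_periodic_def
proof (intro allI impI)
  have *: "periodize Z r c f x = periodize Z r c f x'" if x: "torus_rel x x'" and y: "y \<in> Z" "dist x y < r" for x x' y
  proof -
    let ?y = "y + (x' - x)"
    have yy: "torus_rel y ?y" using torus_rel_diff[of x' x] torus_rel_diff[of ?y y] torus_rel_sym[OF x]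
      by (simp add: torus_rel_sym)
    then have "?y \<in> Z" using sat y by blast
    moreover have "dist x' ?y = dist x y" by (simp add: dist_norm)
    ultimately have "periodize Z r c f x' = c ?y * f (x' - ?y)" using periodize_near y by metis
    also have "\<dots> = c y * f (x - y)" using torus_periodicD[OF c yy] by simp
    finally show ?thesis using periodize_near[OF y] by simp
  qed
  fix x x' :: "real^2" assume xx: "torus_rel x x'"
  show "periodize Z r c f x = periodize Z r c f x'"
  proof (cases "(\<exists>y\<in>Z. dist x y < r) \<or> (\<exists>y\<in>Z. dist x' y < r)")
    case True
    then show ?thesis
    proof
      assume "\<exists>y\<in>Z. dist x y < r"
      then show ?thesis using *[OF xx] by blast
    next
      assume "\<exists>y\<in>Z. dist x' y < r"
      then show ?thesis using *[OF torus_rel_sym[OF xx]] by fastforce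
    qed
  next
    case False
    then show ?thesis by (simp add: periodize_def)
  qed
qed

lemma loclip_periodize:
  assumes f: "loclip f" and supp: "\<And>v. r \<le> norm v \<Longrightarrow> f v = 0"
  shows "loclip (periodize Z r c f)"
proof (rule loclipI)
  fix x0
  obtain y b where *: "\<And>f x. (\<And>v. r \<le> norm v \<Longrightarrow> f v = 0) \<Longrightarrow> x \<in> ball x0 (r/2) \<Longrightarrow>
    periodize Z r c f x = b * f (x - y)" using periodize_local by metis
  have "loclip (\<lambda>x. x - y)"
    by (rule loclip_global[of 1]) (auto intro!: lipschitz_onI simp: dist_norm)
  then have "loclip (\<lambda>x. b * f (x - y))" by (intro loclip_mult loclip_const loclip_compose[OF _ f])
  then obtain e C where e: "e > 0" "C-lipschitz_on (ball x0 e) (\<lambda>x. b * f (x - y))"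
    unfolding loclip_def by blast
  have "C-lipschitz_on (ball x0 (min e (r/2))) (\<lambda>x. b * f (x - y))"
    by (rule lipschitz_on_subset[OF e(2)]) auto
  then have "C-lipschitz_on (ball x0 (min e (r/2))) (periodize Z r c f)"
    by (rule lipschitz_on_transform) (use *[OF supp] in auto)
  then show "\<exists>e>0. \<exists>C. C-lipschitz_on (ball x0 e) (periodize Z r c f)"
    using e r by (intro exI[of _ "min e (r/2)"]) auto
qed

lemma has_derivative_periodize:
  assumes D: "\<And>v. (\<beta> has_derivative (\<lambda>h. p v * S h + q v * U h)) (at v)"
    and supp: "\<And>v. r \<le> norm v \<Longrightarrow> \<beta> v = 0 \<and> p v = 0 \<and> q v = 0"
  shows "(periodize Z r c \<beta> has_derivative
    (\<lambda>h. periodize Z r c p x * S h + periodize Z r c q x * U h)) (at x)"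
proof -
  obtain y b where *: "\<And>f u. (\<And>v. r \<le> norm v \<Longrightarrow> f v = 0) \<Longrightarrow> u \<in> ball x (r/2) \<Longrightarrow>
    periodize Z r c f u = b * f (u - y)" using periodize_local by metis
  have "((\<lambda>u. u - y) has_derivative (\<lambda>h. h)) (at x)" by (auto intro!: derivative_eq_intros)
  from has_derivative_compose[OF this D]
  have "((\<lambda>u. b * \<beta> (u - y)) has_derivative (\<lambda>h. b * (p (x - y) * S h + q (x - y) * U h))) (at x)"
    by (intro has_derivative_mult_right)
  moreover have "b * p (x - y) = periodize Z r c p x" "b * q (x - y) = periodize Z r c q x"
    using *[of p x] *[of q x] supp r by auto
  ultimately have "((\<lambda>u. b * \<beta> (u - y)) has_derivative
    (\<lambda>h. periodize Z r c p x * S h + periodize Z r c q x * U h)) (at x)"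
    by (simp add: distrib_left flip: mult.assoc)
  moreover have "\<forall>\<^sub>F u in nhds x. b * \<beta> (u - y) = periodize Z r c \<beta> u"
    by (rule eventually_mono[OF eventually_nhds_in_open[of "ball x (r/2)" x]])
      (use r *[of \<beta>] supp in auto)
  ultimately show ?thesis by (rule has_derivative_transform_nhds)
qed

end

text \<open>A point is isolated from the other classes because a finite set is closed in the
  Hausdorff quotient, and from its own translates by the unit gap. Distances are invariant under
  translation, so the minimum over one representative per class works everywhere.\<close>

lemma abs_torus_vimage_separated:
  assumes "finite F"
  obtains r where "0 < r"
    "\<And>x y. abs_torus x \<in> F \<Longrightarrow> abs_torus y \<in> F \<Longrightarrow> x \<noteq> y \<Longrightarrow> 3 * r \<le> dist x y"
proof -
  have *: "\<exists>e>0. \<forall>y. abs_torus y \<in> F \<longrightarrow> y \<noteq> x \<longrightarrow> e \<le> dist x y" for x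
  proof -
    have "closed (F - {abs_torus x})" using assms by (intro finite_imp_closed) auto
    then have "open (abs_torus -` (- (F - {abs_torus x})))" unfolding closed_def open_torus_iff .
    moreover have "x \<in> abs_torus -` (- (F - {abs_torus x}))" by simp
    ultimately obtain e where e: "e > 0" "ball x e \<subseteq> abs_torus -` (- (F - {abs_torus x}))"
      using open_contains_ball by meson
    have "min e 1 \<le> dist x y" if "abs_torus y \<in> F" "y \<noteq> x" for y
    proof (cases "abs_torus y = abs_torus x")
      case True
      then have "1 \<le> dist x y" using torus_rel_separated that by (metis abs_torus_eq_iff)
      then show ?thesis by simp
    next
      case False
      then have "y \<notin> ball x e" using e(2) that by blast
      then show ?thesis by simp
    qed
    then show ?thesis using e(1) by (intro exI[of _ "min e 1"]) auto
  qed
  then obtain e where e: "\<And>x. e x > 0" "\<And>x y. abs_torus y \<in> F \<Longrightarrow> y \<noteq> x \<Longrightarrow> e x \<le> dist x y"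
    by metis
  define R where "R = Min (insert 1 ((\<lambda>t. e (rep_torus t)) ` F))"
  have R: "R > 0" "\<And>t. t \<in> F \<Longrightarrow> R \<le> e (rep_torus t)"
    using assms e(1) by (simp_all add: R_def)
  show thesis
  proof (rule that[of "R / 3"])
    show "0 < R / 3" using R by simp
    fix x y assume xy: "abs_torus x \<in> F" "abs_torus y \<in> F" "x \<noteq> y"
    let ?x = "rep_torus (abs_torus x)"
    let ?y = "y + (?x - x)"
    have "torus_rel ?x x" by (rule torus_rel_rep_abs)
    then have "torus_rel ?y y" using torus_rel_diff[of ?x x] torus_rel_diff[of ?y y] by simp
    then have "abs_torus ?y \<in> F" using xy by (metis abs_torus_eq_iff)
    moreover have "?y \<noteq> ?x" using xy by simp
    ultimately have "e ?x \<le> dist ?x ?y" by (rule e(2))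
    also have "dist ?x ?y = dist x y" by (simp add: dist_norm)
    finally show "3 * (R / 3) \<le> dist x y" using R(2)[OF xy(1)] by simp
  qed
qed

text \<open>The slope is recorded as \<open>c t * s\<close> with \<open>s\<close> between
  \<open>- \<omega>\<close> and \<open>1 + \<omega>\<close> because the two applications have
  coefficients of opposite sign and draw different one-sided bounds from it.\<close>

lemma periodic_perturbation:
  fixes S U :: "real^2 \<Rightarrow> real"
  assumes F: "finite F" and linU: "linear U" and basis: "\<And>x. x = S x *\<^sub>R es + U x *\<^sub>R eu"
    and dual: "U es = 0" "U eu = 1" and \<omega>: "0 < \<omega>" and cM: "\<And>t. t \<in> F \<Longrightarrow> \<bar>c t\<bar> \<le> M" and M: "0 \<le> M"
  obtains \<psi> \<psi>s \<psi>u :: "real^2 \<Rightarrow> real" where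
    "\<forall>x. (\<psi> has_derivative (\<lambda>h. \<psi>s x * S h + \<psi>u x * U h)) (at x)"
    "loclip \<psi>s" "loclip \<psi>u" "torus_periodic \<psi>" "torus_periodic \<psi>s" "torus_periodic \<psi>u"
    "\<forall>x. \<bar>\<psi> x\<bar> \<le> M * \<omega>" "\<forall>x. \<bar>\<psi>s x\<bar> \<le> M * \<omega>"
    "\<forall>x. \<psi>u x = 0 \<or> (\<exists>t\<in>F. \<exists>s. - \<omega> \<le> s \<and> s \<le> 1 + \<omega> \<and> \<psi>u x = c t * s)"
    "\<forall>x. abs_torus x \<in> F \<longrightarrow> \<psi> x = 0 \<and> \<psi>s x = 0 \<and> \<psi>u x = c (abs_torus x)"
proof -
  obtain r where r: "0 < r"
    "\<And>x y. abs_torus x \<in> F \<Longrightarrow> abs_torus y \<in> F \<Longrightarrow> x \<noteq> y \<Longrightarrow> 3 * r \<le> dist x y"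
    using abs_torus_vimage_separated[OF F] by metis
  obtain \<beta> \<beta>s \<beta>u :: "real^2 \<Rightarrow> real" where \<beta>:
    "\<And>v. (\<beta> has_derivative (\<lambda>h. \<beta>s v * S h + \<beta>u v * U h)) (at v)"
    "loclip \<beta>s" "loclip \<beta>u"
    "\<And>v. \<bar>\<beta> v\<bar> \<le> \<omega>" "\<And>v. \<bar>\<beta>s v\<bar> \<le> \<omega>" "\<And>v. - \<omega> \<le> \<beta>u v" "\<And>v. \<beta>u v \<le> 1 + \<omega>"
    "\<beta> 0 = 0" "\<beta>s 0 = 0" "\<beta>u 0 = 1"
    "\<And>v. r \<le> norm v \<Longrightarrow> \<beta> v = 0 \<and> \<beta>s v = 0 \<and> \<beta>u v = 0"
    using bump[OF linU basis dual r(1) \<omega>] by blast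
  define Z where "Z = abs_torus -` F"
  interpret separated_periodic_set Z r "\<lambda>x. c (abs_torus x)"
  proof
    show "y \<in> Z" if "torus_rel x y" "x \<in> Z" for x y
      using that by (simp add: Z_def abs_torus_eq_iff[symmetric])
    show "torus_periodic (\<lambda>x. c (abs_torus x))" by (simp add: torus_periodic_def abs_torus_eq_iff[symmetric])
  qed (use r in \<open>auto simp: Z_def\<close>)
  let ?P = "periodize Z r (\<lambda>x. c (abs_torus x))"
  have bound: "\<bar>?P f x\<bar> \<le> M * \<omega>" if "\<And>v. \<bar>f v\<bar> \<le> \<omega>" for f x
  proof (cases rule: periodize_cases[where f=f and x=x])
    case 1
    then show ?thesis using M \<omega> by simp
  next
    case (2 y)
    then have "\<bar>c (abs_torus y)\<bar> * \<bar>f (x - y)\<bar> \<le> M * \<omega>"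
      using cM[of "abs_torus y"] that[of "x - y"] M by (intro mult_mono) (simp_all add: Z_def)
    then show ?thesis using 2(2) by (simp add: abs_mult)
  qed
  show thesis
  proof (rule that[of "?P \<beta>" "?P \<beta>s" "?P \<beta>u"]; (intro allI impI)?)
    show "(?P \<beta> has_derivative (\<lambda>h. ?P \<beta>s x * S h + ?P \<beta>u x * U h)) (at x)" for x
      by (rule has_derivative_periodize[OF \<beta>(1) \<beta>(11)])
    show "loclip (?P \<beta>s)" "loclip (?P \<beta>u)"
      using loclip_periodize \<beta>(2,3,11) by blast+
    show "\<bar>?P \<beta> x\<bar> \<le> M * \<omega>" "\<bar>?P \<beta>s x\<bar> \<le> M * \<omega>" for x
      using bound \<beta>(4,5) by blast+
    show "?P \<beta>u x = 0 \<or> (\<exists>t\<in>F. \<exists>s. - \<omega> \<le> s \<and> s \<le> 1 + \<omega> \<and> ?P \<beta>u x = c t * s)" for x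
    proof (cases rule: periodize_cases[where f=\<beta>u and x=x])
      case (2 y)
      then show ?thesis using \<beta>(6,7)[of "x - y"] by (auto simp: Z_def)
    qed simp
    show "?P \<beta> x = 0 \<and> ?P \<beta>s x = 0 \<and> ?P \<beta>u x = c (abs_torus x)" if "abs_torus x \<in> F" for x
    proof -
      have "x \<in> Z" using that by (simp add: Z_def)
      then show ?thesis using periodize_on \<beta>(8-10) by simp
    qed
  qed (rule torus_periodic_periodize)+
qed

section \<open>Periodic orbits and the choice of constants\<close>

lemma orbit_prod_root:
  fixes \<mu> x :: real
  assumes "0 < n" "0 < x" "\<And>i. i < n \<Longrightarrow> \<bar>\<mu> * v i\<bar> = x"
  shows "\<bar>\<Prod>i<n. \<mu> * v i\<bar> powr (1 / real n) = x"
proof -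
  have "\<bar>\<Prod>i<n. \<mu> * v i\<bar> = (\<Prod>i<n. x)" using assms(3) by (simp add: abs_prod)
  also have "\<dots> = x powr real n" using assms(2) by (simp add: powr_realpow)
  finally show ?thesis using assms(1,2) by (simp add: powr_powr)
qed

text \<open>Bumps must sit on complete orbits, since the eigenvalue is a product over a whole
  period. Periodicity makes the orbits finite and every point a positive iterate of itself, so
  \<open>L\<close> maps \<open>W\<close> onto itself.\<close>

lemma finite_orbit_closure:
  assumes "finite F" and per: "\<forall>p\<in>F. periodic_point L p"
  defines "W \<equiv> (\<Union>p\<in>F. range (\<lambda>n. (L ^^ n) p))"
  shows "finite W" and "F \<subseteq> W" and "L ` W = W"
proof -
  have fin: "finite (range (\<lambda>n. (L ^^ n) p))" if "p \<in> F" for p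
  proof -
    obtain m where m: "m > 0" "(L ^^ m) p = p" using per \<open>p \<in> F\<close> by (auto simp: periodic_point_def)
    have "(L ^^ n) p = (L ^^ (n mod m)) p" for n
      using funpow_mod_eq[OF m(2)] by metis
    then have "range (\<lambda>n. (L ^^ n) p) \<subseteq> (\<lambda>n. (L ^^ n) p) ` {..<m}"
      using m(1) by (metis (no_types, lifting) image_subsetI imageI lessThan_iff mod_less_divisor)
    then show ?thesis using finite_subset by blast
  qed
  then show "finite W" unfolding W_def using assms(1) by blast
  show "F \<subseteq> W"
  proof
    fix p assume "p \<in> F"
    moreover have "p = (L ^^ 0) p" by simp
    ultimately show "p \<in> W" unfolding W_def by blast
  qed
  show "L ` W = W"
  proof
    show "L ` W \<subseteq> W"
    proof (rule image_subsetI)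
      fix t assume "t \<in> W"
      then obtain p n where "p \<in> F" "t = (L ^^ n) p" by (auto simp: W_def)
      then have "p \<in> F" "L t = (L ^^ Suc n) p" by simp_all
      then show "L t \<in> W" unfolding W_def by blast
    qed
    show "W \<subseteq> L ` W"
    proof
      fix t assume "t \<in> W"
      then obtain p n where pn: "p \<in> F" "t = (L ^^ n) p" by (auto simp: W_def)
      obtain m where m: "m > 0" "(L ^^ m) p = p" using per pn by (auto simp: periodic_point_def)
      have "t = (L ^^ (n + m)) p" using m pn by (simp add: funpow_add)
      also have "\<dots> = L ((L ^^ (n + m - 1)) p)"
        using m(1) by (metis Suc_diff_1 add_gr_0 comp_apply funpow.simps(2))
      finally show "t \<in> L ` W" using pn unfolding W_def by blast
    qed
  qed
qed

lemma orbit_iff_funpow: "q \<in> orbit L p \<longleftrightarrow> (\<exists>n>0. q = (L ^^ n) p)"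
  unfolding orbit_altdef by blast

text \<open>\<open>F\<close> may contain only some points of an orbit, while values are needed at
  all of them. A point takes the value at some member of \<open>F\<close> whose orbit contains it;
  the compatibility hypothesis makes the choice immaterial.\<close>

lemma orbit_constant_extension:
  assumes per: "\<forall>p\<in>F. periodic_point L p"
    and a: "\<forall>p\<in>F. \<forall>q\<in>F. q \<in> orbit L p \<longrightarrow> a p = a q"
  obtains a' where "\<And>p n. p \<in> F \<Longrightarrow> a' ((L ^^ n) p) = (a p :: real)"
proof (rule that[of "\<lambda>t. a (SOME p. p \<in> F \<and> (\<exists>n. t = (L ^^ n) p))"])
  fix p n assume p: "p \<in> F"
  define q where "q = (SOME q. q \<in> F \<and> (\<exists>k. (L ^^ n) p = (L ^^ k) q))"
  have "q \<in> F \<and> (\<exists>k. (L ^^ n) p = (L ^^ k) q)"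
    unfolding q_def by (rule someI[of _ p], rule conjI[OF p], rule exI[of _ n], rule refl)
  then obtain k where k: "q \<in> F" "(L ^^ n) p = (L ^^ k) q" by (elim conjE exE)
  obtain m where m: "m > 0" "(L ^^ m) p = p" using per p by (auto simp: periodic_point_def)
  have mm: "(L ^^ (m * j)) p = p" for j
    by (induction j) (simp_all add: funpow_add m(2))
  \<comment> \<open>A multiple of a period that exceeds \<open>n\<close>: hence
    \<open>(L ^^ n) p\<close> returns to \<open>p\<close> after a positive number of further steps,
    as \<open>orbit\<close> counts positive iterates only.\<close>
  have less: "n < m * (n + 1)"
  proof -
    have "1 * (n + 1) \<le> m * (n + 1)" using m(1) by (intro mult_le_mono1) simp
    then show ?thesis by (rule less_le_trans[rotated]) simp
  qed
  then have "n \<le> m * (n + 1)" by (rule less_imp_le)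
  then have "(L ^^ (m * (n + 1) - n + n)) p = p" by (simp only: le_add_diff_inverse2 mm)
  then have "(L ^^ (m * (n + 1) - n)) ((L ^^ n) p) = p" by (simp only: funpow_add comp_apply)
  then have "p = (L ^^ (m * (n + 1) - n + k)) q" by (simp only: funpow_add comp_apply k(2))
  moreover have "m * (n + 1) - n + k > 0" using less by linarith
  ultimately have "p \<in> orbit L q"
    unfolding orbit_iff_funpow by (intro exI[of _ "m * (n + 1) - n + k"] conjI)
  then show "a (SOME q. q \<in> F \<and> (\<exists>k. (L ^^ n) p = (L ^^ k) q)) = a p"
  proof -
    have "a q = a p" using a[rule_format, OF k(1) p \<open>p \<in> orbit L q\<close>] .
    then show ?thesis unfolding q_def .
  qed
qed

theorem corollary1:
  fixes L :: "torus \<Rightarrow> torus" and F :: "torus set" and a b :: "torus \<Rightarrow> real"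
  assumes "hyperbolic_automorphism L"
    and "finite F" and "\<forall>p\<in>F. periodic_point L p"
    and "\<forall>p\<in>F. a p > 0 \<and> b p > 0"
    and "\<forall>p\<in>F. \<forall>q\<in>F. q \<in> orbit L p \<longrightarrow> a p = a q \<and> b p = b q"
  shows "\<exists>(X :: torus topology) (A :: (torus, real^2) chart set) g \<alpha> Es Eu h (P\<^sub>u :: real) (P\<^sub>s :: real).
    0 < \<alpha> \<and> \<alpha> < 1 \<and> anosov_diffeo \<alpha> X A g Es Eu \<and>
    (\<forall>x\<in>topspace X. dim (Es x) = 1 \<and> dim (Eu x) = 1) \<and>
    homeomorphic_map euclidean X h \<and> g \<circ> h = h \<circ> L \<and>
    (\<forall>p\<in>F. let n = least_power L p in
       \<bar>periodic_eigenvalue A g Eu (h p)\<bar> powr (1 / real n) = exp (- P\<^sub>u) * a p \<and>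
       \<bar>periodic_eigenvalue A g Es (h p)\<bar> powr (1 / real n) = exp P\<^sub>s * b p)"
proof -
  obtain M where M: "hyperbolic_matrix M" "L = toral_map M"
    using assms(1) by (auto simp: hyperbolic_automorphism_def)
  obtain N where N: "M ** N = mat 1" "N ** M = mat 1"
    using M(1) unfolding hyperbolic_matrix_def invertible_def by blast
  define A Ai where "A = (\<lambda>x :: real^2. int_matrix M *v x)" and "Ai = (\<lambda>x :: real^2. int_matrix N *v x)"
  have AAi: "A (Ai x) = x" and AiA: "Ai (A x) = x" for x
    by (simp_all add: A_def Ai_def matrix_vector_mul_assoc int_matrix_mult[symmetric] N int_matrix_id)
  have equi: "torus_equivariant A" "torus_equivariant Ai"
    unfolding A_def Ai_def by (rule torus_equivariant_int_matrix)+
  have L: "L = torus_map A" using M(2) by (simp add: toral_map_eq A_def)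
  have Labs: "L (abs_torus x) = abs_torus (A x)" for x
    unfolding L by (rule torus_liftD[OF torus_lift_map[OF equi(1)]])
  have Lpow: "(L ^^ n) (abs_torus x) = abs_torus ((A ^^ n) x)" for n x
    unfolding L by (rule torus_liftD[OF torus_lift_funpow[OF torus_lift_map[OF equi(1)]]])
  obtain S U :: "real^2 \<Rightarrow> real" and es eu :: "real^2" and \<mu>s \<mu>u :: real where
    lin: "linear S" "linear U" and basis: "\<And>x. x = S x *\<^sub>R es + U x *\<^sub>R eu"
    and dual: "S es = 1" "S eu = 0" "U es = 0" "U eu = 1"
    and SA: "\<And>x. S (A x) = \<mu>s * S x" and UA: "\<And>x. U (A x) = \<mu>u * U x"
    and \<mu>: "\<bar>\<mu>s\<bar> * \<bar>\<mu>u\<bar> = 1" "1 < \<bar>\<mu>u\<bar>"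
    using hyperbolic_eigenbasis[OF M(1)] unfolding A_def by blast

  define W where "W = (\<Union>p\<in>F. range (\<lambda>n. (L ^^ n) p))"
  have W: "finite W" "F \<subseteq> W" "L ` W = W"
    using finite_orbit_closure[OF assms(2,3)] unfolding W_def by blast+
  obtain a' where a': "\<And>p n. p \<in> F \<Longrightarrow> a' ((L ^^ n) p) = a p"
    using orbit_constant_extension[OF assms(3), of a] assms(5) by blast
  obtain b' where b': "\<And>p n. p \<in> F \<Longrightarrow> b' ((L ^^ n) p) = b p"
    using orbit_constant_extension[OF assms(3), of b] assms(5) by blast
  have pos: "0 < a' t" "0 < b' t" if "t \<in> W" for t
    using that a' b' assms(4) unfolding W_def by auto

  define \<Lambda> where "\<Lambda> = \<bar>\<mu>u\<bar>"
  have \<Lambda>: "1 < \<Lambda>" "\<bar>\<mu>s\<bar> = 1 / \<Lambda>" using \<mu> by (auto simp: \<Lambda>_def field_simps)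
  \<comment> \<open>Dividing by a lower bound of the unstable and an upper bound of the stable data
    gives \<open>cu\<close> nonnegative and \<open>cs\<close> nonpositive; the factors go into
    \<open>Pu\<close> and \<open>Ps\<close>. The inserted 1 covers an empty
    \<open>W\<close>.\<close>
  define a0 where "a0 = Min (insert 1 (a' ` W))"
  define b0 where "b0 = Max (insert 1 (b' ` W))"
  have a0: "0 < a0" "\<And>t. t \<in> W \<Longrightarrow> a0 \<le> a' t" using W(1) pos by (simp_all add: a0_def)
  have b0: "0 < b0" "\<And>t. t \<in> W \<Longrightarrow> b' t \<le> b0"
    using W(1) by (auto simp: b0_def intro: less_le_trans[of 0 1])
  define cu where "cu t = a' t / a0 - 1" for t
  define cs where "cs t = b' t / b0 - 1" for t
  define Mu where "Mu = Max (insert 0 (cu ` W))"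
  have cu: "0 \<le> cu t" "\<bar>cu t\<bar> \<le> Mu" if "t \<in> W" for t
  proof -
    show "0 \<le> cu t" using a0 that by (simp add: cu_def)
    moreover have "cu t \<le> Mu" using W(1) that by (simp add: Mu_def)
    ultimately show "\<bar>cu t\<bar> \<le> Mu" by simp
  qed
  have Mu: "0 \<le> Mu" using W(1) by (simp add: Mu_def)
  \<comment> \<open>A lower bound for the wanted factors \<open>1 + cs t\<close>. The locale
    receives \<open>\<sigma> / 2\<close> as \<open>m\<close>, which leaves room for the overshoot of
    the bumps.\<close>
  define \<sigma> where "\<sigma> = Min (insert 1 ((\<lambda>t. b' t / b0) ` W))"
  have \<sigma>: "0 < \<sigma>" "\<sigma> \<le> 1" "\<And>t. t \<in> W \<Longrightarrow> \<sigma> \<le> b' t / b0"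
    using W(1) pos b0(1) by (simp_all add: \<sigma>_def)
  have cs: "\<sigma> - 1 \<le> cs t" "cs t \<le> 0" if "t \<in> W" for t
    using \<sigma>(3)[OF that] b0(2)[OF that] b0(1) by (simp_all add: cs_def)

  \<comment> \<open>The midpoint of \<open>1 / \<Lambda>\<close> and 1, leaving a margin on both
    sides.\<close>
  define \<tau> where "\<tau> = (1 + 1 / \<Lambda>) / 2"
  have \<tau>: "0 < \<tau>" "\<tau> < 1" "1 < \<tau> * \<Lambda>"
    using \<Lambda>(1) by (simp_all add: \<tau>_def field_simps)
  \<comment> \<open>The terms secure, in this order, \<open>\<epsilon> < \<sigma> / 2\<close>, the
    bound \<open>\<tau> * (1 + 2 * \<epsilon>) \<le> 1\<close>, and the surviving expansion
    \<open>1 \<le> \<tau> * (\<Lambda> * (1 - 2 * \<epsilon>))\<close>.\<close>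
  define \<epsilon> where "\<epsilon> = min (\<sigma> / 4) (min ((1 / \<tau> - 1) / 2) ((1 - 1 / (\<tau> * \<Lambda>)) / 2))"
  have \<epsilon>: "0 < \<epsilon>" "\<epsilon> \<le> \<sigma> / 4" "\<tau> * (1 + 2 * \<epsilon>) \<le> 1" "1 \<le> \<tau> * (\<Lambda> * (1 - 2 * \<epsilon>))"
  proof -
    show "0 < \<epsilon>" using \<sigma>(1) \<tau> by (simp add: \<epsilon>_def)
    show "\<epsilon> \<le> \<sigma> / 4" by (simp add: \<epsilon>_def)
    have "\<epsilon> \<le> (1 / \<tau> - 1) / 2"
      unfolding \<epsilon>_def by (rule order_trans[OF min.cobounded2 min.cobounded1])
    then have "1 + 2 * \<epsilon> \<le> 1 / \<tau>" by simp
    then show "\<tau> * (1 + 2 * \<epsilon>) \<le> 1" using \<tau>(1) by (simp add: pos_le_divide_eq mult.commute)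
    have "\<epsilon> \<le> (1 - 1 / (\<tau> * \<Lambda>)) / 2"
      unfolding \<epsilon>_def by (rule order_trans[OF min.cobounded2 min.cobounded2])
    then have "1 / (\<tau> * \<Lambda>) \<le> 1 - 2 * \<epsilon>" by simp
    then have "1 \<le> (1 - 2 * \<epsilon>) * (\<tau> * \<Lambda>)" using \<tau> \<Lambda> by (simp add: pos_divide_le_eq)
    then show "1 \<le> \<tau> * (\<Lambda> * (1 - 2 * \<epsilon>))" by (simp add: mult_ac)
  qed
  \<comment> \<open>The error of a bump is multiplied by a coefficient of size at most
    \<open>Mu\<close> or 1, and in the off-diagonal conditions also by
    \<open>\<Lambda> * \<Lambda>\<close>; the denominator absorbs all of these.\<close>
  define \<omega> where "\<omega> = \<epsilon> / ((Mu + 1) * (\<Lambda> * \<Lambda>))"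
  have LL: "1 \<le> \<Lambda> * \<Lambda>" using mult_mono[of 1 \<Lambda> 1 \<Lambda>] \<Lambda>(1) by simp
  have \<omega>0: "0 < \<omega>" using \<epsilon>(1) Mu LL by (simp add: \<omega>_def)
  have "\<omega> * ((Mu + 1) * (\<Lambda> * \<Lambda>)) = \<epsilon>" using Mu LL \<Lambda>(1) by (simp add: \<omega>_def)
  then have "Mu * \<omega> * (\<Lambda> * \<Lambda>) + \<omega> * (\<Lambda> * \<Lambda>) = \<epsilon>" by (simp add: algebra_simps)
  moreover have "0 \<le> Mu * \<omega> * (\<Lambda> * \<Lambda>)" "0 \<le> \<omega> * (\<Lambda> * \<Lambda>)" using Mu \<omega>0 LL by simp_all
  ultimately have \<omega>LL: "Mu * \<omega> * (\<Lambda> * \<Lambda>) \<le> \<epsilon>" "\<omega> * (\<Lambda> * \<Lambda>) \<le> \<epsilon>" by linarith+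
  have "Mu * \<omega> * 1 \<le> Mu * \<omega> * (\<Lambda> * \<Lambda>)" "\<omega> * 1 \<le> \<omega> * (\<Lambda> * \<Lambda>)"
    using Mu \<omega>0 LL by (intro mult_left_mono; simp)+
  then have \<omega>: "Mu * \<omega> \<le> \<epsilon>" "\<omega> \<le> \<epsilon>" using \<omega>LL by linarith+

  obtain \<psi> \<psi>s \<psi>u :: "real^2 \<Rightarrow> real" where
    \<psi>': "\<forall>x. (\<psi> has_derivative (\<lambda>h. \<psi>s x * S h + \<psi>u x * U h)) (at x)"
    "loclip \<psi>s" "loclip \<psi>u" "torus_periodic \<psi>" "torus_periodic \<psi>s" "torus_periodic \<psi>u"
    "\<forall>x. \<bar>\<psi> x\<bar> \<le> Mu * \<omega>" "\<forall>x. \<bar>\<psi>s x\<bar> \<le> Mu * \<omega>"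
    "\<forall>x. \<psi>u x = 0 \<or> (\<exists>t\<in>W. \<exists>s. - \<omega> \<le> s \<and> s \<le> 1 + \<omega> \<and> \<psi>u x = cu t * s)"
    "\<forall>x. abs_torus x \<in> W \<longrightarrow> \<psi> x = 0 \<and> \<psi>s x = 0 \<and> \<psi>u x = cu (abs_torus x)"
    by (rule periodic_perturbation[where c=cu, OF W(1) lin(2) basis dual(3,4) \<omega>0 cu(2) Mu])
  note \<psi> = \<psi>'[rule_format]
  have cs1: "\<bar>cs t\<bar> \<le> 1" if "t \<in> W" for t using cs[OF that] \<sigma> by linarith
  \<comment> \<open>For the stable bumps the two coordinates exchange roles, so the same
    construction yields a prescribed slope along \<open>es\<close>.\<close>
  have basis': "x = U x *\<^sub>R eu + S x *\<^sub>R es" for x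
    using basis[of x] by (simp only: add.commute)
  obtain \<eta> \<eta>u \<eta>s :: "real^2 \<Rightarrow> real" where
    \<eta>': "\<forall>x. (\<eta> has_derivative (\<lambda>h. \<eta>u x * U h + \<eta>s x * S h)) (at x)"
    "loclip \<eta>u" "loclip \<eta>s" "torus_periodic \<eta>" "torus_periodic \<eta>u" "torus_periodic \<eta>s"
    "\<forall>x. \<bar>\<eta> x\<bar> \<le> 1 * \<omega>" "\<forall>x. \<bar>\<eta>u x\<bar> \<le> 1 * \<omega>"
    "\<forall>x. \<eta>s x = 0 \<or> (\<exists>t\<in>W. \<exists>s. - \<omega> \<le> s \<and> s \<le> 1 + \<omega> \<and> \<eta>s x = cs t * s)"
    "\<forall>x. abs_torus x \<in> W \<longrightarrow> \<eta> x = 0 \<and> \<eta>u x = 0 \<and> \<eta>s x = cs (abs_torus x)"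
    by (rule periodic_perturbation[where c=cs, OF W(1) lin(1) basis' dual(2,1) \<omega>0 cs1 zero_le_one])
  note \<eta> = \<eta>'[rule_format]

  have \<psi>u: "- \<epsilon> \<le> \<psi>u x" for x
  proof (cases "\<psi>u x = 0")
    case False
    then obtain t s where ts: "t \<in> W" "- \<omega> \<le> s" "\<psi>u x = cu t * s" using \<psi>(9) by blast
    \<comment> \<open>As \<open>cu t\<close> is nonnegative, only negative \<open>s\<close> can
      lower the derivative, and \<open>s\<close> is at least \<open>- \<omega>\<close>.\<close>
    have "cu t * (- s) \<le> Mu * \<omega>"
    proof (cases "s \<le> 0")
      case True
      then show ?thesis using cu[OF ts(1)] ts(2) Mu by (intro mult_mono) auto
    next
      case False
      then have "cu t * (- s) \<le> 0" using cu(1)[OF ts(1)] by (intro mult_nonneg_nonpos) auto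
      also have "0 \<le> Mu * \<omega>" using Mu \<omega>0 by simp
      finally show ?thesis .
    qed
    then show ?thesis using \<omega>(1) ts(3) by simp
  qed (use \<epsilon> in simp)
  have \<eta>s: "\<sigma> / 2 \<le> 1 + \<eta>s x" "\<eta>s x \<le> \<epsilon>" for x
  proof -
    have "\<sigma> / 2 \<le> 1 + \<eta>s x \<and> \<eta>s x \<le> \<epsilon>"
    proof (cases "\<eta>s x = 0")
      case False
      then obtain t s where ts: "t \<in> W" "- \<omega> \<le> s" "s \<le> 1 + \<omega>" "\<eta>s x = cs t * s" using \<eta>(9) by blast
      \<comment> \<open>The nonpositive coefficient is \<open>- e\<close> with
        \<open>e \<le> 1 - \<sigma>\<close>. Values of \<open>s\<close> up to
        \<open>1 + \<omega>\<close> therefore lower the factor by at most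
        \<open>1 - \<sigma> + \<omega>\<close>, and negative ones raise it by at most
        \<open>\<omega>\<close>.\<close>
      define e where "e = - cs t"
      have e: "0 \<le> e" "e \<le> 1 - \<sigma>" "e \<le> 1" using cs[OF ts(1)] \<sigma> by (simp_all add: e_def)
      have "e * s \<le> e * (1 + \<omega>)" using e ts by (intro mult_left_mono) auto
      also have "\<dots> = e + e * \<omega>" by (simp add: algebra_simps)
      also have "\<dots> \<le> 1 - \<sigma> + 1 * \<omega>" using e \<omega>0 by (intro add_mono mult_right_mono) auto
      finally have "e * s \<le> 1 - \<sigma> + \<sigma> / 4" using \<omega>(2) \<epsilon>(2) by linarith
      moreover have "e * (- s) \<le> e * \<omega>" using e ts by (intro mult_left_mono) auto
      moreover have "e * \<omega> \<le> 1 * \<omega>" using e \<omega>0 by (intro mult_right_mono) auto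
      moreover have "\<eta>s x = - (e * s)" by (simp add: ts(4) e_def)
      ultimately show ?thesis using \<omega>(2) \<sigma>(1) by simp
    qed (use \<epsilon> \<sigma> in simp)
    then show "\<sigma> / 2 \<le> 1 + \<eta>s x" "\<eta>s x \<le> \<epsilon>" by blast+
  qed

  have inj_L: "inj L"
  proof (rule injI)
    fix s t assume "L s = L t"
    then have "torus_rel (A (rep_torus s)) (A (rep_torus t))"
      using Labs by (metis abs_rep_torus abs_torus_eq_iff)
    then have "torus_rel (rep_torus s) (rep_torus t)"
      using torus_equivariantD[OF equi(2)] by (metis AiA)
    then show "s = t" by (metis abs_rep_torus abs_torus_eq_iff)
  qed
  define P where "P = abs_torus -` W"
  have P: "A x \<in> P" "Ai x \<in> P" if "x \<in> P" for x
  proof -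
    have "L (abs_torus x) \<in> W" using W(3) that by (auto simp: P_def)
    then show "A x \<in> P" by (simp add: P_def Labs)
    have "abs_torus x \<in> L ` W" using W(3) that by (simp add: P_def)
    then obtain t where t: "t \<in> W" "L t = abs_torus x" by force
    have "L (abs_torus (Ai x)) = L t" using t by (simp add: Labs AAi)
    then have "abs_torus (Ai x) = t" using inj_L by (simp add: inj_eq)
    then show "Ai x \<in> P" using t by (simp add: P_def)
  qed

  interpret PA: perturbed_automorphism A Ai S U es eu \<mu>s \<mu>u \<eta> \<eta>s \<eta>u \<psi> \<psi>s \<psi>u P \<epsilon> \<tau> "\<sigma> / 2" "(Mu + 1) * \<omega>"
  proof
    show "A (x + y) = A x + A y" "Ai (x + y) = Ai x + Ai y" "A (c *\<^sub>R x) = c *\<^sub>R A x" "Ai (c *\<^sub>R x) = c *\<^sub>R Ai x" for x y c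
      unfolding A_def Ai_def by (simp_all add: matrix_vector_right_distrib matrix_vector_mult_scaleR)
    show "S (x + y) = S x + S y" "S (c *\<^sub>R x) = c *\<^sub>R S x" "U (x + y) = U x + U y" "U (c *\<^sub>R x) = c *\<^sub>R U x" for x y c
      using lin by (simp_all add: linear_add linear_scale)
    show "(\<eta> has_derivative (\<lambda>h. \<eta>s x * S h + \<eta>u x * U h)) (at x)" for x
      using \<eta>(1)[of x] by (simp add: add.commute)
    show "\<bar>\<eta> x\<bar> \<le> (Mu + 1) * \<omega>" "\<bar>\<psi> x\<bar> \<le> (Mu + 1) * \<omega>" for x
      using \<eta>(7)[of x] \<psi>(7)[of x] mult_nonneg_nonneg[OF Mu less_imp_le[OF \<omega>0]] \<omega>0
      by (simp_all add: distrib_right)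
    show "\<bar>\<eta>u x\<bar> * (\<bar>\<mu>u\<bar> * \<bar>\<mu>u\<bar>) \<le> \<epsilon>" "\<bar>\<psi>s x\<bar> * (\<bar>\<mu>u\<bar> * \<bar>\<mu>u\<bar>) \<le> \<epsilon>" for x
      using mult_right_mono[OF \<eta>(8)[of x], of "\<Lambda> * \<Lambda>"] mult_right_mono[OF \<psi>(8)[of x], of "\<Lambda> * \<Lambda>"] LL \<omega>LL
      unfolding \<Lambda>_def[symmetric] by simp_all
    show "\<epsilon> < \<sigma> / 2" using \<epsilon>(2) \<sigma>(1) by linarith
    show "1 \<le> \<tau> * (\<bar>\<mu>u\<bar> * (1 - 2 * \<epsilon>))" using \<epsilon>(4) by (simp add: \<Lambda>_def)
    show "x = S x *\<^sub>R es + U x *\<^sub>R eu" for x by (rule basis)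
    show "x \<in> P \<Longrightarrow> \<eta> x = 0" "x \<in> P \<Longrightarrow> \<psi> x = 0" "x \<in> P \<Longrightarrow> \<eta>u x = 0" "x \<in> P \<Longrightarrow> \<psi>s x = 0" for x
      using \<psi>(10) \<eta>(10) by (simp_all add: P_def)
    show "(\<psi> has_derivative (\<lambda>h. \<psi>s x * S h + \<psi>u x * U h)) (at x)" for x by (rule \<psi>(1))
  qed (use equi AiA AAi dual SA UA \<mu> \<psi>(2-6) \<eta>(2-6) \<tau> \<epsilon> \<eta>s \<psi>u P in \<open>simp_all only:\<close>)

  obtain Es Eu h where g: "anosov_diffeo (1/2) euclidean torus_atlas (torus_map PA.g) Es Eu"
    "\<And>t. dim (Es t) = 1 \<and> dim (Eu t) = 1"
    "homeomorphic_map euclidean euclidean h" "torus_map PA.g \<circ> h = h \<circ> torus_map A"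
    "\<And>x n. x \<in> P \<Longrightarrow> torus_rel ((A ^^ n) x) x \<Longrightarrow> 0 < n \<Longrightarrow> h (abs_torus x) = abs_torus x \<and>
      periodic_eigenvalue torus_atlas (torus_map PA.g) Eu (abs_torus x)
        = (\<Prod>i<least_power (torus_map A) (abs_torus x). \<mu>u * (1 + \<psi>u ((A ^^ i) x))) \<and>
      periodic_eigenvalue torus_atlas (torus_map PA.g) Es (abs_torus x)
        = (\<Prod>i<least_power (torus_map A) (abs_torus x). \<mu>s * (1 + \<eta>s ((A ^^ i) x)))"
    using PA.anosov_conjugate by blast
  \<comment> \<open>With this choice \<open>\<Lambda> * (1 + cu t)\<close> equals
    \<open>exp (- Pu) * a' t\<close> and \<open>(1 + cs t) / \<Lambda>\<close> equals
    \<open>exp Ps * b' t\<close>.\<close>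
  define Pu where "Pu = - ln (\<Lambda> / a0)"
  define Ps where "Ps = ln (1 / (\<Lambda> * b0))"
  have exps: "exp (- Pu) = \<Lambda> / a0" "exp Ps = 1 / (\<Lambda> * b0)"
    using \<Lambda> a0 b0 by (simp_all add: Pu_def Ps_def)
  have eig: "\<bar>periodic_eigenvalue torus_atlas (torus_map PA.g) Eu (h p)\<bar> powr (1 / real (least_power L p))
        = exp (- Pu) * a p \<and>
      \<bar>periodic_eigenvalue torus_atlas (torus_map PA.g) Es (h p)\<bar> powr (1 / real (least_power L p))
        = exp Ps * b p" if p: "p \<in> F" for p
  proof -
    define x where "x = rep_torus p"
    have px: "p = abs_torus x" by (simp add: x_def)
    have ab: "0 < a p" "0 < b p" using assms(4) p by auto
    have "x \<in> P" using p W(2) px by (auto simp: P_def)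
    obtain m where m: "m > 0" "(L ^^ m) p = p" using assms(3) p by (auto simp: periodic_point_def)
    have "torus_rel ((A ^^ m) x) x"
      using m(2) unfolding px Lpow by (simp add: abs_torus_eq_iff)
    note e = g(5)[OF \<open>x \<in> P\<close> this m(1), folded L px]
    have n: "0 < least_power L p" using least_powerI(2)[OF m(2,1)] .
    have iW: "abs_torus ((A ^^ i) x) = (L ^^ i) p" "(L ^^ i) p \<in> W" for i
      by (simp add: px Lpow) (use p in \<open>unfold W_def, blast\<close>)
    \<comment> \<open>All factors along the orbit have the same absolute value, so the root of their
      product is that value.\<close>
    have "\<bar>\<mu>u * (1 + \<psi>u ((A ^^ i) x))\<bar> = exp (- Pu) * a p" for i
      using \<psi>(10)[of "(A ^^ i) x"] iW a'[OF p] a0(1) ab by (simp add: cu_def exps abs_mult \<Lambda>_def)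
    moreover have "\<bar>\<mu>s * (1 + \<eta>s ((A ^^ i) x))\<bar> = exp Ps * b p" for i
      using \<eta>(10)[of "(A ^^ i) x"] iW b'[OF p] b0(1) ab \<Lambda> by (simp add: cs_def exps abs_mult)
    moreover have "0 < exp (- Pu) * a p" "0 < exp Ps * b p" using ab by simp_all
    moreover have "h p = p" using e by blast
    ultimately show ?thesis using e n orbit_prod_root by simp
  qed
  show ?thesis
    by (rule exI[of _ euclidean], rule exI[of _ torus_atlas], rule exI[of _ "torus_map PA.g"],
        rule exI[of _ "1/2"], rule exI[of _ Es], rule exI[of _ Eu], rule exI[of _ h],
        rule exI[of _ Pu], rule exI[of _ Ps])
      (use g(1-4) eig L in \<open>simp add: Let_def\<close>)
qed

end
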